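(* Let $(X,\omega)$ be a one-connected and integral symplectic manifold, $x_0\in X$, and $\alpha\in C^1(X;S^1)$ a singular one-cochain with $\delta\alpha=jI_\omega$. The group cochain $a_{x_0,\alpha}\in C^2_{\mathrm{grp}}(\mathrm{Symp}(X,\omega);S^1)$ given by $$a_{x_0,\alpha}(g,h)=\int_{x_0}^{h(x_0)}g^*\alpha-\alpha$$ is a cocycle. Moreover, the cohomology class $[a_{x_0,\alpha}]$ does not depend on the choice of $x_0$ and $\alpha$.
   Context: One-connected means connected and simply connected; $(X,\omega)$ is integral if $[\omega]\in H^2(X;\mathbb{R})$ is the image of a class in $H^2(X;\mathbb{Z})$. $S^1=\mathbb{R}/\mathbb{Z}$, $j\colon\mathbb{R}\to S^1$ is the projection, also denoting the induced map on cochains. $I_\omega\in C^2(X;\mathbb{R})$ is the $C^\infty$-singular cochain $I_\omega(s)=\int_s\omega$; integrality guarantees that $\alpha$ with $\delta\alpha=jI_\omega$ exists. For each $g$ in the symplectomorphism group $\mathrm{Symp}(X,\omega)$ the cochain $g^*\alpha-\alpha$ is a singular cocycle, and $\int_{x_0}^{h(x_0)}g^*\alpha-\alpha\in S^1$ denotes its pairing with a path from $x_0$ to $h(x_0)$ (independent of the path since $X$ is one-connected). For a group $G$ and trivial $G$-module $M$, $C^p_{\mathrm{grp}}(G;M)$ is the group of all functions $c\colon G^p\to M$, with $\delta c(g_1,\dots,g_{p+1})=c(g_2,\dots,g_{p+1})+\sum_{i=1}^p(-1)^ic(g_1,\dots,g_ig_{i+1},\dots,g_{p+1})+(-1)^{p+1}c(g_1,\dots,g_p)$;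 its cohomology is $H^*_{\mathrm{grp}}(G;M)$. *)

theory Defs
  imports "HOL-Analysis.Analysis" "HOL-Algebra.Group" "HOL-Homology.Homology"
begin

section \<open>The circle group\<close>

quotient_type circle = real / "\<lambda>x y. x - y \<in> \<int>"
proof (rule equivpI)
  show "reflp (\<lambda>x y::real. x - y \<in> \<int>)"
    by (simp add: reflp_def)
  show "symp (\<lambda>x y::real. x - y \<in> \<int>)"
  proof (rule sympI)
    fix x y :: real
    assume "x - y \<in> \<int>"
    then have "- (x - y) \<in> \<int>" by (rule Ints_minus)
    then show "y - x \<in> \<int>" by simp
  qed
  show "transp (\<lambda>x y::real. x - y \<in> \<int>)"
  proof (rule transpI)
    fix x y z :: real
    assume "x - y \<in> \<int>" "y - z \<in> \<int>"
    then have "(x - y) + (y - z) \<in> \<int>" by (rule Ints_add)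
    then show "x - z \<in> \<int>" by simp
  qed
qed

instantiation circle :: ab_group_add
begin

lift_definition zero_circle :: circle is 0 .

lift_definition plus_circle :: "circle \<Rightarrow> circle \<Rightarrow> circle" is "(+)"
proof -
  fix x x' y y' :: real
  assume "x - x' \<in> \<int>" "y - y' \<in> \<int>"
  then have "(x - x') + (y - y') \<in> \<int>" by (rule Ints_add)
  then show "(x + y) - (x' + y') \<in> \<int>" by (simp add: algebra_simps)
qed

lift_definition uminus_circle :: "circle \<Rightarrow> circle" is uminus
proof -
  fix x x' :: real
  assume "x - x' \<in> \<int>"
  then have "- (x - x') \<in> \<int>" by (rule Ints_minus)
  then show "- x - - x' \<in> \<int>" by (simp add: algebra_simps)
qed

lift_definition minus_circle :: "circle \<Rightarrow> circle \<Rightarrow> circle" is "(-)"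
proof -
  fix x x' y y' :: real
  assume "x - x' \<in> \<int>" "y - y' \<in> \<int>"
  then have "(x - x') - (y - y') \<in> \<int>" by (rule Ints_diff)
  then show "(x - y) - (x' - y') \<in> \<int>" by (simp add: algebra_simps)
qed

instance
proof
  fix a b c :: circle
  show "a + b + c = a + (b + c)" by transfer (simp add: add.assoc)
  show "a + b = b + a" by transfer (simp add: add.commute)
  show "0 + a = a" by transfer simp
  show "- a + a = 0" by transfer simp
  show "a - b = a + - b" by transfer simp
qed

end

lift_definition to_circle :: "real \<Rightarrow> circle" is "\<lambda>x. x" .

lemma to_circle_add: "to_circle (x + y) = to_circle x + to_circle y"
  by transfer simp

lemma to_circle_eq_0_iff: "to_circle x = 0 \<longleftrightarrow> x \<in> \<int>"
  by transfer simp


section \<open>Smooth functions\<close>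

text \<open>
  Smoothness on an open set of a finite-dimensional space, via iterated directional derivatives;
  in finite dimension this is equivalent to the existence and continuity of all higher Frechet
  derivatives.
\<close>

primrec Ck_on :: "nat \<Rightarrow> 'e::real_normed_vector set \<Rightarrow> ('e \<Rightarrow> 'f::real_normed_vector) \<Rightarrow> bool" where
  "Ck_on 0 S f \<longleftrightarrow> continuous_on S f"
| "Ck_on (Suc k) S f \<longleftrightarrow>
     (\<forall>x\<in>S. f differentiable (at x)) \<and>
     (\<forall>v. Ck_on k S (\<lambda>x. frechet_derivative f (at x) v))"

definition smooth_on :: "'e::real_normed_vector set \<Rightarrow> ('e \<Rightarrow> 'f::real_normed_vector) \<Rightarrow> bool" where
  "smooth_on S f \<longleftrightarrow> (\<forall>k. Ck_on k S f)"

text \<open>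
  The same notion for functions of \<open>n\<close> real variables, the variables being the first \<open>n\<close> entries of a
  sequence as in \<^const>\<open>standard_simplex\<close> and \<^const>\<open>Euclidean_space\<close>: all iterated partial derivatives
  exist and are continuous.
\<close>

primrec Ck_vars_on ::
    "nat \<Rightarrow> nat \<Rightarrow> (nat \<Rightarrow> real) set \<Rightarrow> ((nat \<Rightarrow> real) \<Rightarrow> 'f::real_normed_vector) \<Rightarrow> bool" where
  "Ck_vars_on n 0 W F \<longleftrightarrow> continuous_on W F"
| "Ck_vars_on n (Suc k) W F \<longleftrightarrow>
     continuous_on W F \<and>
     (\<forall>i<n. (\<forall>x\<in>W. (\<lambda>t. F (x(i := t))) differentiable (at (x i))) \<and>
            Ck_vars_on n k W (\<lambda>x. vector_derivative (\<lambda>t. F (x(i := t))) (at (x i))))"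

definition smooth_vars_on ::
    "nat \<Rightarrow> (nat \<Rightarrow> real) set \<Rightarrow> ((nat \<Rightarrow> real) \<Rightarrow> 'f::real_normed_vector) \<Rightarrow> bool" where
  "smooth_vars_on n W F \<longleftrightarrow> (\<forall>k. Ck_vars_on n k W F)"


section \<open>Smooth manifolds\<close>

text \<open>
  A manifold is a type \<open>'a\<close> (whose sort will contain \<open>t2_space\<close> and \<open>second_countable_topology\<close>) with
  an atlas of charts \<open>(U, \<phi>)\<close> into a finite-dimensional inner product space \<open>'e\<close>. The class
  \<open>euclidean_space\<close> is not used for \<open>'e\<close> since it excludes dimension zero. The map \<open>\<phi>\<close> is relevant on
  \<open>U\<close> only.
\<close>

type_synonym ('a, 'e) chart = "'a set \<times> ('a \<Rightarrow> 'e)"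

abbreviation chart_dom :: "('a, 'e) chart \<Rightarrow> 'a set" where
  "chart_dom c \<equiv> fst c"

abbreviation chart_map :: "('a, 'e) chart \<Rightarrow> 'a \<Rightarrow> 'e" where
  "chart_map c \<equiv> snd c"

definition chart_inv :: "('a, 'e) chart \<Rightarrow> 'e \<Rightarrow> 'a" where
  "chart_inv c = inv_into (chart_dom c) (chart_map c)"

text \<open>The map \<open>f\<close> read in the charts \<open>c\<close> (source) and \<open>c'\<close> (target), and its domain.\<close>

definition local_rep :: "('a \<Rightarrow> 'a) \<Rightarrow> ('a, 'e) chart \<Rightarrow> ('a, 'e) chart \<Rightarrow> 'e \<Rightarrow> 'e" where
  "local_rep f c c' = chart_map c' \<circ> f \<circ> chart_inv c"

definition local_dom :: "('a \<Rightarrow> 'a) \<Rightarrow> ('a, 'e) chart \<Rightarrow> ('a, 'e) chart \<Rightarrow> 'e set" where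
  "local_dom f c c' = chart_map c ` (chart_dom c \<inter> f -` chart_dom c')"

definition smooth_atlas :: "('a::topological_space, 'e::real_inner) chart set \<Rightarrow> bool" where
  "smooth_atlas A \<longleftrightarrow>
     (\<exists>B::'e set. finite B \<and> span B = UNIV) \<and>
     (\<Union>c\<in>A. chart_dom c) = UNIV \<and>
     (\<forall>c\<in>A. open (chart_dom c) \<and> open (chart_map c ` chart_dom c) \<and>
        homeomorphism (chart_dom c) (chart_map c ` chart_dom c) (chart_map c) (chart_inv c)) \<and>
     (\<forall>c\<in>A. \<forall>c'\<in>A. smooth_on (local_dom id c c') (local_rep id c c'))"

definition smooth_self_map ::
    "('a::topological_space, 'e::real_inner) chart set \<Rightarrow> ('a \<Rightarrow> 'a) \<Rightarrow> bool" where
  "smooth_self_map A f \<longleftrightarrow>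
     continuous_on UNIV f \<and>
     (\<forall>c\<in>A. \<forall>c'\<in>A. smooth_on (local_dom f c c') (local_rep f c c'))"

definition one_connected :: "'a::topological_space set \<Rightarrow> bool" where
  "one_connected S \<longleftrightarrow> connected S \<and> simply_connected S"


section \<open>Symplectic forms and symplectomorphisms\<close>

text \<open>
  A 2-form is given by its local expressions: \<open>\<omega> c p u v\<close> is the value on tangent vectors \<open>u\<close>, \<open>v\<close> of
  \<open>(\<phi>\<inverse>)\<^sup>*\<omega>\<close> at the point \<open>p\<close> of \<open>\<phi>(U)\<close>, for the chart \<open>c = (U, \<phi>)\<close>.
\<close>

type_synonym ('a, 'e) form2 = "('a, 'e) chart \<Rightarrow> 'e \<Rightarrow> 'e \<Rightarrow> 'e \<Rightarrow> real"

text \<open>The condition \<open>f\<^sup>*\<omega> = \<omega>\<close>.\<close>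

definition preserves_form ::
    "('a, 'e::real_normed_vector) chart set \<Rightarrow> ('a, 'e) form2 \<Rightarrow> ('a \<Rightarrow> 'a) \<Rightarrow> bool" where
  "preserves_form A \<omega> f \<longleftrightarrow>
     (\<forall>c\<in>A. \<forall>c'\<in>A. \<forall>p\<in>local_dom f c c'. \<forall>u v.
        (let D = frechet_derivative (local_rep f c c') (at p)
         in \<omega> c' (local_rep f c c' p) (D u) (D v)) = \<omega> c p u v)"

text \<open>For \<open>f = id\<close> it is the transformation rule of the local expressions under change of charts.\<close>

definition smooth_form2 :: "('a, 'e::real_normed_vector) chart set \<Rightarrow> ('a, 'e) form2 \<Rightarrow> bool" where
  "smooth_form2 A \<omega> \<longleftrightarrow>
     (\<forall>c\<in>A. \<forall>p\<in>chart_map c ` chart_dom c. bilinear (\<omega> c p) \<and> (\<forall>u. \<omega> c p u u = 0)) \<and>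
     (\<forall>c\<in>A. \<forall>u v. smooth_on (chart_map c ` chart_dom c) (\<lambda>p. \<omega> c p u v)) \<and>
     preserves_form A \<omega> id"

text \<open>The exterior derivative in a chart, evaluated on constant vector fields.\<close>

definition ext_deriv :: "('e \<Rightarrow> 'e \<Rightarrow> 'e \<Rightarrow> real) \<Rightarrow> 'e::real_normed_vector \<Rightarrow> 'e \<Rightarrow> 'e \<Rightarrow> 'e \<Rightarrow> real" where
  "ext_deriv \<eta> p u v w =
     frechet_derivative (\<lambda>q. \<eta> q v w) (at p) u
   - frechet_derivative (\<lambda>q. \<eta> q u w) (at p) v
   + frechet_derivative (\<lambda>q. \<eta> q u v) (at p) w"

definition symplectic_form :: "('a, 'e::real_normed_vector) chart set \<Rightarrow> ('a, 'e) form2 \<Rightarrow> bool" where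
  "symplectic_form A \<omega> \<longleftrightarrow>
     smooth_form2 A \<omega> \<and>
     (\<forall>c\<in>A. \<forall>p\<in>chart_map c ` chart_dom c.
        (\<forall>u v w. ext_deriv (\<omega> c) p u v w = 0) \<and>
        (\<forall>u. u \<noteq> 0 \<longrightarrow> (\<exists>v. \<omega> c p u v \<noteq> 0)))"

definition symplectic_manifold ::
    "('a::{t2_space,second_countable_topology}, 'e::real_inner) chart set \<Rightarrow> ('a, 'e) form2 \<Rightarrow> bool" where
  "symplectic_manifold A \<omega> \<longleftrightarrow> smooth_atlas A \<and> symplectic_form A \<omega>"

definition Symp ::
    "('a::topological_space, 'e::real_inner) chart set \<Rightarrow> ('a, 'e) form2 \<Rightarrow> ('a \<Rightarrow> 'a) monoid" where
  "Symp A \<omega> =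
     \<lparr>carrier = {g. bij g \<and> smooth_self_map A g \<and> smooth_self_map A (inv_into UNIV g) \<and> preserves_form A \<omega> g},
      monoid.mult = (\<circ>), one = id\<rparr>"


section \<open>Smooth singular cochains\<close>

text \<open>
  A singular simplex is smooth if, read in charts, it extends locally to a smooth function of its
  \<open>p + 1\<close> barycentric coordinates, defined on an open subset of the space of all \<open>(p + 1)\<close>-tuples.
\<close>

definition smooth_simplex ::
    "('a::topological_space, 'e::real_inner) chart set \<Rightarrow> nat \<Rightarrow> ((nat \<Rightarrow> real) \<Rightarrow> 'a) \<Rightarrow> bool" where
  "smooth_simplex A p \<sigma> \<longleftrightarrow>
     singular_simplex p euclidean \<sigma> \<and>
     (\<forall>c\<in>A. \<forall>t\<in>standard_simplex p. \<sigma> t \<in> chart_dom c \<longrightarrow>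
        (\<exists>W F. openin (Euclidean_space (Suc p)) W \<and> t \<in> W \<and> smooth_vars_on (Suc p) W F \<and>
           (\<forall>s\<in>W \<inter> standard_simplex p. \<sigma> s \<in> chart_dom c \<and> F s = chart_map c (\<sigma> s))))"

definition alt_sign :: "nat \<Rightarrow> 'm::ab_group_add \<Rightarrow> 'm" where
  "alt_sign i m = (if even i then m else - m)"

text \<open>Cochains are made total by the value \<open>0\<close> outside the smooth simplices of the given dimension.\<close>

type_synonym ('a, 'm) sing_cochain = "((nat \<Rightarrow> real) \<Rightarrow> 'a) \<Rightarrow> 'm"

definition sing_cochains ::
    "('a::topological_space, 'e::real_inner) chart set \<Rightarrow> nat \<Rightarrow> ('a, 'm::ab_group_add) sing_cochain set" where
  "sing_cochains A p = {c. \<forall>\<sigma>. \<not> smooth_simplex A p \<sigma> \<longrightarrow> c \<sigma> = 0}"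

definition sing_coboundary ::
    "('a::topological_space, 'e::real_inner) chart set \<Rightarrow> nat \<Rightarrow>
      ('a, 'm::ab_group_add) sing_cochain \<Rightarrow> ('a, 'm) sing_cochain" where
  "sing_coboundary A p c =
     (\<lambda>\<sigma>. if smooth_simplex A (Suc p) \<sigma>
          then \<Sum>k\<le>Suc p. alt_sign k (c (singular_face (Suc p) k \<sigma>))
          else 0)"

definition sing_cocycles ::
    "('a::topological_space, 'e::real_inner) chart set \<Rightarrow> nat \<Rightarrow> ('a, 'm::ab_group_add) sing_cochain set" where
  "sing_cocycles A p = {c \<in> sing_cochains A p. sing_coboundary A p c = (\<lambda>_. 0)}"

definition sing_coboundaries ::
    "('a::topological_space, 'e::real_inner) chart set \<Rightarrow> nat \<Rightarrow> ('a, 'm::ab_group_add) sing_cochain set" where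
  "sing_coboundaries A p =
     (case p of 0 \<Rightarrow> {\<lambda>_. 0} | Suc q \<Rightarrow> sing_coboundary A q ` sing_cochains A q)"

text \<open>The cohomology class of a cocycle, as a coset of the group of coboundaries.\<close>

definition sing_class ::
    "('a::topological_space, 'e::real_inner) chart set \<Rightarrow> nat \<Rightarrow>
      ('a, 'm::ab_group_add) sing_cochain \<Rightarrow> ('a, 'm) sing_cochain set" where
  "sing_class A p c = {\<lambda>\<sigma>. c \<sigma> + b \<sigma> | b. b \<in> sing_coboundaries A p}"

definition sing_pullback ::
    "('a::topological_space, 'e::real_inner) chart set \<Rightarrow> nat \<Rightarrow> ('a \<Rightarrow> 'a) \<Rightarrow>
      ('a, 'm::ab_group_add) sing_cochain \<Rightarrow> ('a, 'm) sing_cochain" where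
  "sing_pullback A p g c = (\<lambda>\<sigma>. if smooth_simplex A p \<sigma> then c (simplex_map p g \<sigma>) else 0)"

text \<open>
  For a 2-simplex \<open>\<sigma>\<close>, \<open>\<sigma>\<^sup>*\<omega>\<close> is integrated over the triangle \<open>s, t > 0\<close>, \<open>s + t < 1\<close> with the
  coordinates \<open>(s, t) = (t\<^sub>1, t\<^sub>2)\<close>, oriented by \<open>ds \<and> dt\<close> in accordance with the order of the vertices.
  The triangle is open so that the partial derivatives of \<open>\<sigma>\<close> are two-sided. By the transformation
  rule the integrand does not depend on the chart chosen around \<open>\<sigma>(s, t)\<close>.
\<close>

definition bary :: "real \<Rightarrow> real \<Rightarrow> nat \<Rightarrow> real" where
  "bary s t = (\<lambda>i. if i = 0 then 1 - s - t else if i = 1 then s else if i = 2 then t else 0)"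

definition form_density ::
    "('a, 'e::real_normed_vector) chart set \<Rightarrow> ('a, 'e) form2 \<Rightarrow> ((nat \<Rightarrow> real) \<Rightarrow> 'a) \<Rightarrow>
      real \<Rightarrow> real \<Rightarrow> real" where
  "form_density A \<omega> \<sigma> s t =
     (let c = (SOME c. c \<in> A \<and> \<sigma> (bary s t) \<in> chart_dom c) in
      \<omega> c (chart_map c (\<sigma> (bary s t)))
        (vector_derivative (\<lambda>r. chart_map c (\<sigma> (bary r t))) (at s))
        (vector_derivative (\<lambda>r. chart_map c (\<sigma> (bary s r))) (at t)))"

definition integral_cochain ::
    "('a::topological_space, 'e::real_inner) chart set \<Rightarrow> ('a, 'e) form2 \<Rightarrow> ('a, real) sing_cochain" where
  "integral_cochain A \<omega> =
     (\<lambda>\<sigma>. if smooth_simplex A 2 \<sigma>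
          then integral {(s, t). 0 < s \<and> 0 < t \<and> s + t < 1} (\<lambda>(s, t). form_density A \<omega> \<sigma> s t)
          else 0)"

text \<open>
  The de Rham class of \<open>\<omega>\<close> is represented in smooth singular cohomology by \<^term>\<open>integral_cochain A \<omega>\<close>.
\<close>

definition integral_form ::
    "('a::topological_space, 'e::real_inner) chart set \<Rightarrow> ('a, 'e) form2 \<Rightarrow> bool" where
  "integral_form A \<omega> \<longleftrightarrow>
     (\<exists>z :: ('a, int) sing_cochain. z \<in> sing_cocycles A 2 \<and>
        sing_class A 2 (integral_cochain A \<omega>) = sing_class A 2 (\<lambda>\<sigma>. real_of_int (z \<sigma>)))"

text \<open>
  The pairing of a 1-cochain with a path from \<open>x\<close> to \<open>y\<close>. For cocycles on a one-connected manifold it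
  does not depend on the path.
\<close>

definition vertex :: "nat \<Rightarrow> nat \<Rightarrow> real" where
  "vertex i = (\<lambda>j. if j = i then 1 else 0)"

definition path_pairing ::
    "('a::topological_space, 'e::real_inner) chart set \<Rightarrow> 'a \<Rightarrow> 'a \<Rightarrow> ('a, 'm) sing_cochain \<Rightarrow> 'm" where
  "path_pairing A x y c = c (SOME \<sigma>. smooth_simplex A 1 \<sigma> \<and> \<sigma> (vertex 0) = x \<and> \<sigma> (vertex 1) = y)"


section \<open>Group cohomology with trivial coefficients\<close>

text \<open>A \<open>p\<close>-cochain is a function of lists, with value \<open>0\<close> outside \<open>G\<^sup>p\<close>.\<close>

definition grp_tuples :: "('g, 'b) monoid_scheme \<Rightarrow> nat \<Rightarrow> 'g list set" where
  "grp_tuples G p = {gs. length gs = p \<and> set gs \<subseteq> carrier G}"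

definition grp_cochains :: "('g, 'b) monoid_scheme \<Rightarrow> nat \<Rightarrow> ('g list \<Rightarrow> 'm::ab_group_add) set" where
  "grp_cochains G p = {c. \<forall>gs. gs \<notin> grp_tuples G p \<longrightarrow> c gs = 0}"

text \<open>\<open>merge G i [g\<^sub>1, \<dots>, g\<^sub>n] = [g\<^sub>1, \<dots>, g\<^sub>i g\<^sub>i\<^sub>+\<^sub>1, \<dots>, g\<^sub>n]\<close> for \<open>1 \<le> i < n\<close>; lists are indexed from \<open>0\<close>.\<close>

definition merge :: "('g, 'b) monoid_scheme \<Rightarrow> nat \<Rightarrow> 'g list \<Rightarrow> 'g list" where
  "merge G i gs = take (i - 1) gs @ [(gs ! (i - 1)) \<otimes>\<^bsub>G\<^esub> (gs ! i)] @ drop (i + 1) gs"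

definition grp_coboundary ::
    "('g, 'b) monoid_scheme \<Rightarrow> nat \<Rightarrow> ('g list \<Rightarrow> 'm::ab_group_add) \<Rightarrow> 'g list \<Rightarrow> 'm" where
  "grp_coboundary G p c =
     (\<lambda>gs. if gs \<in> grp_tuples G (Suc p)
           then c (tl gs) + (\<Sum>i = 1..p. alt_sign i (c (merge G i gs))) + alt_sign (Suc p) (c (butlast gs))
           else 0)"

definition grp_cocycles :: "('g, 'b) monoid_scheme \<Rightarrow> nat \<Rightarrow> ('g list \<Rightarrow> 'm::ab_group_add) set" where
  "grp_cocycles G p = {c \<in> grp_cochains G p. grp_coboundary G p c = (\<lambda>_. 0)}"

definition grp_coboundaries :: "('g, 'b) monoid_scheme \<Rightarrow> nat \<Rightarrow> ('g list \<Rightarrow> 'm::ab_group_add) set" where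
  "grp_coboundaries G p =
     (case p of 0 \<Rightarrow> {\<lambda>_. 0} | Suc q \<Rightarrow> grp_coboundary G q ` grp_cochains G q)"

definition grp_class ::
    "('g, 'b) monoid_scheme \<Rightarrow> nat \<Rightarrow> ('g list \<Rightarrow> 'm::ab_group_add) \<Rightarrow> ('g list \<Rightarrow> 'm) set" where
  "grp_class G p c = {\<lambda>gs. c gs + b gs | b. b \<in> grp_coboundaries G p}"


section \<open>The cochain on the symplectomorphism group\<close>

definition symp_cochain ::
    "('a::topological_space, 'e::real_inner) chart set \<Rightarrow> ('a, 'e) form2 \<Rightarrow> 'a \<Rightarrow>
      ('a, circle) sing_cochain \<Rightarrow> ('a \<Rightarrow> 'a) list \<Rightarrow> circle" where
  "symp_cochain A \<omega> x\<^sub>0 \<alpha> =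
     (\<lambda>gs. if gs \<in> grp_tuples (Symp A \<omega>) 2
           then let g = gs ! 0; h = gs ! 1
                in path_pairing A x\<^sub>0 (h x\<^sub>0) (\<lambda>\<sigma>. sing_pullback A 1 g \<alpha> \<sigma> - \<alpha> \<sigma>)
           else 0)"

end

theory Submission
  imports Defs
begin

text \<open>
  For \<open>g\<close> in the symplectomorphism group, \<open>\<theta>\<^sub>g = g\<^sup>*\<alpha> - \<alpha>\<close> is a cocycle because \<open>g\<close> preserves the integral of
  \<open>\<omega>\<close> over 2-simplices, and \<open>\<theta>\<^sub>g\<^sub>h = h\<^sup>*\<theta>\<^sub>g + \<theta>\<^sub>h\<close>. The pairing of a cocycle with paths depends on the end points
  only and is additive, so the cocycle identity follows by integrating this relation from \<open>x\<^sub>0\<close> to \<open>k(x\<^sub>0)\<close>.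
  Passing from \<open>x\<^sub>0\<close> to \<open>x\<^sub>1\<close> changes the cochain by the coboundary of \<open>g \<mapsto> - \<integral> \<theta>\<^sub>g\<close>, integrated from \<open>x\<^sub>0\<close> to \<open>x\<^sub>1\<close>,
  and passing from \<open>\<alpha>\<close> to \<open>\<beta>\<close> by that of \<open>g \<mapsto> - \<integral> (\<beta> - \<alpha>)\<close>, integrated from the base point to its image under \<open>g\<close>.

  Independence of the path is a monodromy argument: in a convex chart domain a smooth cocycle is the
  difference of the values of a function, obtained by integration along segments, and such local
  primitives extend over the square underlying a null homotopy.
\<close>

section \<open>Calculus of the smoothness predicates\<close>

text \<open>A cocycle has values on smooth simplices only, whereas simple connectivity supplies a
  merely continuous null homotopy, whose square cannot be cut into simplices on which the cocycle
  can be evaluated. The way out is the family of germs \<open>D x y\<close>, the values of the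
  cocycle on straight segments in a chart fixed at \<open>x\<close>: they depend on points alone and
  pull back along continuous maps. As \<open>path_pairing\<close> evaluates at a path chosen by
  \<open>SOME\<close>, path independence precedes every computation with it; afterwards, identities
  between pairings of different cocycles are checked on one common path. Existence of smooth paths
  between arbitrary points requires joining arcs without a corner, hence the flat function, which
  brings both arcs to rest at the joint. The signs of the two coboundaries come from the relation
  for composites: the integral of \<theta> of \<open>g\<close> over the image of a path under
  \<open>h\<close>, minus that over the path itself, is the integral of \<theta> of
  \<open>g \<circ> h\<close> minus those of \<theta> of \<open>g\<close> and of \<open>h\<close>,
  which is the coboundary of minus the integral.\<close>

lemma finite_orthogonal_expansion:
  fixes B :: "'e::real_inner set"
  assumes "finite B" "span B = UNIV"
  obtains C :: "'e set" where "finite C" "\<And>v. v = (\<Sum>b\<in>C. ((v \<bullet> b) / (b \<bullet> b)) *\<^sub>R b)"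
proof -
  obtain C where C: "finite C" "span C = span B" "pairwise orthogonal C"
    using basis_orthogonal[OF assms(1)] by blast
  have "v = (\<Sum>b\<in>C. ((v \<bullet> b) / (b \<bullet> b)) *\<^sub>R b)" for v
  proof -
    \<comment> \<open>The remainder \<open>w\<close> is orthogonal to \<open>C\<close>, hence to its
      span, which is everything, hence to itself. Zero vectors in \<open>C\<close> are harmless,
      since division by \<open>0\<close> gives \<open>0\<close>.\<close>
    define w where "w = v - (\<Sum>b\<in>C. ((v \<bullet> b) / (b \<bullet> b)) *\<^sub>R b)"
    have "orthogonal w x" for x
    proof -
      have "\<And>y. y \<in> C \<Longrightarrow> orthogonal w y"
      proof -
        fix y assume y: "y \<in> C"
        have "(\<Sum>b\<in>C. ((v \<bullet> b) / (b \<bullet> b)) *\<^sub>R b) \<bullet> y = (\<Sum>b\<in>C. (v \<bullet> b) / (b \<bullet> b) * (b \<bullet> y))"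
          by (simp add: inner_sum_left)
        also have "\<dots> = (\<Sum>b\<in>C. if b = y then v \<bullet> y else 0)"
        proof (rule sum.cong)
          fix b assume "b \<in> C"
          then show "(v \<bullet> b) / (b \<bullet> b) * (b \<bullet> y) = (if b = y then v \<bullet> y else 0)"
            using C(3) y by (auto simp: pairwise_def orthogonal_def)
        qed simp
        also have "\<dots> = v \<bullet> y" using C(1) y by simp
        finally show "orthogonal w y" by (simp add: w_def orthogonal_def inner_diff_left)
      qed
      moreover have "x \<in> span C" using C assms by simp
      ultimately show ?thesis
        using orthogonal_to_span[of x C w] by (auto simp: orthogonal_commute)
    qed
    then have "w = 0" by (metis orthogonal_self)
    then show ?thesis by (simp add: w_def)
  qed
  with C(1) show ?thesis using that by blast
qed

lemma frechet_derivative_eq: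
  "(f has_derivative f') (at x) \<Longrightarrow> frechet_derivative f (at x) = f'"
  using frechet_derivative_at by metis

text \<open>The derivatives are two-sided; openness makes them depend on the values on
  \<open>S\<close> alone.\<close>

lemma Ck_on_cong:
  assumes "open S" "\<And>x. x \<in> S \<Longrightarrow> f x = g x" "Ck_on k S f"
  shows "Ck_on k S g"
  using assms(2,3)
proof (induction k arbitrary: f g)
  case 0
  then show ?case by (simp cong: continuous_on_cong)
next
  case (Suc k)
  have d: "(g has_derivative frechet_derivative f (at x)) (at x)" if "x \<in> S" for x
  proof -
    have "(f has_derivative frechet_derivative f (at x)) (at x)"
      using Suc.prems(2) that by (auto simp: frechet_derivative_works)
    then show ?thesis
      using has_derivative_transform_within_open[OF _ assms(1) that] Suc.prems(1) by blast
  qed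
  show ?case
    unfolding Ck_on.simps
  proof (intro conjI ballI allI)
    fix x assume "x \<in> S"
    then show "g differentiable at x" using d differentiable_def by blast
  next
    fix v
    show "Ck_on k S (\<lambda>x. frechet_derivative g (at x) v)"
    proof (rule Suc.IH)
      show "Ck_on k S (\<lambda>x. frechet_derivative f (at x) v)" using Suc.prems(2) by simp
      show "frechet_derivative f (at x) v = frechet_derivative g (at x) v" if "x \<in> S" for x
        using frechet_derivative_eq[OF d[OF that]] by simp
    qed
  qed
qed

lemma Ck_on_SucI:
  assumes "open S" "\<And>x. x \<in> S \<Longrightarrow> (f has_derivative f' x) (at x)"
    "\<And>v. Ck_on k S (\<lambda>x. f' x v)"
  shows "Ck_on (Suc k) S f"
  unfolding Ck_on.simps
proof (intro conjI ballI allI)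
  fix x assume "x \<in> S"
  then show "f differentiable at x" using assms(2) differentiable_def by blast
next
  fix v
  show "Ck_on k S (\<lambda>x. frechet_derivative f (at x) v)"
    by (rule Ck_on_cong[OF assms(1) _ assms(3)[of v]])
      (simp add: frechet_derivative_eq[OF assms(2)])
qed

lemma Ck_on_SucD:
  assumes "Ck_on (Suc k) S f"
  shows "\<And>x. x \<in> S \<Longrightarrow> (f has_derivative frechet_derivative f (at x)) (at x)"
    and "\<And>v. Ck_on k S (\<lambda>x. frechet_derivative f (at x) v)"
  using assms by (auto simp: frechet_derivative_works)

lemma Ck_on_Suc_imp: "Ck_on (Suc k) S f \<Longrightarrow> Ck_on k S f"
proof (induction k arbitrary: f)
  case 0
  then show ?case
    by (auto intro!: continuous_at_imp_continuous_on differentiable_imp_continuous_within)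
next
  case (Suc k)
  from Suc.prems show ?case
    unfolding Ck_on.simps(2)[of "Suc k"] Ck_on.simps(2)[of k S f]
    using Suc.IH by blast
qed

lemma Ck_on_imp_continuous_on: "Ck_on k S f \<Longrightarrow> continuous_on S f"
  by (induction k) (auto dest: Ck_on_Suc_imp simp del: Ck_on.simps(2))

lemma Ck_on_subset: "Ck_on k S f \<Longrightarrow> T \<subseteq> S \<Longrightarrow> Ck_on k T f"
  by (induction k arbitrary: f) (auto intro: continuous_on_subset)

text \<open>A composite of maps of the manifold can be read through an intermediate chart only near
  each point; this passes from such neighbourhoods to the whole domain.\<close>

lemma Ck_on_local:
  assumes "\<And>x. x \<in> S \<Longrightarrow> \<exists>U. open U \<and> x \<in> U \<and> Ck_on k U f"
  shows "Ck_on k S f"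
  using assms
proof (induction k arbitrary: f)
  case 0
  have "continuous (at x) f" if "x \<in> S" for x
    using 0[OF that] by (auto simp: continuous_on_eq_continuous_at)
  then show ?case by (simp add: continuous_at_imp_continuous_on)
next
  case (Suc k)
  show ?case
    unfolding Ck_on.simps
  proof (intro conjI ballI allI)
    fix x assume "x \<in> S"
    then show "f differentiable at x" using Suc.prems by auto
  next
    fix v
    show "Ck_on k S (\<lambda>x. frechet_derivative f (at x) v)"
    proof (rule Suc.IH)
      fix x assume "x \<in> S"
      then show "\<exists>U. open U \<and> x \<in> U \<and> Ck_on k U (\<lambda>x. frechet_derivative f (at x) v)"
        using Suc.prems by fastforce
    qed
  qed
qed

lemma Ck_on_const: "open S \<Longrightarrow> Ck_on k S (\<lambda>x. c)"
proof (induction k arbitrary: c)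
  case (Suc k)
  show ?case by (rule Ck_on_SucI[OF Suc.prems]) (auto intro: derivative_eq_intros Suc)
qed simp

lemma Ck_on_add:
  assumes "open S" "Ck_on k S f" "Ck_on k S g"
  shows "Ck_on k S (\<lambda>x. f x + g x)"
  using assms(2,3)
proof (induction k arbitrary: f g)
  case 0
  then show ?case by (auto intro: continuous_intros)
next
  case (Suc k)
  show ?case
  proof (rule Ck_on_SucI[OF assms(1)])
    fix x assume "x \<in> S"
    then show "((\<lambda>x. f x + g x) has_derivative
        (\<lambda>v. frechet_derivative f (at x) v + frechet_derivative g (at x) v)) (at x)"
      using Ck_on_SucD(1)[OF Suc.prems(1)] Ck_on_SucD(1)[OF Suc.prems(2)]
      by (auto intro: has_derivative_add)
  next
    fix v
    show "Ck_on k S (\<lambda>x. frechet_derivative f (at x) v + frechet_derivative g (at x) v)"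
      using Suc Ck_on_SucD(2) by blast
  qed
qed

lemma Ck_on_sum:
  assumes "open S" "\<And>i. i \<in> I \<Longrightarrow> Ck_on k S (f i)"
  shows "Ck_on k S (\<lambda>x. \<Sum>i\<in>I. f i x)"
  using assms(2)
  by (induction I rule: infinite_finite_induct) (auto intro: Ck_on_const Ck_on_add assms(1))

lemma Ck_on_bilinear:
  assumes "open S" "bounded_bilinear pr" "Ck_on k S f" "Ck_on k S g"
  shows "Ck_on k S (\<lambda>x. pr (f x) (g x))"
  using assms(3,4)
proof (induction k arbitrary: f g)
  case 0
  then show ?case by (auto intro: bounded_bilinear.continuous_on[OF assms(2)])
next
  case (Suc k)
  show ?case
  proof (rule Ck_on_SucI[OF assms(1)])
    fix x assume "x \<in> S"
    then show "((\<lambda>x. pr (f x) (g x)) has_derivative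
        (\<lambda>v. pr (f x) (frechet_derivative g (at x) v) + pr (frechet_derivative f (at x) v) (g x))) (at x)"
      using Ck_on_SucD(1)[OF Suc.prems(1)] Ck_on_SucD(1)[OF Suc.prems(2)]
      by (intro bounded_bilinear.FDERIV[OF assms(2)])
  next
    fix v
    show "Ck_on k S (\<lambda>x. pr (f x) (frechet_derivative g (at x) v) + pr (frechet_derivative f (at x) v) (g x))"
      using Suc.prems[THEN Ck_on_Suc_imp] Ck_on_SucD(2)[OF Suc.prems(1)] Ck_on_SucD(2)[OF Suc.prems(2)]
      by (intro Ck_on_add assms(1) Suc.IH)
  qed
qed

text \<open>\<open>Ck_on\<close> iterates derivatives in fixed directions, whereas the chain rule
  differentiates \<open>g\<close> in a direction that varies with \<open>x\<close>. Expanding that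
  direction in a finite orthogonal set gives a finite sum of products, and the induction hypothesis
  applies to the directional derivatives of \<open>g\<close>.\<close>

lemma Ck_on_compose:
  fixes f :: "'d::real_normed_vector \<Rightarrow> 'e::real_inner" and g :: "'e \<Rightarrow> 'f::real_normed_vector"
  assumes B: "finite (B::'e set)" "span B = UNIV"
    and S: "open S" and f: "Ck_on k S f" and g: "Ck_on k T g" and fST: "f ` S \<subseteq> T"
  shows "Ck_on k S (\<lambda>x. g (f x))"
proof -
  obtain C :: "'e set" where C: "finite C" "\<And>v. v = (\<Sum>b\<in>C. ((v \<bullet> b) / (b \<bullet> b)) *\<^sub>R b)"
    using finite_orthogonal_expansion[OF B] by metis
  show ?thesis
    using f g
  proof (induction k arbitrary: g)
    case 0
    then show ?case
      using continuous_on_compose2[of T g S f] fST by auto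
  next
    case (Suc k)
    note fD = Ck_on_SucD[OF Suc.prems(1)] and gD = Ck_on_SucD[OF Suc.prems(2)]
    let ?f' = "\<lambda>x. frechet_derivative f (at x)" and ?g' = "\<lambda>x. frechet_derivative g (at x)"
    show ?case
    proof (rule Ck_on_SucI[OF S])
      fix x assume x: "x \<in> S"
      then have "f x \<in> T" using fST by auto
      have 1: "((\<lambda>x. g (f x)) has_derivative (\<lambda>v. ?g' (f x) (?f' x v))) (at x)"
        by (rule has_derivative_compose[OF fD(1)[OF x] gD(1)[OF \<open>f x \<in> T\<close>]])
      have expand: "?g' (f x) w = (\<Sum>b\<in>C. ((w \<bullet> b) / (b \<bullet> b)) *\<^sub>R ?g' (f x) b)" for w
      proof -
        have lin: "linear (?g' (f x))" using gD(1)[OF \<open>f x \<in> T\<close>] has_derivative_linear by blast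
        show ?thesis
          by (subst C(2)[of w]) (simp add: linear_sum[OF lin] linear_cmul[OF lin])
      qed
      show "((\<lambda>x. g (f x)) has_derivative
          (\<lambda>v. \<Sum>b\<in>C. ((?f' x v \<bullet> b) / (b \<bullet> b)) *\<^sub>R ?g' (f x) b)) (at x)"
        by (rule has_derivative_eq_rhs[OF 1]) (rule ext, rule expand)
    next
      fix v
      show "Ck_on k S (\<lambda>x. \<Sum>b\<in>C. ((?f' x v \<bullet> b) / (b \<bullet> b)) *\<^sub>R ?g' (f x) b)"
      proof (rule Ck_on_sum[OF S])
        fix b
        \<comment> \<open>The coefficient is an inner product with a constant vector, so the
          bilinear rule covers it.\<close>
        have 1: "Ck_on k S (\<lambda>x. ?f' x v \<bullet> (b /\<^sub>R (b \<bullet> b)))"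
          by (rule Ck_on_bilinear[OF S bounded_bilinear_inner fD(2) Ck_on_const[OF S]])
        have 2: "Ck_on k S (\<lambda>x. ?g' (f x) b)"
          by (rule Suc.IH[OF Ck_on_Suc_imp[OF Suc.prems(1)] gD(2)])
        show "Ck_on k S (\<lambda>x. ((?f' x v \<bullet> b) / (b \<bullet> b)) *\<^sub>R ?g' (f x) b)"
          using Ck_on_bilinear[OF S bounded_bilinear_scaleR 1 2] by (simp add: divide_inverse mult.commute)
      qed
    qed
  qed
qed

lemma smooth_on_imp_continuous_on: "smooth_on S f \<Longrightarrow> continuous_on S f"
  unfolding smooth_on_def using Ck_on_imp_continuous_on by blast

lemma smooth_on_has_derivative:
  "smooth_on S f \<Longrightarrow> x \<in> S \<Longrightarrow> (f has_derivative frechet_derivative f (at x)) (at x)"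
  unfolding smooth_on_def using Ck_on_SucD(1) by blast


text \<open>The whole tower of derivatives is given in advance, so induction on the order simply
  passes from \<open>f n\<close> to \<open>f (Suc n)\<close>.\<close>

lemma smooth_on_real_coinduct:
  fixes f :: "nat \<Rightarrow> real \<Rightarrow> 'f::real_normed_vector"
  assumes "open S" "\<And>n x. x \<in> S \<Longrightarrow> (f n has_vector_derivative f (Suc n) x) (at x)"
  shows "smooth_on S (f n)"
proof -
  have "Ck_on k S (f n)" for k
  proof (induction k arbitrary: n)
    case 0
    then show ?case
      using assms(2) has_vector_derivative_continuous continuous_at_imp_continuous_on
      by (metis Ck_on.simps(1))
  next
    case (Suc k)
    show ?case
    proof (rule Ck_on_SucI[OF assms(1)])
      show "(f n has_derivative (\<lambda>v. v *\<^sub>R f (Suc n) x)) (at x)" if "x \<in> S" for x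
        using assms(2)[OF that] by (simp add: has_vector_derivative_def)
      show "Ck_on k S (\<lambda>x. v *\<^sub>R f (Suc n) x)" for v
        by (rule Ck_on_bilinear[OF assms(1) bounded_bilinear_scaleR Ck_on_const[OF assms(1)] Suc])
    qed
  qed
  then show ?thesis by (simp add: smooth_on_def)
qed

section \<open>Functions of finitely many coordinates, on open subsets of the coordinate
  space\<close>

lemma openin_Euclidean_space_iff:
  "openin (Euclidean_space n) W \<longleftrightarrow> (\<exists>V. open V \<and> W = V \<inter> {x. \<forall>i\<ge>n. x i = 0})"
  unfolding Euclidean_space_def openin_subtopology euclidean_product_topology open_openin[symmetric] ..

lemma openin_Euclidean_space_Int_open:
  assumes "openin (Euclidean_space n) W" "open V"
  shows "openin (Euclidean_space n) (W \<inter> V)"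
proof -
  obtain U where "open U" "W = U \<inter> {x. \<forall>i\<ge>n. x i = 0}"
    using assms(1) openin_Euclidean_space_iff by blast
  then have "open (U \<inter> V)" "W \<inter> V = (U \<inter> V) \<inter> {x. \<forall>i\<ge>n. x i = 0}"
    using assms(2) by (simp_all add: Int_ac open_Int)
  then show ?thesis unfolding openin_Euclidean_space_iff by blast
qed

lemma openin_Euclidean_space_preimage:
  assumes "openin (Euclidean_space n) W" "continuous_on W F" "open S"
  shows "openin (Euclidean_space n) {x \<in> W. F x \<in> S}"
proof -
  obtain V where V: "open V" "V \<inter> W = F -` S \<inter> W"
    using assms(2,3) continuous_on_open_invariant by metis
  then have "{x \<in> W. F x \<in> S} = W \<inter> V" by blast
  then show ?thesis using openin_Euclidean_space_Int_open[OF assms(1) V(1)] by simp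
qed

lemma continuous_on_fun_upd2:
  fixes f :: "'b::topological_space \<Rightarrow> 'i \<Rightarrow> 'c::topological_space"
  assumes "continuous_on S f" "continuous_on S g"
  shows "continuous_on S (\<lambda>p. (f p)(i := g p))"
proof (rule continuous_on_coordinatewise_then_product)
  fix j
  show "continuous_on S (\<lambda>p. ((f p)(i := g p)) j)"
    using assms(2) continuous_on_product_then_coordinatewise[OF assms(1), of j]
    by (cases "j = i") simp_all
qed

lemma openin_Euclidean_space_zero:
  "openin (Euclidean_space n) W \<Longrightarrow> x \<in> W \<Longrightarrow> k \<ge> n \<Longrightarrow> x k = 0"
  unfolding openin_Euclidean_space_iff by blast

lemma open_vimage_fun_upd2:
  assumes "openin (Euclidean_space n) W" "i < n" "j < n" "\<forall>k\<ge>n. x k = 0"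
  shows "open {p. x(i := fst p, j := snd p) \<in> W}"
proof -
  obtain V where V: "open V" "W = V \<inter> {x. \<forall>i\<ge>n. x i = 0}"
    using assms(1) openin_Euclidean_space_iff by metis
  have "(x(i := a, j := b)) k = 0" if "k \<ge> n" for k a b
    using assms(2-4) that by simp
  then have "x(i := a, j := b) \<in> W \<longleftrightarrow> x(i := a, j := b) \<in> V" for a b
    unfolding V(2) by blast
  then have "{p. x(i := fst p, j := snd p) \<in> W} = (\<lambda>p. x(i := fst p, j := snd p)) -` V"
    unfolding vimage_def by blast
  moreover have "continuous_on UNIV (\<lambda>p::real \<times> real. x(i := fst p, j := snd p))"
    by (intro continuous_on_fun_upd2 continuous_on_const continuous_on_fst continuous_on_snd continuous_on_id)
  ultimately show ?thesis using open_vimage[OF V(1)] by simp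
qed

lemma open_vimage_fun_upd:
  assumes "openin (Euclidean_space n) W" "x \<in> W" "i < n"
  shows "open {t. x(i := t) \<in> W}"
proof -
  have "\<forall>k\<ge>n. x k = 0" using openin_Euclidean_space_zero[OF assms(1,2)] by blast
  \<comment> \<open>The instance \<open>j = i\<close> of the two-variable statement is used: the
    second update overwrites the first, so the preimage is taken along the diagonal.\<close>
  moreover have "continuous_on UNIV (\<lambda>t::real. (t, t))" by (intro continuous_intros)
  ultimately have "open ((\<lambda>t. (t, t)) -` {p. x(i := fst p, i := snd p) \<in> W})"
    by (intro open_vimage open_vimage_fun_upd2[OF assms(1,3,3)])
  then show ?thesis unfolding vimage_def mem_Collect_eq fst_conv snd_conv fun_upd_upd .
qed

lemma has_vector_derivative_fun_upd_cong:
  assumes W: "openin (Euclidean_space n) W" and x: "x \<in> W" and i: "i < n"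
    and eq: "\<And>y. y \<in> W \<Longrightarrow> F y = G y"
    and F: "((\<lambda>t. F (x(i := t))) has_vector_derivative D) (at (x i))"
  shows "((\<lambda>t. G (x(i := t))) has_vector_derivative D) (at (x i))"
  by (rule has_vector_derivative_transform_within_open[OF F open_vimage_fun_upd[OF W x i]])
    (use x eq in auto)

lemma Ck_vars_on_imp_continuous_on: "Ck_vars_on n k W F \<Longrightarrow> continuous_on W F"
  by (cases k) auto

lemma Ck_vars_on_SucD:
  assumes "Ck_vars_on n (Suc k) W F" "i < n"
  shows "\<And>x. x \<in> W \<Longrightarrow> ((\<lambda>t. F (x(i := t))) has_vector_derivative
      vector_derivative (\<lambda>t. F (x(i := t))) (at (x i))) (at (x i))"
    and "Ck_vars_on n k W (\<lambda>x. vector_derivative (\<lambda>t. F (x(i := t))) (at (x i)))"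
  using assms by (auto simp: vector_derivative_works)

lemma Ck_vars_on_cong:
  assumes W: "openin (Euclidean_space n) W" and "\<And>x. x \<in> W \<Longrightarrow> F x = G x" "Ck_vars_on n k W F"
  shows "Ck_vars_on n k W G"
  using assms(2,3)
proof (induction k arbitrary: F G)
  case 0
  then show ?case by (simp cong: continuous_on_cong)
next
  case (Suc k)
  let ?D = "\<lambda>F i x. vector_derivative (\<lambda>t. F (x(i := t))) (at (x i))"
  have d: "((\<lambda>t. G (x(i := t))) has_vector_derivative ?D F i x) (at (x i))" if "i < n" "x \<in> W" for i x
    by (rule has_vector_derivative_fun_upd_cong[OF W that(2,1) Suc.prems(1)
          Ck_vars_on_SucD(1)[OF Suc.prems(2) that]])
  show ?case
    unfolding Ck_vars_on.simps
  proof (intro conjI ballI allI impI)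
    show "continuous_on W G"
      using Suc.prems by (simp cong: continuous_on_cong)
  next
    fix i x assume "i < n" "x \<in> W"
    then show "(\<lambda>t. G (x(i := t))) differentiable at (x i)"
      using d differentiableI_vector by blast
  next
    fix i assume i: "i < n"
    show "Ck_vars_on n k W (?D G i)"
    proof (rule Suc.IH)
      show "Ck_vars_on n k W (?D F i)" using Ck_vars_on_SucD(2)[OF Suc.prems(2) i] .
      show "?D F i x = ?D G i x" if "x \<in> W" for x
        using vector_derivative_at[OF d[OF i that]] by simp
    qed
  qed
qed

lemma Ck_vars_on_SucI:
  assumes "openin (Euclidean_space n) W" "continuous_on W F"
    "\<And>i x. i < n \<Longrightarrow> x \<in> W \<Longrightarrow> ((\<lambda>t. F (x(i := t))) has_vector_derivative D i x) (at (x i))"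
    "\<And>i. i < n \<Longrightarrow> Ck_vars_on n k W (D i)"
  shows "Ck_vars_on n (Suc k) W F"
  unfolding Ck_vars_on.simps
proof (intro conjI ballI allI impI assms(2))
  fix i x assume "i < n" "x \<in> W"
  then show "(\<lambda>t. F (x(i := t))) differentiable at (x i)"
    using assms(3) differentiableI_vector by blast
next
  fix i assume i: "i < n"
  show "Ck_vars_on n k W (\<lambda>x. vector_derivative (\<lambda>t. F (x(i := t))) (at (x i)))"
    by (rule Ck_vars_on_cong[OF assms(1) _ assms(4)[OF i]])
      (simp add: vector_derivative_at[OF assms(3)[OF i]])
qed

lemma Ck_vars_on_Suc_imp: "Ck_vars_on n (Suc k) W F \<Longrightarrow> Ck_vars_on n k W F"
proof (induction k arbitrary: F)
  case (Suc k)
  show ?case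
    unfolding Ck_vars_on.simps(2)[of n k W F]
  proof (intro conjI allI impI)
    fix i assume i: "i < n"
    show "Ck_vars_on n k W (\<lambda>x. vector_derivative (\<lambda>t. F (x(i := t))) (at (x i)))"
      by (rule Suc.IH[OF Ck_vars_on_SucD(2)[OF Suc.prems i]])
  qed (use Suc.prems in auto)
qed simp

lemma Ck_vars_on_subset: "Ck_vars_on n k W F \<Longrightarrow> V \<subseteq> W \<Longrightarrow> Ck_vars_on n k V F"
  by (induction k arbitrary: F) (auto intro: continuous_on_subset)

lemma Ck_vars_on_const: "openin (Euclidean_space n) W \<Longrightarrow> Ck_vars_on n k W (\<lambda>x. c)"
proof (induction k arbitrary: c)
  case (Suc k)
  show ?case
    by (rule Ck_vars_on_SucI[OF Suc.prems, where D = "\<lambda>_ _. 0"])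
      (simp_all add: Suc)
qed simp

lemma has_vector_derivative_fun_upd_coord:
  fixes x :: "nat \<Rightarrow> real"
  shows "((\<lambda>t. (x(i := t)) j) has_vector_derivative (if i = j then 1 else 0)) (at (x i))"
proof (cases "i = j")
  case True
  then have eq: "(\<lambda>t. (x(i := t)) j) = (\<lambda>t. t)" by simp
  show ?thesis unfolding eq using True by (simp add: has_vector_derivative_id)
next
  case False
  then have eq: "(\<lambda>t. (x(i := t)) j) = (\<lambda>t. x j)" by simp
  show ?thesis unfolding eq using False by simp
qed

lemma Ck_vars_on_coord:
  assumes W: "openin (Euclidean_space n) W"
  shows "Ck_vars_on n k W (\<lambda>x. x j)"
proof (cases k)
  case 0
  have "continuous_on W (\<lambda>x. x j)"
    by (rule continuous_on_subset[OF continuous_on_product_coordinates subset_UNIV])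
  with 0 show ?thesis by simp
next
  case (Suc m)
  have c: "continuous_on W (\<lambda>x. x j)"
    by (rule continuous_on_subset[OF continuous_on_product_coordinates subset_UNIV])
  have "Ck_vars_on n (Suc m) W (\<lambda>x. x j)"
    by (rule Ck_vars_on_SucI[OF W c has_vector_derivative_fun_upd_coord Ck_vars_on_const[OF W]])
  then show ?thesis by (simp only: Suc)
qed

lemma Ck_vars_on_add:
  assumes W: "openin (Euclidean_space n) W" and "Ck_vars_on n k W F" "Ck_vars_on n k W G"
  shows "Ck_vars_on n k W (\<lambda>x. F x + G x)"
  using assms(2,3)
proof (induction k arbitrary: F G)
  case 0
  then show ?case by (auto intro: continuous_intros)
next
  case (Suc k)
  note F = Ck_vars_on_SucD[OF Suc.prems(1)] and G = Ck_vars_on_SucD[OF Suc.prems(2)]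
  show ?case
    by (rule Ck_vars_on_SucI[OF W _ has_vector_derivative_add[OF F(1) G(1)] Suc.IH[OF F(2) G(2)]])
      (use Suc.prems in \<open>auto intro: continuous_intros\<close>)
qed

lemma Ck_vars_on_sum:
  assumes "openin (Euclidean_space n) W" "\<And>i. i \<in> I \<Longrightarrow> Ck_vars_on n k W (F i)"
  shows "Ck_vars_on n k W (\<lambda>x. \<Sum>i\<in>I. F i x)"
  using assms(2)
  by (induction I rule: infinite_finite_induct) (auto intro: Ck_vars_on_const Ck_vars_on_add assms(1))

lemma Ck_vars_on_bilinear:
  assumes W: "openin (Euclidean_space n) W" and b: "bounded_bilinear pr"
    and "Ck_vars_on n k W F" "Ck_vars_on n k W G"
  shows "Ck_vars_on n k W (\<lambda>x. pr (F x) (G x))"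
  using assms(3,4)
proof (induction k arbitrary: F G)
  case 0
  then show ?case by (auto intro: bounded_bilinear.continuous_on[OF b])
next
  case (Suc k)
  note F = Ck_vars_on_SucD[OF Suc.prems(1)] and G = Ck_vars_on_SucD[OF Suc.prems(2)]
  let ?D = "\<lambda>F i x. vector_derivative (\<lambda>t. F (x(i := t))) (at (x i))"
  show ?case
  proof (rule Ck_vars_on_SucI[OF W, where D = "\<lambda>i x. pr (F x) (?D G i x) + pr (?D F i x) (G x)"])
    show "continuous_on W (\<lambda>x. pr (F x) (G x))"
      using Suc.prems by (auto intro: bounded_bilinear.continuous_on[OF b])
  next
    fix i x assume *: "i < n" "x \<in> W"
    show "((\<lambda>t. pr (F (x(i := t))) (G (x(i := t)))) has_vector_derivative
        pr (F x) (?D G i x) + pr (?D F i x) (G x)) (at (x i))"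
      using bounded_bilinear.has_vector_derivative[OF b F(1)[OF *] G(1)[OF *]]
      unfolding fun_upd_triv .
  next
    fix i assume i: "i < n"
    show "Ck_vars_on n k W (\<lambda>x. pr (F x) (?D G i x) + pr (?D F i x) (G x))"
      by (rule Ck_vars_on_add[OF W Suc.IH[OF Ck_vars_on_Suc_imp[OF Suc.prems(1)] G(2)[OF i]]
            Suc.IH[OF F(2)[OF i] Ck_vars_on_Suc_imp[OF Suc.prems(2)]]])
  qed
qed

text \<open>The obstacle and the remedy are those of \<open>Ck_on_compose\<close>: the derivative of
  \<open>g\<close> is taken in a varying direction, which is expanded in a finite orthogonal
  set.\<close>

lemma Ck_vars_on_compose:
  fixes F :: "(nat \<Rightarrow> real) \<Rightarrow> 'e::real_inner" and g :: "'e \<Rightarrow> 'f::real_normed_vector"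
  assumes B: "finite (B::'e set)" "span B = UNIV"
    and W: "openin (Euclidean_space n) W"
    and F: "Ck_vars_on n k W F" and g: "Ck_on k T g" and FWT: "F ` W \<subseteq> T"
  shows "Ck_vars_on n k W (\<lambda>x. g (F x))"
proof -
  obtain C :: "'e set" where C: "finite C" "\<And>v. v = (\<Sum>b\<in>C. ((v \<bullet> b) / (b \<bullet> b)) *\<^sub>R b)"
    using finite_orthogonal_expansion[OF B] by metis
  show ?thesis
    using F g
  proof (induction k arbitrary: g)
    case 0
    then show ?case
      using continuous_on_compose2[of T g W F] FWT by auto
  next
    case (Suc k)
    note FD = Ck_vars_on_SucD[OF Suc.prems(1)] and gD = Ck_on_SucD[OF Suc.prems(2)]
    let ?F' = "\<lambda>i x. vector_derivative (\<lambda>t. F (x(i := t))) (at (x i))"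
      and ?g' = "\<lambda>y. frechet_derivative g (at y)"
    show ?case
    proof (rule Ck_vars_on_SucI[OF W])
      show "continuous_on W (\<lambda>x. g (F x))"
        using continuous_on_compose2[OF Ck_on_imp_continuous_on[OF Suc.prems(2)]
            Ck_vars_on_imp_continuous_on[OF Suc.prems(1)] FWT] .
    next
      fix i x assume i: "i < n" and x: "x \<in> W"
      then have "F x \<in> T" using FWT by auto
      then have "(g has_derivative ?g' (F x)) (at (F (x(i := x i))))" using gD(1) by simp
      from has_derivative_compose[OF FD(1)[OF i x, unfolded has_vector_derivative_def] this]
      have 1: "((\<lambda>t. g (F (x(i := t)))) has_derivative (\<lambda>h. ?g' (F x) (h *\<^sub>R ?F' i x))) (at (x i))" .
      have lin: "linear (?g' (F x))" using gD(1)[OF \<open>F x \<in> T\<close>] has_derivative_linear by blast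
      have expand: "?g' (F x) w = (\<Sum>b\<in>C. ((w \<bullet> b) / (b \<bullet> b)) *\<^sub>R ?g' (F x) b)" for w
        by (subst C(2)[of w]) (simp add: linear_sum[OF lin] linear_cmul[OF lin])
      show "((\<lambda>t. g (F (x(i := t)))) has_vector_derivative
          (\<Sum>b\<in>C. ((?F' i x \<bullet> b) / (b \<bullet> b)) *\<^sub>R ?g' (F x) b)) (at (x i))"
        unfolding has_vector_derivative_def expand[symmetric]
        by (rule has_derivative_eq_rhs[OF 1]) (simp add: linear_cmul[OF lin])
    next
      fix i assume i: "i < n"
      show "Ck_vars_on n k W (\<lambda>x. \<Sum>b\<in>C. ((?F' i x \<bullet> b) / (b \<bullet> b)) *\<^sub>R ?g' (F x) b)"
      proof (rule Ck_vars_on_sum[OF W])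
        fix b
        have 1: "Ck_vars_on n k W (\<lambda>x. ?F' i x \<bullet> (b /\<^sub>R (b \<bullet> b)))"
          by (rule Ck_vars_on_bilinear[OF W bounded_bilinear_inner FD(2)[OF i] Ck_vars_on_const[OF W]])
        have 2: "Ck_vars_on n k W (\<lambda>x. ?g' (F x) b)"
          by (rule Suc.IH[OF Ck_vars_on_Suc_imp[OF Suc.prems(1)] gD(2)])
        show "Ck_vars_on n k W (\<lambda>x. ((?F' i x \<bullet> b) / (b \<bullet> b)) *\<^sub>R ?g' (F x) b)"
          using Ck_vars_on_bilinear[OF W bounded_bilinear_scaleR 1 2]
          by (simp add: divide_inverse mult.commute)
      qed
    qed
  qed
qed

text \<open>
  Continuity of the partial derivatives makes the function totally differentiable in any two of its
  variables, hence differentiable along the edges of the simplex.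
\<close>

lemma Ck_vars_on_line_derivative:
  fixes F :: "(nat \<Rightarrow> real) \<Rightarrow> 'f::real_normed_vector"
  assumes W: "openin (Euclidean_space n) W" and F: "Ck_vars_on n (Suc k) W F"
    and ij: "i < n" "j < n" "i \<noteq> j" and y: "x(i := c - u, j := u) \<in> W"
  defines "D \<equiv> \<lambda>i x. vector_derivative (\<lambda>t. F (x(i := t))) (at (x i))"
  shows "((\<lambda>u. F (x(i := c - u, j := u))) has_vector_derivative
      D j (x(i := c - u, j := u)) - D i (x(i := c - u, j := u))) (at u)"
proof -
  let ?y = "x(i := c - u, j := u)"
  let ?p = "\<lambda>a b. x(i := a, j := b)"
  have x0: "\<forall>k\<ge>n. (?p 0 0) k = 0"
  proof (intro allI impI)
    fix k assume "k \<ge> n"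
    then have "?y k = 0" by (rule openin_Euclidean_space_zero[OF W y])
    with \<open>k \<ge> n\<close> ij show "(?p 0 0) k = 0" by simp
  qed
  have "open {p. (?p 0 0)(i := fst p, j := snd p) \<in> W}"
    by (rule open_vimage_fun_upd2[OF W ij(1,2) x0])
  moreover have "(?p 0 0)(i := a, j := b) = ?p a b" for a b using ij by auto
  ultimately have "open {p. ?p (fst p) (snd p) \<in> W}" by simp
  moreover have "(c - u, u) \<in> {p. ?p (fst p) (snd p) \<in> W}" using y by simp
  ultimately obtain X Y where XY: "open X" "open Y" "(c - u, u) \<in> X \<times> Y"
      "X \<times> Y \<subseteq> {p. ?p (fst p) (snd p) \<in> W}"
    by (rule open_prod_elim)
  \<comment> \<open>\<open>has_derivative_partialsI\<close> asks for a convex range of the second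
    variable, hence a ball. In the first variable it needs a derivative at the one point only; in
    the second, a continuous one nearby.\<close>
  obtain e where e: "e > 0" "ball u e \<subseteq> Y" using XY by (meson mem_Sigma_iff open_contains_ball)
  have inW: "?p a b \<in> W" if "a \<in> X" "b \<in> ball u e" for a b
    using subsetD[OF XY(4), of "(a, b)"] subsetD[OF e(2)] that by simp
  have D: "((\<lambda>t. F (z(k := t))) has_vector_derivative D k z) (at (z k))"
    "continuous_on W (D k)" if "k < n" "z \<in> W" for k z
    unfolding D_def using Ck_vars_on_SucD[OF F that(1)] that(2) Ck_vars_on_imp_continuous_on by blast+
  have "((\<lambda>(a, b). F (?p a b)) has_derivative
      (\<lambda>(ta, tb). ta *\<^sub>R D i ?y + blinfun_apply (blinfun_scaleR_left (D j (?p (c - u) u))) tb))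
      (at (c - u, u) within X \<times> ball u e)"
  proof (rule has_derivative_partialsI)
    have "((\<lambda>t. F (?y(i := t))) has_derivative (\<lambda>t. t *\<^sub>R D i ?y)) (at (c - u))"
      using D(1)[OF ij(1) y] ij(3) by (simp add: has_vector_derivative_def)
    moreover have "?y(i := t) = ?p t u" for t using ij by auto
    ultimately show "((\<lambda>a. F (?p a u)) has_derivative (\<lambda>t. t *\<^sub>R D i ?y)) (at (c - u) within X)"
      using has_derivative_at_withinI by simp
  next
    fix a b assume "a \<in> X" "b \<in> ball u e"
    then show "((\<lambda>b. F (?p a b)) has_derivative blinfun_apply (blinfun_scaleR_left (D j (?p a b))))
        (at b within ball u e)"
      using D(1)[OF ij(2) inW, of a b] ij(3)
      by (auto simp: has_vector_derivative_def intro: has_derivative_at_withinI)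
  next
    have "continuous_on (X \<times> ball u e) (\<lambda>p. D j (?p (fst p) (snd p)))"
      by (rule continuous_on_compose2[OF D(2)[OF ij(2) y]])
        (auto intro!: continuous_on_fun_upd2 continuous_on_const continuous_on_fst continuous_on_snd continuous_on_id
          inW simp del: mem_ball fun_upd_apply)
    then have "continuous_on (X \<times> ball u e) (\<lambda>(a, b). blinfun_scaleR_left (D j (?p a b)))"
      unfolding split_beta by (rule bounded_linear.continuous_on[OF bounded_linear_blinfun_scaleR_left])
    then show "continuous (at (c - u, u) within X \<times> ball u e) (\<lambda>(a, b). blinfun_scaleR_left (D j (?p a b)))"
      using XY(3) e(1) by (auto simp: continuous_on_eq_continuous_within)
  qed (use e(1) in auto)
  then have "((\<lambda>(a, b). F (?p a b)) has_derivative (\<lambda>(ta, tb). ta *\<^sub>R D i ?y + tb *\<^sub>R D j ?y)) (at (c - u, u))"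
    using XY e(1) at_within_open[of "(c - u, u)" "X \<times> ball u e"]
    by (auto simp: open_Times)
  then have *: "((\<lambda>p. F (?p (fst p) (snd p))) has_derivative (\<lambda>p. fst p *\<^sub>R D i ?y + snd p *\<^sub>R D j ?y)) (at (c - u, u))"
    by (simp add: case_prod_beta' del: fun_upd_apply)
  have "((\<lambda>u. (c - u, u)) has_derivative (\<lambda>h. (- h, h))) (at u)"
    by (auto intro!: derivative_eq_intros)
  from has_derivative_compose[OF this *]
  show ?thesis
    by (simp add: has_vector_derivative_def algebra_simps)
qed

text \<open>Moving weight from vertex \<open>i\<close> to vertex \<open>j\<close> preserves the sum
  of the barycentric coordinates, so these are lines along which a simplex can be read. The
  derivative along the line is the difference of two partial derivatives restricted to the same
  line, so the induction closes.\<close>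

lemma smooth_vars_on_line:
  fixes F :: "(nat \<Rightarrow> real) \<Rightarrow> 'f::real_normed_vector"
  assumes W: "openin (Euclidean_space n) W" and F: "smooth_vars_on n W F"
    and ij: "i < n" "j < n" "i \<noteq> j" and x: "\<forall>k\<ge>n. x k = 0"
  shows "open {u. x(i := c - u, j := u) \<in> W}"
    and "smooth_on {u. x(i := c - u, j := u) \<in> W} (\<lambda>u. F (x(i := c - u, j := u)))"
proof -
  let ?S = "{u. x(i := c - u, j := u) \<in> W}"
  have "continuous_on UNIV (\<lambda>u::real. (c - u, u))" by (intro continuous_intros)
  from open_vimage[OF open_vimage_fun_upd2[OF W ij(1,2) x] this]
  show S: "open ?S" unfolding vimage_def mem_Collect_eq fst_conv snd_conv .
  have "Ck_on k ?S (\<lambda>u. F (x(i := c - u, j := u)))" if "Ck_vars_on n k W F" for k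
    using that
  proof (induction k arbitrary: F)
    case 0
    show ?case
      unfolding Ck_on.simps
      by (rule continuous_on_compose2[OF Ck_vars_on_imp_continuous_on[OF 0]])
        (auto intro!: continuous_on_fun_upd2 continuous_on_const continuous_on_diff continuous_on_id
          simp del: fun_upd_apply)
  next
    case (Suc k)
    let ?D = "\<lambda>F i x. vector_derivative (\<lambda>t. F (x(i := t))) (at (x i))"
    show ?case
    proof (rule Ck_on_SucI[OF S])
      fix u assume "u \<in> ?S"
      then show "((\<lambda>u. F (x(i := c - u, j := u))) has_derivative
         (\<lambda>h. h *\<^sub>R (?D F j (x(i := c - u, j := u)) + (- 1) *\<^sub>R ?D F i (x(i := c - u, j := u))))) (at u)"
        using Ck_vars_on_line_derivative[OF W Suc.prems ij, of x c u]
        unfolding has_vector_derivative_def by (simp del: fun_upd_apply)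
    next
      fix v
      have "Ck_vars_on n k W (\<lambda>x. ?D F j x + (- 1) *\<^sub>R ?D F i x)"
        by (rule Ck_vars_on_add[OF W Ck_vars_on_SucD(2)[OF Suc.prems ij(2)]
              Ck_vars_on_bilinear[OF W bounded_bilinear_scaleR Ck_vars_on_const[OF W]
                Ck_vars_on_SucD(2)[OF Suc.prems ij(1)]]])
      from Suc.IH[OF this]
      show "Ck_on k ?S (\<lambda>u. v *\<^sub>R (?D F j (x(i := c - u, j := u)) + (- 1) *\<^sub>R ?D F i (x(i := c - u, j := u))))"
        by (intro Ck_on_bilinear[OF S bounded_bilinear_scaleR Ck_on_const[OF S]])
    qed
  qed
  then show "smooth_on ?S (\<lambda>u. F (x(i := c - u, j := u)))"
    using F unfolding smooth_on_def smooth_vars_on_def by blast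
qed

lemma smooth_vars_on_imp_continuous_on: "smooth_vars_on n W F \<Longrightarrow> continuous_on W F"
  unfolding smooth_vars_on_def using Ck_vars_on_imp_continuous_on by blast

lemma smooth_vars_on_subset: "smooth_vars_on n W F \<Longrightarrow> V \<subseteq> W \<Longrightarrow> smooth_vars_on n V F"
  unfolding smooth_vars_on_def using Ck_vars_on_subset by blast

lemma smooth_vars_on_const: "openin (Euclidean_space n) W \<Longrightarrow> smooth_vars_on n W (\<lambda>x. c)"
  unfolding smooth_vars_on_def using Ck_vars_on_const by blast

lemma smooth_vars_on_coord: "openin (Euclidean_space n) W \<Longrightarrow> smooth_vars_on n W (\<lambda>x. x i)"
  unfolding smooth_vars_on_def using Ck_vars_on_coord by blast

lemma smooth_vars_on_add:
  "openin (Euclidean_space n) W \<Longrightarrow> smooth_vars_on n W F \<Longrightarrow> smooth_vars_on n W G \<Longrightarrow>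
    smooth_vars_on n W (\<lambda>x. F x + G x)"
  unfolding smooth_vars_on_def using Ck_vars_on_add by blast

lemma smooth_vars_on_bilinear:
  "openin (Euclidean_space n) W \<Longrightarrow> bounded_bilinear pr \<Longrightarrow>
    smooth_vars_on n W F \<Longrightarrow> smooth_vars_on n W G \<Longrightarrow> smooth_vars_on n W (\<lambda>x. pr (F x) (G x))"
  unfolding smooth_vars_on_def using Ck_vars_on_bilinear by blast

lemma smooth_vars_on_compose:
  fixes F :: "(nat \<Rightarrow> real) \<Rightarrow> 'e::real_inner"
  assumes "finite (B::'e set)" "span B = UNIV" "openin (Euclidean_space n) W"
    "smooth_vars_on n W F" "smooth_on T g" "F ` W \<subseteq> T"
  shows "smooth_vars_on n W (\<lambda>x. g (F x))"
  using assms Ck_vars_on_compose unfolding smooth_vars_on_def smooth_on_def by blast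

lemma smooth_vars_on_compose_real:
  fixes F :: "(nat \<Rightarrow> real) \<Rightarrow> real"
  assumes "openin (Euclidean_space n) W" "smooth_vars_on n W F" "smooth_on T g" "F ` W \<subseteq> T"
  shows "smooth_vars_on n W (\<lambda>x. g (F x))"
proof (rule smooth_vars_on_compose[OF _ _ assms])
  show "finite {1::real}" "span {1::real} = UNIV"
    by (auto simp: span_singleton) 
qed

section \<open>Monodromy in simply connected spaces\<close>

text \<open>
  A family \<open>D\<close> of germs \<open>D x\<close> at the points \<open>x\<close> with locally consistent differences describes a torsor
  under the locally constant functions; \<open>\<phi>\<close> is a section of it over \<open>S\<close>.
\<close>

definition local_differences :: "('x::topological_space \<Rightarrow> 'x \<Rightarrow> 'm::ab_group_add) \<Rightarrow> bool" where
  "local_differences D \<longleftrightarrow>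
     (\<forall>x. \<forall>\<^sub>F y in nhds x. \<forall>\<^sub>F z in nhds y. D x z = D x y + D y z)"

definition primitive_on ::
    "('x::topological_space \<Rightarrow> 'x \<Rightarrow> 'm::ab_group_add) \<Rightarrow> 'x set \<Rightarrow> ('x \<Rightarrow> 'm) \<Rightarrow> bool" where
  "primitive_on D S \<phi> \<longleftrightarrow> (\<forall>x\<in>S. \<forall>\<^sub>F y in nhds x. y \<in> S \<longrightarrow> \<phi> y = \<phi> x + D x y)"

lemma continuous_on_UNIV_filterlim_nhds:
  "continuous_on UNIV f \<Longrightarrow> filterlim f (nhds (f x)) (nhds x)"
  by (simp add: continuous_on_def tendsto_at_iff_tendsto_nhds)

text \<open>Mere continuity of \<open>f\<close> suffices; this is what admits a null homotopy that
  is not smooth.\<close>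

lemma local_differences_vimage:
  assumes D: "local_differences D" and f: "continuous_on UNIV f"
  shows "local_differences (\<lambda>x y. D (f x) (f y))"
  unfolding local_differences_def
proof
  fix x
  have "\<forall>\<^sub>F y in nhds (f x). \<forall>\<^sub>F z in nhds y. D (f x) z = D (f x) y + D y z"
    using D unfolding local_differences_def by blast
  then have "\<forall>\<^sub>F y in nhds x. \<forall>\<^sub>F z in nhds (f y). D (f x) z = D (f x) (f y) + D (f y) z"
    by (rule eventually_compose_filterlim[OF _ continuous_on_UNIV_filterlim_nhds[OF f]])
  then show "\<forall>\<^sub>F y in nhds x. \<forall>\<^sub>F z in nhds y. D (f x) (f z) = D (f x) (f y) + D (f y) (f z)"
  proof eventually_elim
    case (elim y)
    then show ?case
      by (rule eventually_compose_filterlim[OF _ continuous_on_UNIV_filterlim_nhds[OF f]])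
  qed
qed

lemma primitive_on_subset:
  "primitive_on D S \<phi> \<Longrightarrow> T \<subseteq> S \<Longrightarrow> primitive_on D T \<phi>"
  unfolding primitive_on_def by (blast intro: eventually_mono)

lemma primitive_on_cong:
  assumes "primitive_on D S \<phi>" "\<And>x y. x \<in> S \<Longrightarrow> y \<in> S \<Longrightarrow> D x y = E x y"
  shows "primitive_on E S \<phi>"
  using assms unfolding primitive_on_def by (auto elim!: eventually_mono)

lemma primitive_on_vimage:
  assumes \<phi>: "primitive_on D S \<phi>" and f: "continuous_on UNIV f" and T: "f ` T \<subseteq> S"
  shows "primitive_on (\<lambda>x y. D (f x) (f y)) T (\<lambda>x. \<phi> (f x))"
  unfolding primitive_on_def
proof
  fix x assume "x \<in> T"
  then have "\<forall>\<^sub>F y in nhds (f x). y \<in> S \<longrightarrow> \<phi> y = \<phi> (f x) + D (f x) y"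
    using \<phi> T unfolding primitive_on_def by blast
  from eventually_compose_filterlim[OF this continuous_on_UNIV_filterlim_nhds[OF f]]
  show "\<forall>\<^sub>F y in nhds x. y \<in> T \<longrightarrow> \<phi> (f y) = \<phi> (f x) + D (f x) (f y)"
    by eventually_elim (use T in blast)
qed

text \<open>The filter \<open>nhds x\<close> contains the point itself, so the defining equation may
  be read at \<open>y = x\<close>.\<close>

lemma primitive_on_refl:
  assumes "primitive_on D S \<phi>" "x \<in> S"
  shows "D x x = 0"
proof -
  have "\<forall>\<^sub>F y in nhds x. y \<in> S \<longrightarrow> \<phi> y = \<phi> x + D x y"
    using assms unfolding primitive_on_def by blast
  from eventually_nhds_x_imp_x[OF this] assms(2) show ?thesis by simp
qed

lemma local_differences_primitive:
  assumes "local_differences D"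
  obtains U where "open U" "x \<in> U" "primitive_on D U (D x)"
proof -
  have "\<forall>\<^sub>F y in nhds x. \<forall>\<^sub>F z in nhds y. D x z = D x y + D y z"
    using assms unfolding local_differences_def by blast
  then obtain U where U: "open U" "x \<in> U" "\<forall>y\<in>U. \<forall>\<^sub>F z in nhds y. D x z = D x y + D y z"
    unfolding eventually_nhds[of _ x] by blast
  have "primitive_on D U (D x)"
    unfolding primitive_on_def
  proof
    fix y assume "y \<in> U"
    then have "\<forall>\<^sub>F z in nhds y. D x z = D x y + D y z" using U(3) by blast
    then show "\<forall>\<^sub>F z in nhds y. z \<in> U \<longrightarrow> D x z = D x y + D y z" by eventually_elim simp
  qed
  with U(1,2) show ?thesis by (rule that)
qed

lemma locally_constant_connected:
  assumes "connected S" "\<And>x. x \<in> S \<Longrightarrow> \<forall>\<^sub>F y in nhds x. y \<in> S \<longrightarrow> f y = f x"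
    and "a \<in> S" "b \<in> S"
  shows "f a = f b"
proof -
  have "f constant_on S"
  proof (rule locally_constant_imp_constant[OF assms(1)])
    fix x assume x: "x \<in> S"
    obtain U where U: "open U" "x \<in> U" "\<forall>y\<in>U. y \<in> S \<longrightarrow> f y = f x"
      using assms(2)[OF x] unfolding eventually_nhds by blast
    have "openin (top_of_set S) (S \<inter> U)" using U(1) by (rule openin_open_Int)
    then show "\<exists>T. openin (top_of_set S) T \<and> x \<in> T \<and> (\<forall>y\<in>T. f y = f x)"
      using x U(2,3) by blast
  qed
  then show ?thesis using assms(3,4) unfolding constant_on_def by auto
qed

text \<open>The difference of two primitives is locally constant, hence constant on a connected
  set.\<close>

lemma primitive_on_unique:
  assumes "connected S" "primitive_on D S \<phi>" "primitive_on D S \<psi>" "a \<in> S" "b \<in> S"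
  shows "\<phi> b - \<phi> a = \<psi> b - \<psi> a"
proof -
  have "\<phi> a - \<psi> a = \<phi> b - \<psi> b"
  proof (rule locally_constant_connected[OF assms(1) _ assms(4,5)])
    fix x assume x: "x \<in> S"
    from bspec[OF assms(2)[unfolded primitive_on_def] x] bspec[OF assms(3)[unfolded primitive_on_def] x]
    show "\<forall>\<^sub>F y in nhds x. y \<in> S \<longrightarrow> \<phi> y - \<psi> y = \<phi> x - \<psi> x"
      by eventually_elim simp
  qed
  then show ?thesis by (simp add: algebra_simps)
qed

text \<open>On the connected intersection the two primitives differ by a constant, by which the
  second is shifted. As both sets are closed, a point outside one of them has a neighbourhood
  missing it, so the condition can be checked for each set separately.\<close>

lemma primitive_on_Un:
  assumes S: "closed S" and T: "closed T" and ST: "connected (S \<inter> T)"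
    and \<phi>: "primitive_on D S \<phi>" and \<psi>: "primitive_on D T \<psi>"
  shows "\<exists>\<theta>. primitive_on D (S \<union> T) \<theta>"
proof -
  obtain c where c: "\<And>x. x \<in> S \<Longrightarrow> x \<in> T \<Longrightarrow> \<phi> x = \<psi> x + c"
  proof (cases "S \<inter> T = {}")
    case False
    then obtain a where a: "a \<in> S \<inter> T" by blast
    have "\<phi> x = \<psi> x + (\<phi> a - \<psi> a)" if "x \<in> S \<inter> T" for x
      using primitive_on_unique[OF ST primitive_on_subset[OF \<phi>] primitive_on_subset[OF \<psi>] a that]
      by (simp add: algebra_simps)
    then show ?thesis using that by blast
  qed blast
  define \<theta> where "\<theta> x = (if x \<in> S then \<phi> x else \<psi> x + c)" for x
  have \<theta>S: "\<theta> x = \<phi> x" if "x \<in> S" for x using that by (simp add: \<theta>_def)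
  have \<theta>T: "\<theta> x = \<psi> x + c" if "x \<in> T" for x using that c by (simp add: \<theta>_def)
  have "\<forall>\<^sub>F y in nhds x. y \<in> S \<longrightarrow> \<theta> y = \<theta> x + D x y" for x
  proof (cases "x \<in> S")
    case True
    then have "\<forall>\<^sub>F y in nhds x. y \<in> S \<longrightarrow> \<phi> y = \<phi> x + D x y"
      using \<phi> unfolding primitive_on_def by blast
    then show ?thesis by eventually_elim (use True \<theta>S in auto)
  next
    case False
    then have "\<forall>\<^sub>F y in nhds x. y \<in> - S"
      using S by (intro eventually_nhds_in_open) auto
    then show ?thesis by eventually_elim auto
  qed
  moreover have "\<forall>\<^sub>F y in nhds x. y \<in> T \<longrightarrow> \<theta> y = \<theta> x + D x y" for x
  proof (cases "x \<in> T")
    case True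
    then have "\<forall>\<^sub>F y in nhds x. y \<in> T \<longrightarrow> \<psi> y = \<psi> x + D x y"
      using \<psi> unfolding primitive_on_def by blast
    then show ?thesis by eventually_elim (use True \<theta>T in auto)
  next
    case False
    then have "\<forall>\<^sub>F y in nhds x. y \<in> - T"
      using T by (intro eventually_nhds_in_open) auto
    then show ?thesis by eventually_elim auto
  qed
  ultimately have "\<forall>\<^sub>F y in nhds x. y \<in> S \<union> T \<longrightarrow> \<theta> y = \<theta> x + D x y" for x
    by (rule eventually_elim2) blast
  then show ?thesis unfolding primitive_on_def by blast
qed

text \<open>Bisection in both directions: small rectangles have primitives because the germs do, and
  neighbouring rectangles meet in a segment, which is connected, so \<open>primitive_on_Un\<close>
  glues them.\<close>

lemma primitive_on_square:
  fixes D :: "real \<times> real \<Rightarrow> real \<times> real \<Rightarrow> 'm::ab_group_add"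
  assumes D: "local_differences D"
  obtains \<phi> where "primitive_on D ({0..1} \<times> {0..1}) \<phi>"
proof -
  \<comment> \<open>Bisection in the first coordinate, with a strip height that may depend on the
    level \<open>t\<close>.\<close>
  have strip: "\<exists>e>0. \<exists>\<phi>. primitive_on D ({0..1} \<times> {t-e..t+e}) \<phi>" for t
  proof (rule Bolzano[where P = "\<lambda>a b. \<exists>e>0. \<exists>\<phi>. primitive_on D ({a..b} \<times> {t-e..t+e}) \<phi>"])
    fix a b c :: real
    assume "\<exists>e>0. \<exists>\<phi>. primitive_on D ({a..b} \<times> {t-e..t+e}) \<phi>"
      "\<exists>e>0. \<exists>\<phi>. primitive_on D ({b..c} \<times> {t-e..t+e}) \<phi>" and abc: "a \<le> b" "b \<le> c"
    then obtain d e \<phi> \<psi> where de: "d > 0" "e > 0"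
      and \<phi>: "primitive_on D ({a..b} \<times> {t-d..t+d}) \<phi>"
      and \<psi>: "primitive_on D ({b..c} \<times> {t-e..t+e}) \<psi>" by blast
    \<comment> \<open>Gluing side by side requires a common height.\<close>
    define f where "f = min d e"
    have f: "f > 0" "f \<le> d" "f \<le> e" using de by (auto simp: f_def)
    have int: "({a..b} \<times> {t-f..t+f}) \<inter> ({b..c} \<times> {t-f..t+f}) = {b} \<times> {t-f..t+f}"
      and un: "({a..b} \<times> {t-f..t+f}) \<union> ({b..c} \<times> {t-f..t+f}) = {a..c} \<times> {t-f..t+f}"
      using abc by auto
    have "\<exists>\<theta>. primitive_on D (({a..b} \<times> {t-f..t+f}) \<union> ({b..c} \<times> {t-f..t+f})) \<theta>"
    proof (rule primitive_on_Un)
      show "connected (({a..b} \<times> {t-f..t+f}) \<inter> ({b..c} \<times> {t-f..t+f}))"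
        unfolding int by (intro convex_connected convex_Times) auto
      show "primitive_on D ({a..b} \<times> {t-f..t+f}) \<phi>"
        by (rule primitive_on_subset[OF \<phi>]) (use f in auto)
      show "primitive_on D ({b..c} \<times> {t-f..t+f}) \<psi>"
        by (rule primitive_on_subset[OF \<psi>]) (use f in auto)
    qed (auto intro: closed_Times)
    then show "\<exists>e>0. \<exists>\<phi>. primitive_on D ({a..c} \<times> {t-e..t+e}) \<phi>"
      unfolding un using f(1) by blast
  next
    fix s :: real
    obtain U where U: "open U" "(s, t) \<in> U" "primitive_on D U (D (s, t))"
      using local_differences_primitive[OF D] by metis
    obtain A B where AB: "open A" "open B" "(s, t) \<in> A \<times> B" "A \<times> B \<subseteq> U"
      using open_prod_elim[OF U(1,2)] by metis
    obtain d where d: "d > 0" "ball s d \<subseteq> A" using AB by (meson mem_Sigma_iff open_contains_ball)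
    obtain e where e: "e > 0" "cball t e \<subseteq> B" using AB by (meson mem_Sigma_iff open_contains_cball)
    have "primitive_on D ({a..b} \<times> {t-e..t+e}) (D (s, t))" if "a \<le> s" "s \<le> b" "b - a < d" for a b
    proof (rule primitive_on_subset[OF U(3)])
      have "{a..b} \<subseteq> A" using that d by (auto simp: dist_real_def subset_iff)
      moreover have "{t-e..t+e} \<subseteq> B" using e by (auto simp: dist_real_def subset_iff)
      ultimately show "{a..b} \<times> {t-e..t+e} \<subseteq> U" using AB(4) by blast
    qed
    then show "\<exists>d>0. \<forall>a b. a \<le> s \<and> s \<le> b \<and> b - a < d \<longrightarrow>
        (\<exists>e>0. \<exists>\<phi>. primitive_on D ({a..b} \<times> {t-e..t+e}) \<phi>)"
      using d(1) e(1) by blast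
  qed simp
  \<comment> \<open>Bisection in the second coordinate stacks the strips; the height obtained at
    level \<open>t\<close> is the required gauge.\<close>
  have "\<exists>\<phi>. primitive_on D ({0..1} \<times> {0..1}) \<phi>"
  proof (rule Bolzano[where P = "\<lambda>a b. \<exists>\<phi>. primitive_on D ({0..1} \<times> {a..b}) \<phi>"])
    fix a b c :: real
    assume "\<exists>\<phi>. primitive_on D ({0..1} \<times> {a..b}) \<phi>" "\<exists>\<phi>. primitive_on D ({0..1} \<times> {b..c}) \<phi>"
      and abc: "a \<le> b" "b \<le> c"
    then obtain \<phi> \<psi> where \<phi>: "primitive_on D ({0..1} \<times> {a..b}) \<phi>"
      and \<psi>: "primitive_on D ({0..1} \<times> {b..c}) \<psi>" by blast
    have int: "({0..1::real} \<times> {a..b}) \<inter> ({0..1} \<times> {b..c}) = {0..1} \<times> {b}"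
      and un: "({0..1::real} \<times> {a..b}) \<union> ({0..1} \<times> {b..c}) = {0..1} \<times> {a..c}"
      using abc by auto
    have "\<exists>\<theta>. primitive_on D (({0..1} \<times> {a..b}) \<union> ({0..1} \<times> {b..c})) \<theta>"
    proof (rule primitive_on_Un[OF _ _ _ \<phi> \<psi>])
      show "connected (({0..1::real} \<times> {a..b}) \<inter> ({0..1} \<times> {b..c}))"
        unfolding int by (intro convex_connected convex_Times) auto
    qed (auto intro: closed_Times)
    then show "\<exists>\<phi>. primitive_on D ({0..1} \<times> {a..c}) \<phi>" unfolding un .
  next
    fix t :: real
    obtain e \<phi> where e: "e > 0" "primitive_on D ({0..1} \<times> {t-e..t+e}) \<phi>" using strip by blast
    have "primitive_on D ({0..1} \<times> {a..b}) \<phi>" if "a \<le> t" "t \<le> b" "b - a < e" for a b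
      by (rule primitive_on_subset[OF e(2)]) (use that in auto)
    then show "\<exists>d>0. \<forall>a b. a \<le> t \<and> t \<le> b \<and> b - a < d \<longrightarrow> (\<exists>\<phi>. primitive_on D ({0..1} \<times> {a..b}) \<phi>)"
      using e(1) by blast
  qed simp
  then show ?thesis using that by blast
qed

text \<open>The integral of the germs along \<open>p\<close>, encoded as a relation so that
  existence of a primitive along \<open>p\<close> is part of it; uniqueness of the value is
  \<open>primitive_on_unique\<close>.\<close>

definition has_increment :: "('x::topological_space \<Rightarrow> 'x \<Rightarrow> 'm::ab_group_add) \<Rightarrow> (real \<Rightarrow> 'x) \<Rightarrow> 'm \<Rightarrow> bool" where
  "has_increment D p m \<longleftrightarrow>
     (\<exists>\<phi>. primitive_on (\<lambda>s t. D (p s) (p t)) {0..1} \<phi> \<and> \<phi> 1 - \<phi> 0 = m)"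

text \<open>The germs pulled back along a free null homotopy have a primitive on the square. Its
  increment along one side is \<open>m\<close>, along the opposite side zero since the homotopy is
  constant there, and along the two remaining sides the same since the homotopy runs through
  loops.\<close>

lemma has_increment_loop:
  fixes D :: "'x::topological_space \<Rightarrow> 'x \<Rightarrow> 'm::ab_group_add"
  assumes D: "local_differences D" and sc: "simply_connected (UNIV :: 'x set)"
    and p: "path p" "pathfinish p = pathstart p" and m: "has_increment D p m"
  shows "m = 0"
proof -
  obtain \<phi> where \<phi>: "primitive_on (\<lambda>s t. D (p s) (p t)) {0..1} \<phi>" "\<phi> 1 - \<phi> 0 = m"
    using m unfolding has_increment_def by blast
  define c where "c = p 0"
  have "homotopic_loops UNIV p (\<lambda>_. c)"
    using sc p unfolding simply_connected_def by (simp add: path_def pathfinish_def pathstart_def)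
  then obtain h where h: "continuous_on ({0..1::real} \<times> {0..1::real}) h"
    "\<forall>x\<in>{0..1}. h (0, x) = p x" "\<forall>x\<in>{0..1}. h (1, x) = c"
    "\<forall>t\<in>{0..1}. pathfinish (h \<circ> Pair t) = pathstart (h \<circ> Pair t)"
    unfolding homotopic_loops by blast
  \<comment> \<open>Clamping extends the homotopy from the square to the plane, because pulling back
    germs needs continuity on the whole space.\<close>
  define cl :: "real \<Rightarrow> real" where "cl t = max 0 (min 1 t)" for t
  have cl: "cl t \<in> {0..1}" "t \<in> {0..1} \<Longrightarrow> cl t = t" for t by (auto simp: cl_def)
  define H where "H = (\<lambda>x. h (cl (fst x), cl (snd x)))"
  have H: "continuous_on UNIV H"
    unfolding H_def
    by (rule continuous_on_compose2[OF h(1)])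
      (auto intro!: continuous_intros cl(1)[unfolded atLeastAtMost_iff, THEN conjunct1]
        cl(1)[unfolded atLeastAtMost_iff, THEN conjunct2] simp: cl_def)
  have H0: "H (0, t) = p t" and H1: "H (1, t) = c" and Hs: "H (t, 1) = H (t, 0)" if "t \<in> {0..1}" for t
    using h that cl by (auto simp: H_def pathstart_def pathfinish_def)
  obtain \<Phi> where \<Phi>: "primitive_on (\<lambda>x y. D (H x) (H y)) ({0..1} \<times> {0..1}) \<Phi>"
    using primitive_on_square[OF local_differences_vimage[OF D H]] by blast
  have side: "primitive_on (\<lambda>s t. D (H (k s)) (H (k t))) {0..1} (\<lambda>t. \<Phi> (k t))"
    if "continuous_on UNIV k" "k ` {0..1} \<subseteq> {0..1} \<times> {0..1}" for k :: "real \<Rightarrow> real \<times> real"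
    using primitive_on_vimage[OF \<Phi> that] .
  have c01: "connected {0..1::real}" "0 \<in> {0..1::real}" "1 \<in> {0..1::real}" by auto
  have "primitive_on (\<lambda>s t. D (p s) (p t)) {0..1} (\<lambda>t. \<Phi> (0, t))"
    by (rule primitive_on_cong[OF side]) (auto intro!: continuous_intros simp: H0)
  from primitive_on_unique[OF c01(1) \<phi>(1) this c01(2,3)]
  have 0: "m = \<Phi> (0, 1) - \<Phi> (0, 0)" using \<phi>(2) by simp
  have 1: "primitive_on (\<lambda>s t. D c c) {0..1} (\<lambda>t. \<Phi> (1, t))"
    by (rule primitive_on_cong[OF side]) (auto intro!: continuous_intros simp: H1)
  have "D c c = 0" by (rule primitive_on_refl[OF 1 c01(2)])
  with 1 have "primitive_on (\<lambda>s t. 0) {0..1} (\<lambda>t. \<Phi> (1, t))" by simp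
  moreover have "primitive_on (\<lambda>s t. 0) {0..1::real} (\<lambda>t. 0 :: 'm)"
    by (simp add: primitive_on_def)
  \<comment> \<open>The zero function is a second primitive of the zero germs on the constant
    side.\<close>
  ultimately have 2: "\<Phi> (1, 1) - \<Phi> (1, 0) = 0 - 0"
    by (rule primitive_on_unique[OF c01(1) _ _ c01(2,3)])
  have 3: "primitive_on (\<lambda>s t. D (H (s, 0)) (H (t, 0))) {0..1} (\<lambda>t. \<Phi> (t, 0))"
    by (rule side) (auto intro!: continuous_intros)
  have "primitive_on (\<lambda>s t. D (H (s, 0)) (H (t, 0))) {0..1} (\<lambda>t. \<Phi> (t, 1))"
    by (rule primitive_on_cong[OF side]) (auto intro!: continuous_intros simp: Hs)
  from primitive_on_unique[OF c01(1) 3 this c01(2,3)] 0 2 show ?thesis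
    by (simp add: algebra_simps)
qed

text \<open>The two halves of the interval meet in one point, which is connected, so the rescaled
  primitives glue.\<close>

lemma has_increment_joinpaths:
  assumes p: "has_increment D p a" and q: "has_increment D q b" and pq: "pathfinish p = pathstart q"
  shows "has_increment D (p +++ q) (a + b)"
proof -
  obtain \<phi> where \<phi>: "primitive_on (\<lambda>s t. D (p s) (p t)) {0..1} \<phi>" "\<phi> 1 - \<phi> 0 = a"
    using p unfolding has_increment_def by blast
  obtain \<psi> where \<psi>: "primitive_on (\<lambda>s t. D (q s) (q t)) {0..1} \<psi>" "\<psi> 1 - \<psi> 0 = b"
    using q unfolding has_increment_def by blast
  let ?E = "\<lambda>s t. D ((p +++ q) s) ((p +++ q) t)"
  have 1: "primitive_on ?E {0..1/2} (\<lambda>t. \<phi> (2 * t))"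
    by (rule primitive_on_cong[OF primitive_on_vimage[OF \<phi>(1)]])
      (auto intro!: continuous_intros simp: joinpaths_def)
  have 2: "primitive_on ?E {1/2..1} (\<lambda>t. \<psi> (2 * t - 1))"
  proof (rule primitive_on_cong[OF primitive_on_vimage[OF \<psi>(1)]])
    have "(p +++ q) t = q (2 * t - 1)" if "t \<in> {1/2..1}" for t
    proof (cases "t = 1/2")
      case True
      show ?thesis unfolding True using pq by (simp add: joinpaths_def pathfinish_def pathstart_def)
    next
      case False
      then show ?thesis using that by (auto simp: joinpaths_def)
    qed
    then show "D (q (2 * s - 1)) (q (2 * t - 1)) = ?E s t" if "s \<in> {1/2..1}" "t \<in> {1/2..1}" for s t
      using that by simp
  qed (auto intro!: continuous_intros)
  have un: "{0..1/2} \<union> {1/2..1} = {0..1::real}" by auto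
  have int: "{0..1/2} \<inter> {1/2..1} = {1/2::real}" by auto
  obtain \<theta> where \<theta>: "primitive_on ?E {0..1} \<theta>"
    using primitive_on_Un[OF _ _ _ 1 2] unfolding un int by auto
  have "\<theta> (1/2) - \<theta> 0 = a"
    using primitive_on_unique[OF _ primitive_on_subset[OF \<theta>] 1, of 0 "1/2"] \<phi>(2) by simp
  moreover have "\<theta> 1 - \<theta> (1/2) = b"
    using primitive_on_unique[OF _ primitive_on_subset[OF \<theta>] 2, of "1/2" 1] \<psi>(2) by simp
  ultimately have "\<theta> 1 - \<theta> 0 = a + b" by (simp add: algebra_simps)
  with \<theta> show ?thesis unfolding has_increment_def by blast
qed

lemma has_increment_reversepath:
  assumes "has_increment D p a"
  shows "has_increment D (reversepath p) (- a)"
proof -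
  obtain \<phi> where \<phi>: "primitive_on (\<lambda>s t. D (p s) (p t)) {0..1} \<phi>" "\<phi> 1 - \<phi> 0 = a"
    using assms unfolding has_increment_def by blast
  have "primitive_on (\<lambda>s t. D (reversepath p s) (reversepath p t)) {0..1} (\<lambda>t. \<phi> (1 - t))"
    unfolding reversepath_def
    by (rule primitive_on_vimage[OF \<phi>(1)]) (auto intro!: continuous_intros)
  moreover have "\<phi> (1 - 1) - \<phi> (1 - 0) = - a" using \<phi>(2) by (simp add: algebra_simps)
  ultimately show ?thesis unfolding has_increment_def by blast
qed

text \<open>Apply \<open>has_increment_loop\<close> to the loop that follows \<open>p\<close>, then
  \<open>q\<close>, then \<open>r\<close> backwards.\<close>

lemma has_increment_triangle:
  fixes D :: "'x::topological_space \<Rightarrow> 'x \<Rightarrow> 'm::ab_group_add"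
  assumes D: "local_differences D" and sc: "simply_connected (UNIV :: 'x set)"
    and paths: "path p" "path q" "path r"
    and ends: "pathfinish p = pathstart q" "pathfinish q = pathfinish r" "pathstart p = pathstart r"
    and incr: "has_increment D p a" "has_increment D q b" "has_increment D r c"
  shows "c = a + b"
proof -
  have "has_increment D ((p +++ q) +++ reversepath r) (a + b + - c)"
    using ends by (intro has_increment_joinpaths has_increment_reversepath incr) auto
  moreover have "path ((p +++ q) +++ reversepath r)"
    using paths ends by (auto intro!: path_join_imp)
  moreover have "pathfinish ((p +++ q) +++ reversepath r) = pathstart ((p +++ q) +++ reversepath r)"
    using ends by simp
  ultimately have "a + b + - c = 0" using has_increment_loop[OF D sc] by metis
  then show ?thesis by (simp add: algebra_simps)
qed

section \<open>A flat function\<close>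

text \<open>With \<open>y = 1 / x\<close> the chain rule turns \<open>P(y) exp (- y)\<close> into
  \<open>y^2 (P(y) - P'(y)) exp (- y)\<close>, which is the recursion.\<close>

primrec flat_poly :: "nat \<Rightarrow> real poly" where
  "flat_poly 0 = 1"
| "flat_poly (Suc n) = [:0, 0, 1:] * (flat_poly n - pderiv (flat_poly n))"

text \<open>The \<open>n\<close>-th derivative of the function vanishing for \<open>x \<le> 0\<close> and equal to \<open>exp (- 1 / x)\<close> for \<open>x > 0\<close>.\<close>

definition flat_deriv :: "nat \<Rightarrow> real \<Rightarrow> real" where
  "flat_deriv n x = (if x \<le> 0 then 0 else poly (flat_poly n) (inverse x) * exp (- inverse x))"

lemma poly_div_exp_tendsto_0: "((\<lambda>y. poly p y * exp (- y)) \<longlongrightarrow> (0::real)) at_top"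
proof -
  have "((\<lambda>y. \<Sum>i\<le>degree p. Polynomial.coeff p i * (y ^ i / exp y)) \<longlongrightarrow> (\<Sum>i\<le>degree p. Polynomial.coeff p i * 0)) at_top"
    by (intro tendsto_sum tendsto_mult_left tendsto_power_div_exp_0)
  moreover have "(\<Sum>i\<le>degree p. Polynomial.coeff p i * (y ^ i / exp y)) = poly p y * exp (- y)" for y :: real
    by (simp add: poly_altdef sum_distrib_right exp_minus divide_inverse mult.assoc)
  ultimately show ?thesis by simp
qed

lemma flat_deriv_has_derivative: "(flat_deriv n has_real_derivative flat_deriv (Suc n) x) (at x)"
proof -
  consider "x < 0" | "x = 0" | "x > 0" by linarith
  then show ?thesis
  proof cases
    case 1
    have "((\<lambda>x. 0) has_real_derivative 0) (at x)" by simp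
    then have "(flat_deriv n has_real_derivative 0) (at x)"
      by (rule has_field_derivative_transform_within_open[where S = "{..<0}"])
        (use 1 in \<open>auto simp: flat_deriv_def\<close>)
    then show ?thesis using 1 by (simp add: flat_deriv_def)
  next
    case 2
    \<comment> \<open>The factor \<open>[:0, 1:]\<close> absorbs the \<open>1 / h\<close> of the
      difference quotient at \<open>0\<close>.\<close>
    let ?p = "[:0, 1:] * flat_poly n"
    have "((\<lambda>h. poly ?p (inverse h) * exp (- inverse h)) \<longlongrightarrow> 0) (at_right 0)"
      by (rule filterlim_compose[OF poly_div_exp_tendsto_0 filterlim_inverse_at_top_right])
    then have r: "((\<lambda>h. flat_deriv n h / h) \<longlongrightarrow> 0) (at_right 0)"
      by (rule Lim_transform_eventually)
        (auto simp: eventually_at_right_less flat_deriv_def divide_inverse mult_ac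
          intro!: eventually_mono[OF eventually_at_right_less])
    have l: "((\<lambda>h. flat_deriv n h / h) \<longlongrightarrow> 0) (at_left 0)"
      by (rule Lim_transform_eventually[OF tendsto_const])
        (auto simp: flat_deriv_def eventually_at_filter)
    from filterlim_split_at[OF l r] show ?thesis
      unfolding 2 DERIV_def by (simp add: flat_deriv_def)
  next
    case 3
    have "((\<lambda>x. poly (flat_poly n) (inverse x) * exp (- inverse x)) has_real_derivative
        poly (flat_poly (Suc n)) (inverse x) * exp (- inverse x)) (at x)"
      using 3 by (auto intro!: derivative_eq_intros simp: power2_eq_square algebra_simps)
    then have "(flat_deriv n has_real_derivative
        poly (flat_poly (Suc n)) (inverse x) * exp (- inverse x)) (at x)"
      by (rule has_field_derivative_transform_within_open[where S = "{0<..}"])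
        (use 3 in \<open>auto simp: flat_deriv_def\<close>)
    then show ?thesis using 3 by (simp add: flat_deriv_def)
  qed
qed

text \<open>The exponent \<open>1 - inverse x\<close> normalises the value at \<open>1\<close> to
  \<open>1\<close>. Only the end \<open>0\<close> has to be flat, as arcs are brought to rest there;
  on the unit interval the arguments used are at most \<open>1\<close>.\<close>

definition smooth_step :: "real \<Rightarrow> real" where
  "smooth_step x = (if x \<le> 0 then 0 else exp (1 - inverse x))"

lemma smooth_on_smooth_step: "smooth_on UNIV smooth_step"
proof -
  have "smooth_on UNIV (\<lambda>x. exp 1 * flat_deriv 0 x)"
    by (rule smooth_on_real_coinduct[where f = "\<lambda>n x. exp 1 * flat_deriv n x" and n = 0])
      (auto simp: has_real_derivative_iff_has_vector_derivative[symmetric]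
        intro!: DERIV_cmult flat_deriv_has_derivative)
  moreover have "(\<lambda>x. exp 1 * flat_deriv 0 x) = smooth_step"
    by (auto simp: fun_eq_iff flat_deriv_def smooth_step_def exp_diff exp_minus divide_inverse)
  ultimately show ?thesis by simp
qed

lemma smooth_step_simps: "x \<le> 0 \<Longrightarrow> smooth_step x = 0" "smooth_step 1 = 1"
  by (auto simp: smooth_step_def)

lemma smooth_step_bounds: "x \<le> 1 \<Longrightarrow> smooth_step x \<in> {0..1}"
  by (auto simp: smooth_step_def one_le_inverse_iff)

section \<open>Smooth simplices in charts\<close>

locale atlas_space =
  fixes A :: "('a::topological_space, 'e::real_inner) chart set"
  assumes atlas: "smooth_atlas A"
begin

lemma chart_cover: obtains c where "c \<in> A" "x \<in> chart_dom c"
  using atlas unfolding smooth_atlas_def by blast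

lemma finite_span: obtains B :: "'e set" where "finite B" "span B = UNIV"
  using atlas unfolding smooth_atlas_def by blast

lemma
  assumes "c \<in> A"
  shows open_chart_dom: "open (chart_dom c)"
    and open_chart_image: "open (chart_map c ` chart_dom c)"
    and chart_homeo: "homeomorphism (chart_dom c) (chart_map c ` chart_dom c) (chart_map c) (chart_inv c)"
  using atlas assms unfolding smooth_atlas_def by blast+

lemma
  assumes c: "c \<in> A"
  shows chart_inv_chart_map [simp]: "x \<in> chart_dom c \<Longrightarrow> chart_inv c (chart_map c x) = x"
    and chart_map_chart_inv [simp]: "y \<in> chart_map c ` chart_dom c \<Longrightarrow> chart_map c (chart_inv c y) = y"
    and chart_inv_in [simp]: "y \<in> chart_map c ` chart_dom c \<Longrightarrow> chart_inv c y \<in> chart_dom c"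
    and continuous_on_chart_inv: "continuous_on (chart_map c ` chart_dom c) (chart_inv c)"
    and continuous_on_chart_map: "continuous_on (chart_dom c) (chart_map c)"
  using chart_homeo[OF c] unfolding homeomorphism_def by auto

lemma smooth_self_map_id: "smooth_self_map A id"
  using atlas unfolding smooth_self_map_def smooth_atlas_def by (simp add: continuous_on_id)

lemma local_domD:
  assumes "c \<in> A" "q \<in> local_dom f c c'"
  shows "q \<in> chart_map c ` chart_dom c" "f (chart_inv c q) \<in> chart_dom c'"
  using assms unfolding local_dom_def by auto

lemma local_domI:
  "x \<in> chart_dom c \<Longrightarrow> f x \<in> chart_dom c' \<Longrightarrow> chart_map c x \<in> local_dom f c c'"
  unfolding local_dom_def by auto

lemma local_rep_chart_map:
  "c \<in> A \<Longrightarrow> x \<in> chart_dom c \<Longrightarrow> local_rep f c c' (chart_map c x) = chart_map c' (f x)"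
  unfolding local_rep_def by simp

lemma open_local_dom:
  assumes "c \<in> A" "c' \<in> A" "continuous_on UNIV f"
  shows "open (local_dom f c c')"
proof -
  have "open (chart_dom c \<inter> f -` chart_dom c')"
    using open_chart_dom assms by (intro open_Int open_vimage) auto
  then have "openin (top_of_set (chart_dom c)) (chart_dom c \<inter> f -` chart_dom c')"
    by (simp add: openin_open_eq open_chart_dom[OF assms(1)])
  then have "openin (top_of_set (chart_map c ` chart_dom c)) (local_dom f c c')"
    unfolding local_dom_def by (rule homeomorphism_imp_open_map[OF chart_homeo[OF assms(1)]])
  then show ?thesis
    using openin_open_eq[OF open_chart_image[OF assms(1)]] by auto
qed

text \<open>The local witnesses hidden in \<open>smooth_simplex\<close> are named, so that they can
  be composed with maps, restricted and glued.\<close>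

definition lifts :: "nat \<Rightarrow> ((nat \<Rightarrow> real) \<Rightarrow> 'a) \<Rightarrow> ('a, 'e) chart \<Rightarrow> (nat \<Rightarrow> real) set \<Rightarrow> ((nat \<Rightarrow> real) \<Rightarrow> 'e) \<Rightarrow> bool"
  where "lifts p \<sigma> c W F \<longleftrightarrow>
    openin (Euclidean_space (Suc p)) W \<and> smooth_vars_on (Suc p) W F \<and>
    (\<forall>s\<in>W \<inter> standard_simplex p. \<sigma> s \<in> chart_dom c \<and> F s = chart_map c (\<sigma> s))"

lemma smooth_simplex_lifts:
  assumes "smooth_simplex A p \<sigma>" "c \<in> A" "t \<in> standard_simplex p" "\<sigma> t \<in> chart_dom c"
  obtains W F where "lifts p \<sigma> c W F" "t \<in> W"
  using assms unfolding smooth_simplex_def lifts_def by meson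

lemma lifts_compose:
  assumes L: "lifts p \<sigma> c W F" and t: "t \<in> W" "t \<in> standard_simplex p"
    and c: "c \<in> A" "c' \<in> A" and f: "smooth_self_map A f" "f (\<sigma> t) \<in> chart_dom c'"
  shows "\<exists>W' F'. lifts p (f \<circ> \<sigma>) c' W' F' \<and> t \<in> W'"
proof -
  define W' where "W' = {s \<in> W. F s \<in> local_dom f c c'}"
  have W: "openin (Euclidean_space (Suc p)) W" "smooth_vars_on (Suc p) W F"
    and \<sigma>: "\<And>s. s \<in> W \<Longrightarrow> s \<in> standard_simplex p \<Longrightarrow> \<sigma> s \<in> chart_dom c \<and> F s = chart_map c (\<sigma> s)"
    using L unfolding lifts_def by auto
  have W': "openin (Euclidean_space (Suc p)) W'"
    unfolding W'_def
    by (rule openin_Euclidean_space_preimage[OF W(1) smooth_vars_on_imp_continuous_on[OF W(2)]])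
      (use f in \<open>simp add: open_local_dom[OF c] smooth_self_map_def\<close>)
  obtain B :: "'e set" where B: "finite B" "span B = UNIV" by (rule finite_span)
  have "smooth_vars_on (Suc p) W' (\<lambda>s. local_rep f c c' (F s))"
  proof (rule smooth_vars_on_compose[OF B W', where F = F and g = "local_rep f c c'" and T = "local_dom f c c'"])
    show "smooth_vars_on (Suc p) W' F"
      by (rule smooth_vars_on_subset[OF W(2)]) (auto simp: W'_def)
    show "smooth_on (local_dom f c c') (local_rep f c c')"
      using f c unfolding smooth_self_map_def by blast
  qed (auto simp: W'_def)
  moreover have "f (\<sigma> s) \<in> chart_dom c' \<and> local_rep f c c' (F s) = chart_map c' (f (\<sigma> s))"
    if "s \<in> W'" "s \<in> standard_simplex p" for s
    using that \<sigma>[of s] local_domD(2)[OF c(1), of "F s" f c'] c(1)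
    by (auto simp: W'_def local_rep_chart_map)
  moreover have "t \<in> W'"
    using t \<sigma>[OF t] f(2) by (auto simp: W'_def local_domI)
  ultimately show ?thesis using W' unfolding lifts_def by auto
qed

lemma standard_simplex_subset: "standard_simplex p \<subseteq> {x. \<forall>i\<ge>Suc p. x i = 0}"
  by (auto simp: standard_simplex_def)

text \<open>One chart per point suffices: any other is reached by composing with the identity of the
  manifold, whose local representatives are the chart changes. Continuity of \<sigma> also comes
  from the lift, as \<open>chart_inv c\<close> after \<open>F\<close>.\<close>

lemma smooth_simplexI:
  assumes ext: "\<sigma> \<in> extensional (standard_simplex p)"
    and L: "\<And>t. t \<in> standard_simplex p \<Longrightarrow> \<exists>c\<in>A. \<exists>W F. lifts p \<sigma> c W F \<and> t \<in> W"
  shows "smooth_simplex A p \<sigma>"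
proof -
  have "continuous (at t within standard_simplex p) \<sigma>" if t: "t \<in> standard_simplex p" for t
  proof -
    obtain c W F where c: "c \<in> A" and L: "lifts p \<sigma> c W F" and tW: "t \<in> W" using L[OF t] by blast
    then have W: "openin (Euclidean_space (Suc p)) W" "smooth_vars_on (Suc p) W F"
      and \<sigma>: "\<And>s. s \<in> W \<Longrightarrow> s \<in> standard_simplex p \<Longrightarrow> \<sigma> s \<in> chart_dom c \<and> F s = chart_map c (\<sigma> s)"
      unfolding lifts_def by auto
    obtain V where V: "open V" "W = V \<inter> {x. \<forall>i\<ge>Suc p. x i = 0}"
      using W(1) unfolding openin_Euclidean_space_iff by blast
    \<comment> \<open>The simplex lies in the coordinate subspace, so on it the relatively open
      \<open>W\<close> may be replaced by the open \<open>V\<close>.\<close>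
    have eq: "W \<inter> standard_simplex p = V \<inter> standard_simplex p"
      unfolding V(2) using standard_simplex_subset by blast
    have "continuous_on (W \<inter> standard_simplex p) (\<lambda>s. chart_inv c (F s))"
    proof (rule continuous_on_compose2[OF continuous_on_chart_inv[OF c]])
      show "continuous_on (W \<inter> standard_simplex p) F"
        using smooth_vars_on_imp_continuous_on[OF W(2)] by (rule continuous_on_subset) blast
    qed (use \<sigma> in auto)
    then have "continuous_on (V \<inter> standard_simplex p) \<sigma>"
      unfolding eq[symmetric] by (rule continuous_on_eq) (use \<sigma> c in auto)
    then have "continuous (at t within V \<inter> standard_simplex p) \<sigma>"
      using tW t V(2) by (auto simp: continuous_on_eq_continuous_within)
    moreover have "at t within V \<inter> standard_simplex p = at t within standard_simplex p"
      by (rule at_within_nhd[where S = V]) (use V tW in auto)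
    ultimately show ?thesis by simp
  qed
  then have "continuous_on (standard_simplex p) \<sigma>"
    by (simp add: continuous_on_eq_continuous_within)
  then have "singular_simplex p euclidean \<sigma>"
    using ext by (simp add: singular_simplex_def euclidean_product_topology)
  moreover have "\<exists>W F. lifts p \<sigma> c' W F \<and> t \<in> W"
    if "c' \<in> A" "t \<in> standard_simplex p" "\<sigma> t \<in> chart_dom c'" for c' t
    using L[OF that(2)] lifts_compose[OF _ _ that(2) _ that(1) smooth_self_map_id] that(3)
    by fastforce
  ultimately show ?thesis
    unfolding smooth_simplex_def lifts_def by blast
qed

lemma smooth_simplex_lift:
  assumes "smooth_simplex A p \<sigma>" "t \<in> standard_simplex p"
  obtains c W F where "c \<in> A" "\<sigma> t \<in> chart_dom c" "lifts p \<sigma> c W F" "t \<in> W"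
proof -
  obtain c where "c \<in> A" "\<sigma> t \<in> chart_dom c" by (rule chart_cover)
  with smooth_simplex_lifts[OF assms(1) _ assms(2)] that show ?thesis by metis
qed

lemma lifts_cong:
  "lifts p \<sigma> c W F \<Longrightarrow> (\<And>s. s \<in> standard_simplex p \<Longrightarrow> \<tau> s = \<sigma> s) \<Longrightarrow> lifts p \<tau> c W F"
  unfolding lifts_def by auto

lemma smooth_simplex_map:
  assumes \<sigma>: "smooth_simplex A p \<sigma>" and f: "smooth_self_map A f"
  shows "smooth_simplex A p (simplex_map p f \<sigma>)"
proof (rule smooth_simplexI)
  show "simplex_map p f \<sigma> \<in> extensional (standard_simplex p)" by (simp add: simplex_map_def)
  fix t assume t: "t \<in> standard_simplex p"
  obtain c W F where c: "c \<in> A" and L: "lifts p \<sigma> c W F" "t \<in> W"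
    using smooth_simplex_lift[OF \<sigma> t] by metis
  obtain c' where c': "c' \<in> A" "f (\<sigma> t) \<in> chart_dom c'" by (rule chart_cover)
  obtain W' F' where L': "lifts p (f \<circ> \<sigma>) c' W' F'" "t \<in> W'"
    using lifts_compose[OF L t c c'(1) f c'(2)] by blast
  have "lifts p (simplex_map p f \<sigma>) c' W' F'"
    by (rule lifts_cong[OF L'(1)]) (simp add: simplex_map_def)
  then show "\<exists>c\<in>A. \<exists>W F. lifts p (simplex_map p f \<sigma>) c W F \<and> t \<in> W"
    using c'(1) L'(2) by blast
qed

end

text \<open>The parameter is the weight of the second vertex. The restriction makes the result
  extensional, as singular simplices are, so it depends only on \<gamma> over the unit
  interval.\<close>

definition arc_simplex :: "(real \<Rightarrow> 'a) \<Rightarrow> (nat \<Rightarrow> real) \<Rightarrow> 'a" where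
  "arc_simplex \<gamma> = restrict (\<lambda>t. \<gamma> (t 1)) (standard_simplex 1)"

lemma bary_0_in_standard_simplex: "u \<in> {0..1} \<Longrightarrow> bary u 0 \<in> standard_simplex 1"
  by (auto simp: bary_def standard_simplex_def)

lemma standard_simplex_1_eq_bary: "t \<in> standard_simplex 1 \<Longrightarrow> t = bary (t 1) 0"
  by (rule ext) (auto simp: bary_def standard_simplex_def)

lemma standard_simplex_1_coord: "t \<in> standard_simplex 1 \<Longrightarrow> t 1 \<in> {0..1}"
  by (auto simp: standard_simplex_def)

lemma standard_simplex_1D: "t \<in> standard_simplex 1 \<Longrightarrow> t 0 = 1 - t 1"
  by (auto simp: standard_simplex_def)

lemma standard_simplex_2D:
  "t \<in> standard_simplex 2 \<Longrightarrow> 0 \<le> t 0 \<and> 0 \<le> t 1 \<and> 0 \<le> t 2 \<and> t 0 + t 1 + t 2 = 1"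
  by (auto simp: standard_simplex_def numeral_2_eq_2)

lemma arc_simplex_bary: "u \<in> {0..1} \<Longrightarrow> arc_simplex \<gamma> (bary u 0) = \<gamma> u"
  using bary_0_in_standard_simplex[of u] by (simp add: arc_simplex_def) (simp add: bary_def)

lemma arc_simplex_of_simplex:
  assumes "\<sigma> \<in> extensional (standard_simplex 1)"
  shows "arc_simplex (\<lambda>u. \<sigma> (bary u 0)) = \<sigma>"
  unfolding arc_simplex_def
  by (rule ext) (metis (no_types, lifting) assms extensional_arb restrict_apply' restrict_apply standard_simplex_1_eq_bary)

lemma arc_simplex_cong: "(\<And>u. u \<in> {0..1} \<Longrightarrow> \<gamma> u = \<delta> u) \<Longrightarrow> arc_simplex \<gamma> = arc_simplex \<delta>"
  unfolding arc_simplex_def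
  by (rule restrict_ext) (metis standard_simplex_1_coord)

context atlas_space
begin

definition smooth_arc :: "(real \<Rightarrow> 'a) \<Rightarrow> bool" where
  "smooth_arc \<gamma> \<longleftrightarrow> smooth_simplex A 1 (arc_simplex \<gamma>)"

lemma smooth_arc_of_simplex:
  assumes "smooth_simplex A 1 \<sigma>"
  shows "smooth_arc (\<lambda>u. \<sigma> (bary u 0))" "arc_simplex (\<lambda>u. \<sigma> (bary u 0)) = \<sigma>"
proof -
  have "\<sigma> \<in> extensional (standard_simplex 1)"
    using assms unfolding smooth_simplex_def singular_simplex_def by blast
  from arc_simplex_of_simplex[OF this] show "arc_simplex (\<lambda>u. \<sigma> (bary u 0)) = \<sigma>" .
  then show "smooth_arc (\<lambda>u. \<sigma> (bary u 0))" using assms unfolding smooth_arc_def by simp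
qed

lemma bary_line: "bary u 0 = (\<lambda>_. 0)(0 := 1 - u, 1 := u)"
  by (auto simp: bary_def)

lemma smooth_arc_lift:
  assumes \<gamma>: "smooth_arc \<gamma>" and u: "u \<in> {0..1}" and c: "c \<in> A" "\<gamma> u \<in> chart_dom c"
  obtains J G where "open J" "u \<in> J" "smooth_on J G"
    "\<And>v. v \<in> J \<Longrightarrow> v \<in> {0..1} \<Longrightarrow> \<gamma> v \<in> chart_dom c \<and> G v = chart_map c (\<gamma> v)"
proof -
  obtain W F where L: "lifts 1 (arc_simplex \<gamma>) c W F" "bary u 0 \<in> W"
    using smooth_simplex_lifts[OF \<gamma>[unfolded smooth_arc_def] c(1) bary_0_in_standard_simplex[OF u]]
      arc_simplex_bary[OF u] c(2) by metis
  then have W: "openin (Euclidean_space 2) W" "smooth_vars_on 2 W F"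
    and \<sigma>: "\<And>s. s \<in> W \<Longrightarrow> s \<in> standard_simplex 1 \<Longrightarrow>
      arc_simplex \<gamma> s \<in> chart_dom c \<and> F s = chart_map c (arc_simplex \<gamma> s)"
    unfolding lifts_def by (auto simp: numeral_2_eq_2)
  \<comment> \<open>The edge is the line that moves the weight \<open>1\<close> from vertex
    \<open>0\<close> to vertex \<open>1\<close>. As \<open>F\<close> lives on an open set of
    coordinates, \<open>J\<close> is open in the whole real line even at the ends of the
    arc.\<close>
  let ?J = "{u. bary u 0 \<in> W}"
  have "open ?J" "smooth_on ?J (\<lambda>u. F (bary u 0))"
    unfolding bary_line by (rule smooth_vars_on_line[OF W]; simp)+
  then show ?thesis
    using that[of ?J "\<lambda>u. F (bary u 0)"] L(2) \<sigma> bary_0_in_standard_simplex arc_simplex_bary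
    by (metis mem_Collect_eq)
qed

lemma smooth_arc_continuous_on:
  assumes "smooth_arc \<gamma>"
  shows "continuous_on {0..1} \<gamma>"
proof -
  have "continuous_on (standard_simplex 1) (arc_simplex \<gamma>)"
    using assms unfolding smooth_arc_def smooth_simplex_def singular_simplex_def
    by (simp add: euclidean_product_topology)
  moreover have "continuous_on {0..1::real} (\<lambda>u. bary u 0)"
    unfolding bary_line
    by (intro continuous_on_fun_upd2 continuous_on_const continuous_on_diff continuous_on_id)
  ultimately have "continuous_on {0..1} (\<lambda>u. arc_simplex \<gamma> (bary u 0))"
    by (rule continuous_on_compose2) (use bary_0_in_standard_simplex in auto)
  then show ?thesis by (rule continuous_on_eq) (simp add: arc_simplex_bary)
qed

lemma openin_Euclidean_space_coords: "openin (Euclidean_space n) {x. \<forall>i\<ge>n. x i = 0}"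
  unfolding openin_Euclidean_space_iff using open_UNIV by blast

text \<open>Source of reparametrised arcs (\<open>p = 1\<close>) and of triangles degenerating into
  an arc (\<open>p = 2\<close>): a local lift of the arc, composed with \<open>l\<close>, is a
  lift.\<close>

lemma smooth_simplex_arc_compose:
  assumes \<gamma>: "smooth_arc \<gamma>" and l: "smooth_vars_on (Suc p) {x. \<forall>i\<ge>Suc p. x i = 0} l"
    and l01: "\<And>t. t \<in> standard_simplex p \<Longrightarrow> l t \<in> {0..1}"
  shows "smooth_simplex A p (restrict (\<lambda>t. \<gamma> (l t)) (standard_simplex p))"
proof (rule smooth_simplexI)
  fix t assume t: "t \<in> standard_simplex p"
  obtain c where c: "c \<in> A" "\<gamma> (l t) \<in> chart_dom c" by (rule chart_cover)
  obtain J G where J: "open J" "l t \<in> J" "smooth_on J G"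
    "\<And>v. v \<in> J \<Longrightarrow> v \<in> {0..1} \<Longrightarrow> \<gamma> v \<in> chart_dom c \<and> G v = chart_map c (\<gamma> v)"
    using smooth_arc_lift[OF \<gamma> l01[OF t] c] by metis
  let ?E = "{x::nat \<Rightarrow> real. \<forall>i\<ge>Suc p. x i = 0}"
  let ?W = "{x \<in> ?E. l x \<in> J}"
  have W: "openin (Euclidean_space (Suc p)) ?W"
    by (rule openin_Euclidean_space_preimage[OF openin_Euclidean_space_coords
          smooth_vars_on_imp_continuous_on[OF l] J(1)])
  have "smooth_vars_on (Suc p) ?W (\<lambda>x. G (l x))"
    by (rule smooth_vars_on_compose_real[OF W smooth_vars_on_subset[OF l] J(3)]) auto
  then have "lifts p (restrict (\<lambda>t. \<gamma> (l t)) (standard_simplex p)) c ?W (\<lambda>x. G (l x))"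
    unfolding lifts_def using W J(4) l01 by auto
  moreover have "t \<in> ?W" using t J(2) standard_simplex_subset by auto
  ultimately show "\<exists>c\<in>A. \<exists>W F. lifts p (restrict (\<lambda>t. \<gamma> (l t)) (standard_simplex p)) c W F \<and> t \<in> W"
    using c(1) by blast
qed simp

lemmas smooth_coords = smooth_vars_on_const[OF openin_Euclidean_space_coords]
  smooth_vars_on_coord[OF openin_Euclidean_space_coords]
  smooth_vars_on_add[OF openin_Euclidean_space_coords]
  smooth_vars_on_bilinear[OF openin_Euclidean_space_coords bounded_bilinear_mult]

text \<open>Sub-arcs, reversed arcs and constant arcs are all instances.\<close>

lemma smooth_arc_affine:
  assumes \<gamma>: "smooth_arc \<gamma>" and ab: "a \<in> {0..1}" "b \<in> {0..1}"
  shows "smooth_arc (\<lambda>u. \<gamma> ((1 - u) * a + u * b))"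
proof -
  have "smooth_vars_on (Suc 1) {x. \<forall>i\<ge>Suc 1. x i = 0} (\<lambda>x. x 0 * a + x 1 * b)"
    by (intro smooth_coords)
  moreover have "t 0 * a + t 1 * b \<in> {0..1}" if "t \<in> standard_simplex 1" for t
  proof -
    have "t 0 = 1 - t 1" "t 1 \<in> {0..1}" using that by (auto simp: standard_simplex_def)
    then show ?thesis using ab convexD_alt[of "{0..1::real}" a b "t 1"] by simp
  qed
  ultimately have "smooth_simplex A 1 (restrict (\<lambda>t. \<gamma> (t 0 * a + t 1 * b)) (standard_simplex 1))"
    by (rule smooth_simplex_arc_compose[OF \<gamma>])
  moreover have "restrict (\<lambda>t. \<gamma> (t 0 * a + t 1 * b)) (standard_simplex 1)
      = arc_simplex (\<lambda>u. \<gamma> ((1 - u) * a + u * b))"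
    unfolding arc_simplex_def by (rule restrict_ext) (simp add: standard_simplex_1D)
  ultimately show ?thesis unfolding smooth_arc_def by simp
qed

end

section \<open>Triangles and the cocycle relation on their boundaries\<close>

definition triangle_simplex :: "(real \<Rightarrow> real \<Rightarrow> real \<Rightarrow> 'a) \<Rightarrow> (nat \<Rightarrow> real) \<Rightarrow> 'a" where
  "triangle_simplex f = restrict (\<lambda>t. f (t 0) (t 1) (t 2)) (standard_simplex 2)"

lemma singular_face_triangle_simplex:
  "singular_face 2 0 (triangle_simplex f) = arc_simplex (\<lambda>u. f 0 (1 - u) u)"
  "singular_face 2 1 (triangle_simplex f) = arc_simplex (\<lambda>u. f (1 - u) 0 u)"
  "singular_face 2 2 (triangle_simplex f) = arc_simplex (\<lambda>u. f (1 - u) u 0)"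
proof -
  have eq: "singular_face 2 k (triangle_simplex f) = restrict
      (\<lambda>t. f (simplical_face k t 0) (simplical_face k t 1) (simplical_face k t 2)) (standard_simplex 1)"
    if "k \<le> 2" for k
  proof -
    have s: "2 - Suc 0 = (1::nat)" by simp
    show ?thesis
      unfolding singular_face_def triangle_simplex_def s
    proof (rule restrict_ext)
      fix t :: "nat \<Rightarrow> real" assume "t \<in> standard_simplex 1"
      then have "simplical_face k t \<in> standard_simplex 2"
        using that by (intro simplical_face_in_standard_simplex) (auto simp: numeral_2_eq_2)
      then show "(restrict (\<lambda>t. f (t 0) (t 1) (t 2)) (standard_simplex 2) \<circ> simplical_face k) t
          = f (simplical_face k t 0) (simplical_face k t 1) (simplical_face k t 2)"
        by simp
    qed
  qed
  show "singular_face 2 0 (triangle_simplex f) = arc_simplex (\<lambda>u. f 0 (1 - u) u)"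
    "singular_face 2 1 (triangle_simplex f) = arc_simplex (\<lambda>u. f (1 - u) 0 u)"
    "singular_face 2 2 (triangle_simplex f) = arc_simplex (\<lambda>u. f (1 - u) u 0)"
    unfolding arc_simplex_def
    by (subst eq, simp, rule restrict_ext, simp add: simplical_face_def standard_simplex_1D)+
qed

lemma sing_coboundary_1_eq:
  assumes "smooth_simplex A 2 \<sigma>"
  shows "sing_coboundary A 1 \<theta> \<sigma> =
    \<theta> (singular_face 2 0 \<sigma>) - \<theta> (singular_face 2 1 \<sigma>) + \<theta> (singular_face 2 2 \<sigma>)"
  using assms by (simp add: sing_coboundary_def alt_sign_def numeral_2_eq_2)

lemma cocycle_triangle:
  assumes "sing_coboundary A 1 \<theta> = (\<lambda>_. 0)" "smooth_simplex A 2 (triangle_simplex f)"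
  shows "\<theta> (arc_simplex (\<lambda>u. f (1 - u) 0 u)) =
    \<theta> (arc_simplex (\<lambda>u. f 0 (1 - u) u)) + \<theta> (arc_simplex (\<lambda>u. f (1 - u) u 0))"
  using sing_coboundary_1_eq[OF assms(2), of \<theta>] assms(1)
  by (simp add: singular_face_triangle_simplex algebra_simps del: One_nat_def)

context atlas_space
begin

text \<open>The triangle with vertices at the parameters \<open>e\<close>, \<open>a\<close>,
  \<open>b\<close> is degenerate: it factors through the arc and is therefore smooth.\<close>

lemma cocycle_affine:
  assumes \<theta>: "sing_coboundary A 1 \<theta> = (\<lambda>_. 0)" and \<gamma>: "smooth_arc \<gamma>"
    and abe: "a \<in> {0..1}" "b \<in> {0..1}" "e \<in> {0..1}"
  shows "\<theta> (arc_simplex (\<lambda>u. \<gamma> ((1 - u) * e + u * b))) =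
    \<theta> (arc_simplex (\<lambda>u. \<gamma> ((1 - u) * a + u * b))) + \<theta> (arc_simplex (\<lambda>u. \<gamma> ((1 - u) * e + u * a)))"
proof -
  have "smooth_vars_on (Suc 2) {x. \<forall>i\<ge>Suc 2. x i = 0} (\<lambda>x. x 0 * e + x 1 * a + x 2 * b)"
    by (intro smooth_coords)
  moreover have "t 0 * e + t 1 * a + t 2 * b \<in> {0..1}" if "t \<in> standard_simplex 2" for t
  proof -
    note t = standard_simplex_2D[OF that]
    have "t 0 * e + t 1 * a + t 2 * b \<le> t 0 * 1 + t 1 * 1 + t 2 * 1"
      using abe t by (intro add_mono mult_left_mono) auto
    moreover have "0 \<le> t 0 * e + t 1 * a + t 2 * b" using abe t by simp
    ultimately show ?thesis using t by simp
  qed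
  ultimately have "smooth_simplex A 2 (restrict (\<lambda>t. \<gamma> (t 0 * e + t 1 * a + t 2 * b)) (standard_simplex 2))"
    by (rule smooth_simplex_arc_compose[OF \<gamma>])
  then have "smooth_simplex A 2 (triangle_simplex (\<lambda>x y z. \<gamma> (x * e + y * a + z * b)))"
    unfolding triangle_simplex_def .
  from cocycle_triangle[OF \<theta> this] show ?thesis by simp
qed

text \<open>With all three vertices equal, \<open>cocycle_affine\<close> says that the value equals
  twice itself.\<close>

lemma cocycle_const_arc:
  assumes \<theta>: "sing_coboundary A 1 \<theta> = (\<lambda>_. 0)" and \<gamma>: "smooth_arc \<gamma>" and a: "a \<in> {0..1}"
  shows "\<theta> (arc_simplex (\<lambda>_. \<gamma> a)) = 0"
proof -
  have "(1 - u) * a + u * a = a" for u by (simp add: algebra_simps)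
  then show ?thesis using cocycle_affine[OF \<theta> \<gamma> a a a] by simp
qed

definition chart_segment :: "('a, 'e) chart \<Rightarrow> 'e \<Rightarrow> 'e \<Rightarrow> real \<Rightarrow> 'a" where
  "chart_segment c p q u = chart_inv c ((1 - u) *\<^sub>R p + u *\<^sub>R q)"

lemma smooth_arc_chart_segment:
  assumes c: "c \<in> A" and V: "convex V" "V \<subseteq> chart_map c ` chart_dom c" and pq: "p \<in> V" "q \<in> V"
  shows "smooth_arc (chart_segment c p q)"
  unfolding smooth_arc_def
proof (rule smooth_simplexI)
  fix t assume t: "t \<in> standard_simplex 1"
  \<comment> \<open>The lift is an affine map on the whole coordinate space; only its values on the
    simplex have to lie in the chart.\<close>
  let ?E = "{x::nat \<Rightarrow> real. \<forall>i\<ge>Suc 1. x i = 0}" and ?F = "\<lambda>x. x 0 *\<^sub>R p + x (1::nat) *\<^sub>R q"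
  have "smooth_vars_on (Suc 1) ?E ?F"
    by (intro smooth_coords smooth_vars_on_bilinear[OF openin_Euclidean_space_coords bounded_bilinear_scaleR])
  moreover have "arc_simplex (chart_segment c p q) s \<in> chart_dom c \<and>
      ?F s = chart_map c (arc_simplex (chart_segment c p q) s)" if s: "s \<in> standard_simplex 1" for s
  proof -
    have "?F s \<in> V"
      using s standard_simplex_1D[OF s] standard_simplex_1_coord[OF s] V(1) pq by (simp add: convexD_alt)
    then have "?F s \<in> chart_map c ` chart_dom c" using V(2) by blast
    moreover have "arc_simplex (chart_segment c p q) s = chart_inv c (?F s)"
      using s by (simp add: arc_simplex_def chart_segment_def standard_simplex_1D)
    ultimately show ?thesis using c by simp
  qed
  ultimately have "lifts 1 (arc_simplex (chart_segment c p q)) c ?E ?F"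
    unfolding lifts_def using openin_Euclidean_space_coords by blast
  moreover have "t \<in> ?E" using t standard_simplex_subset by blast
  ultimately show "\<exists>c'\<in>A. \<exists>W F. lifts 1 (arc_simplex (chart_segment c p q)) c' W F \<and> t \<in> W"
    using c by blast
qed (simp add: arc_simplex_def)

text \<open>
  The simplex \<open>(t\<^sub>0, t\<^sub>1, t\<^sub>2) \<mapsto> t\<^sub>0 p + t\<^sub>1 \<gamma>(t\<^sub>2) + t\<^sub>2 \<gamma>(1 - t\<^sub>1)\<close> fills the triangle formed by \<open>\<gamma>\<close> and the
  segments from \<open>p\<close> to its ends. Unlike the cone over \<open>\<gamma>\<close> it is smooth at the apex.
\<close>

lemma cocycle_cone:
  assumes \<theta>: "sing_coboundary A 1 \<theta> = (\<lambda>_. 0)"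
    and c: "c \<in> A" and V: "convex V" "V \<subseteq> chart_map c ` chart_dom c" and p: "p \<in> V"
    and \<gamma>: "smooth_arc \<gamma>" and \<gamma>V: "\<And>u. u \<in> {0..1} \<Longrightarrow> \<gamma> u \<in> chart_dom c \<and> chart_map c (\<gamma> u) \<in> V"
  shows "\<theta> (arc_simplex (chart_segment c p (chart_map c (\<gamma> 1)))) =
    \<theta> (arc_simplex \<gamma>) + \<theta> (arc_simplex (chart_segment c p (chart_map c (\<gamma> 0))))"
proof -
  define g where "g u = chart_map c (\<gamma> u)" for u
  define m where "m x y z = x *\<^sub>R p + y *\<^sub>R g z + z *\<^sub>R g (1 - y)" for x y z
  have mV: "m (t 0) (t 1) (t 2) \<in> V" if "t \<in> standard_simplex 2" for t
  proof -
    note t = standard_simplex_2D[OF that]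
    have "g (t 2) \<in> V" "g (1 - t 1) \<in> V" using \<gamma>V t by (auto simp: g_def)
    then have "(\<Sum>i\<in>{0, 1, 2::nat}. t i *\<^sub>R (if i = 0 then p else if i = 1 then g (t 2) else g (1 - t 1))) \<in> V"
      using t p by (intro convex_sum[OF _ V(1)]) auto
    then show ?thesis by (simp add: m_def add.assoc)
  qed
  have "smooth_simplex A 2 (triangle_simplex (\<lambda>x y z. chart_inv c (m x y z)))"
  proof (rule smooth_simplexI)
    fix t assume t: "t \<in> standard_simplex 2"
    note t' = standard_simplex_2D[OF t]
    have t2: "t 2 \<in> {0..1}" and t1: "1 - t 1 \<in> {0..1}" using t' by auto
    \<comment> \<open>The map \<open>m\<close> reads the arc at the two parameters
      \<open>t 2\<close> and \<open>1 - t 1\<close>, so two local lifts are needed.\<close>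
    obtain J G where J: "open J" "t 2 \<in> J" "smooth_on J G"
      "\<And>v. v \<in> J \<Longrightarrow> v \<in> {0..1} \<Longrightarrow> \<gamma> v \<in> chart_dom c \<and> G v = chart_map c (\<gamma> v)"
      using smooth_arc_lift[OF \<gamma> t2 c] \<gamma>V[OF t2] by metis
    obtain K H where K: "open K" "1 - t 1 \<in> K" "smooth_on K H"
      "\<And>v. v \<in> K \<Longrightarrow> v \<in> {0..1} \<Longrightarrow> \<gamma> v \<in> chart_dom c \<and> H v = chart_map c (\<gamma> v)"
      using smooth_arc_lift[OF \<gamma> t1 c] \<gamma>V[OF t1] by metis
    let ?E = "{x::nat \<Rightarrow> real. \<forall>i\<ge>Suc 2. x i = 0}"
    let ?W = "{x \<in> {x \<in> ?E. x 2 \<in> J}. 1 + (- 1) * x 1 \<in> K}"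
    let ?F = "\<lambda>x. x 0 *\<^sub>R p + x 1 *\<^sub>R G (x 2) + x 2 *\<^sub>R H (1 + (- 1) * x 1)"
    have s1: "smooth_vars_on (Suc 2) ?E (\<lambda>x. 1 + (- 1) * x 1)" and s2: "smooth_vars_on (Suc 2) ?E (\<lambda>x. x 2)"
      by (intro smooth_coords)+
    have W: "openin (Euclidean_space (Suc 2)) ?W"
      by (intro openin_Euclidean_space_preimage[OF _ _ K(1)] openin_Euclidean_space_preimage[OF _ _ J(1)]
          openin_Euclidean_space_coords smooth_vars_on_imp_continuous_on[OF s2]
          continuous_on_subset[OF smooth_vars_on_imp_continuous_on[OF s1]]) auto
    have "smooth_vars_on (Suc 2) ?W (\<lambda>x. G (x 2))"
      by (rule smooth_vars_on_compose_real[OF W smooth_vars_on_subset[OF s2] J(3)]) auto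
    moreover have "smooth_vars_on (Suc 2) ?W (\<lambda>x. H (1 + (- 1) * x 1))"
      by (rule smooth_vars_on_compose_real[OF W smooth_vars_on_subset[OF s1] K(3)]) auto
    ultimately have "smooth_vars_on (Suc 2) ?W ?F"
      by (intro smooth_vars_on_add[OF W] smooth_vars_on_bilinear[OF W bounded_bilinear_scaleR]
          smooth_vars_on_const[OF W] smooth_vars_on_coord[OF W])
    moreover have "triangle_simplex (\<lambda>x y z. chart_inv c (m x y z)) s \<in> chart_dom c \<and>
        ?F s = chart_map c (triangle_simplex (\<lambda>x y z. chart_inv c (m x y z)) s)"
      if "s \<in> ?W" "s \<in> standard_simplex 2" for s
    proof -
      have "m (s 0) (s 1) (s 2) \<in> chart_map c ` chart_dom c" using mV[OF that(2)] V(2) by blast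
      moreover have "?F s = m (s 0) (s 1) (s 2)"
        using that J(4)[of "s 2"] K(4)[of "1 - s 1"] standard_simplex_2D[OF that(2)]
        by (simp add: m_def g_def)
      ultimately show ?thesis using c that(2) by (simp add: triangle_simplex_def)
    qed
    ultimately have "lifts 2 (triangle_simplex (\<lambda>x y z. chart_inv c (m x y z))) c ?W ?F"
      unfolding lifts_def using W by blast
    moreover have "t \<in> ?W" using t J(2) K(2) standard_simplex_subset[of 2] by auto
    ultimately show "\<exists>c'\<in>A. \<exists>W F. lifts 2 (triangle_simplex (\<lambda>x y z. chart_inv c (m x y z))) c' W F \<and> t \<in> W"
      using c by blast
  qed (simp add: triangle_simplex_def)
  from cocycle_triangle[OF \<theta> this]
  have "\<theta> (arc_simplex (\<lambda>u. chart_inv c (m (1 - u) 0 u))) =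
      \<theta> (arc_simplex (\<lambda>u. chart_inv c (m 0 (1 - u) u))) + \<theta> (arc_simplex (\<lambda>u. chart_inv c (m (1 - u) u 0)))" .
  \<comment> \<open>On the side opposite the apex both parameters equal \<open>u\<close> and the two
    weights add up to \<open>1\<close>.\<close>
  moreover have "arc_simplex (\<lambda>u. chart_inv c (m 0 (1 - u) u)) = arc_simplex \<gamma>"
  proof (rule arc_simplex_cong)
    fix u :: real assume u: "u \<in> {0..1}"
    have "m 0 (1 - u) u = g u" by (simp add: m_def scaleR_left_distrib[symmetric])
    then show "chart_inv c (m 0 (1 - u) u) = \<gamma> u" using \<gamma>V[OF u] c by (simp add: g_def)
  qed
  moreover have "(\<lambda>u. chart_inv c (m (1 - u) 0 u)) = chart_segment c p (chart_map c (\<gamma> 1))"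
    "(\<lambda>u. chart_inv c (m (1 - u) u 0)) = chart_segment c p (chart_map c (\<gamma> 0))"
    by (simp_all add: fun_eq_iff m_def g_def chart_segment_def)
  ultimately show ?thesis by simp
qed

section \<open>Joining smooth arcs; existence of smooth arcs between any two points\<close>

lemma smooth_arc_reverse:
  assumes "smooth_arc \<gamma>"
  shows "smooth_arc (\<lambda>u. \<gamma> (1 - u))"
  using smooth_arc_affine[OF assms, of 1 0] by simp

text \<open>Both arcs are reparametrised over the whole interval so as to rest at the common point
  during one half of it. Near the joint their lifts can then be added, which gives one smooth lift
  without any matching of derivatives.\<close>

lemma smooth_arc_join:
  assumes \<gamma>: "smooth_arc \<gamma>" and \<delta>: "smooth_arc \<delta>" and eq: "\<gamma> 1 = \<delta> 0"
  obtains \<eta> where "smooth_arc \<eta>" "\<eta> 0 = \<gamma> 0" "\<eta> 1 = \<delta> 1"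
proof -
  \<comment> \<open>\<open>b\<close> rises from \<open>0\<close> to \<open>1\<close> on the first
    half and rests at \<open>1\<close>; \<open>d\<close> rests at \<open>0\<close> and rises to
    \<open>1\<close> on the second half. Differences are written as sums and products to suit
    \<open>smooth_coords\<close>.\<close>
  define b where "b u = 1 + (- 1) * smooth_step (1 + (- 2) * u)" for u
  define d where "d u = smooth_step (2 * u + (- 1))" for u
  define \<eta> where "\<eta> u = (if u \<le> 1/2 then \<gamma> (b u) else \<delta> (d u))" for u
  have b1: "b u = 1" if "1/2 \<le> u" for u using that by (simp add: b_def smooth_step_simps)
  have d0: "d u = 0" if "u \<le> 1/2" for u using that by (simp add: d_def smooth_step_simps)
  have b01: "b u \<in> {0..1}" if "u \<in> {0..1}" for u
    using smooth_step_bounds[of "1 + (- 2) * u"] that by (auto simp: b_def)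
  have d01: "d u \<in> {0..1}" if "u \<in> {0..1}" for u
    using smooth_step_bounds[of "2 * u + (- 1)"] that unfolding d_def by simp
  let ?E = "{x::nat \<Rightarrow> real. \<forall>i\<ge>Suc 1. x i = 0}"
  have sb: "smooth_vars_on (Suc 1) ?E (\<lambda>x. b (x 1))" and sd: "smooth_vars_on (Suc 1) ?E (\<lambda>x. d (x 1))"
    unfolding b_def d_def
    by (intro smooth_coords smooth_vars_on_compose_real[OF openin_Euclidean_space_coords _ smooth_on_smooth_step]
        subset_UNIV)+
  have \<gamma>b: "smooth_arc (\<lambda>u. \<gamma> (b u))"
    unfolding smooth_arc_def arc_simplex_def
    by (rule smooth_simplex_arc_compose[OF \<gamma> sb]) (use b01 standard_simplex_1_coord in blast)
  have \<delta>d: "smooth_arc (\<lambda>u. \<delta> (d u))"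
    unfolding smooth_arc_def arc_simplex_def
    by (rule smooth_simplex_arc_compose[OF \<delta> sd]) (use d01 standard_simplex_1_coord in blast)
  have "smooth_simplex A 1 (arc_simplex \<eta>)"
  proof (rule smooth_simplexI)
    fix t assume t: "t \<in> standard_simplex 1"
    then have tE: "t \<in> ?E" using standard_simplex_subset by blast
    have sc: "smooth_vars_on (Suc 1) ?E (\<lambda>x. x 1)" by (intro smooth_coords)
    have t01: "t 1 \<in> {0..1}" by (rule standard_simplex_1_coord[OF t])
    consider "t 1 < 1/2" | "t 1 > 1/2" | "t 1 = 1/2" by linarith
    then show "\<exists>c\<in>A. \<exists>W F. lifts 1 (arc_simplex \<eta>) c W F \<and> t \<in> W"
    proof cases
      case 1
      obtain c W F where L: "c \<in> A" "lifts 1 (arc_simplex (\<lambda>u. \<gamma> (b u))) c W F" "t \<in> W"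
        using smooth_simplex_lift[OF \<gamma>b[unfolded smooth_arc_def] t] by metis
      let ?W = "{x \<in> W. x 1 \<in> {..<1/2}}"
      have "openin (Euclidean_space (Suc 1)) ?W"
        using L(2) unfolding lifts_def
        by (intro openin_Euclidean_space_preimage)
          (auto intro: continuous_on_subset[OF continuous_on_product_coordinates])
      moreover have "arc_simplex \<eta> s = arc_simplex (\<lambda>u. \<gamma> (b u)) s"
        if "s \<in> ?W" "s \<in> standard_simplex 1" for s
        using that by (simp add: arc_simplex_def \<eta>_def)
      ultimately have "lifts 1 (arc_simplex \<eta>) c ?W F"
        using L(2) unfolding lifts_def by (auto intro: smooth_vars_on_subset)
      then show ?thesis using L 1 by auto
    next
      case 2
      obtain c W F where L: "c \<in> A" "lifts 1 (arc_simplex (\<lambda>u. \<delta> (d u))) c W F" "t \<in> W"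
        using smooth_simplex_lift[OF \<delta>d[unfolded smooth_arc_def] t] by metis
      let ?W = "{x \<in> W. x 1 \<in> {1/2<..}}"
      have "openin (Euclidean_space (Suc 1)) ?W"
        using L(2) unfolding lifts_def
        by (intro openin_Euclidean_space_preimage)
          (auto intro: continuous_on_subset[OF continuous_on_product_coordinates])
      moreover have "arc_simplex \<eta> s = arc_simplex (\<lambda>u. \<delta> (d u)) s"
        if "s \<in> ?W" "s \<in> standard_simplex 1" for s
        using that by (simp add: arc_simplex_def \<eta>_def)
      ultimately have "lifts 1 (arc_simplex \<eta>) c ?W F"
        using L(2) unfolding lifts_def by (auto intro: smooth_vars_on_subset)
      then show ?thesis using L 2 by auto
    next
      case 3
      obtain c where c: "c \<in> A" "\<gamma> 1 \<in> chart_dom c" by (rule chart_cover)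
      obtain W F where L: "lifts 1 (arc_simplex (\<lambda>u. \<gamma> (b u))) c W F" "t \<in> W"
        using smooth_simplex_lifts[OF \<gamma>b[unfolded smooth_arc_def] c(1) t] c(2) t 3 b1
        by (auto simp: arc_simplex_def)
      obtain W' F' where L': "lifts 1 (arc_simplex (\<lambda>u. \<delta> (d u))) c W' F'" "t \<in> W'"
        using smooth_simplex_lifts[OF \<delta>d[unfolded smooth_arc_def] c(1) t] c(2) t 3 d0 eq
        by (auto simp: arc_simplex_def)
      \<comment> \<open>At each parameter one of the two reparametrised arcs rests at the joint and
        contributes \<open>chart_map c (\<gamma> 1)\<close>, which is subtracted.\<close>
      let ?W = "W \<inter> W'" and ?F = "\<lambda>x. F x + F' x + (- chart_map c (\<gamma> 1))"
      have W: "openin (Euclidean_space (Suc 1)) ?W"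
        using L(1) L'(1) unfolding lifts_def by blast
      have "smooth_vars_on (Suc 1) ?W ?F"
        using L(1) L'(1) unfolding lifts_def
        by (intro smooth_vars_on_add[OF W] smooth_vars_on_const[OF W])
          (auto intro: smooth_vars_on_subset)
      moreover have "arc_simplex \<eta> s \<in> chart_dom c \<and> ?F s = chart_map c (arc_simplex \<eta> s)"
        if s: "s \<in> ?W" "s \<in> standard_simplex 1" for s
      proof -
        have "\<gamma> (b (s 1)) \<in> chart_dom c" "F s = chart_map c (\<gamma> (b (s 1)))"
          "\<delta> (d (s 1)) \<in> chart_dom c" "F' s = chart_map c (\<delta> (d (s 1)))"
          using s L(1) L'(1) unfolding lifts_def by (auto simp: arc_simplex_def)
        then show ?thesis
          using s(2) b1[of "s 1"] d0[of "s 1"] eq by (auto simp: arc_simplex_def \<eta>_def)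
      qed
      ultimately have "lifts 1 (arc_simplex \<eta>) c ?W ?F"
        unfolding lifts_def using W by blast
      then show ?thesis using c(1) L(2) L'(2) by blast
    qed
  qed (simp add: arc_simplex_def)
  moreover have "\<eta> 0 = \<gamma> 0" "\<eta> 1 = \<delta> 1"
    by (simp_all add: \<eta>_def b_def d_def smooth_step_simps)
  ultimately show ?thesis using that unfolding smooth_arc_def by blast
qed

lemma chart_ball:
  assumes c: "c \<in> A" and x: "x \<in> chart_dom c"
  obtains r where "r > 0" "ball (chart_map c x) r \<subseteq> chart_map c ` chart_dom c"
  using open_chart_image[OF c] x by (meson image_eqI open_contains_ball)

lemma open_chart_preimage:
  assumes c: "c \<in> A" and V: "open V"
  shows "open {x \<in> chart_dom c. chart_map c x \<in> V}"
  using continuous_open_preimage[OF continuous_on_chart_map[OF c] open_chart_dom[OF c] V]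
  by (simp add: vimage_def Int_def)

lemma chart_segment_ends:
  assumes "c \<in> A" "x \<in> chart_dom c" "y \<in> chart_dom c"
  shows "chart_segment c (chart_map c x) (chart_map c y) 0 = x"
    "chart_segment c (chart_map c x) (chart_map c y) 1 = y"
  using assms by (simp_all add: chart_segment_def)

text \<open>Being joined by a smooth arc is an equivalence relation that holds between a point and
  all points of a chart ball around it, hence it is everything on a connected space.\<close>

lemma smooth_arc_exists:
  assumes "connected (UNIV :: 'a set)"
  obtains \<gamma> where "smooth_arc \<gamma>" "\<gamma> 0 = x" "\<gamma> 1 = y"
proof -
  have "\<exists>\<gamma>. smooth_arc \<gamma> \<and> \<gamma> 0 = x \<and> \<gamma> 1 = y"
  proof (rule connected_equivalence_relation[OF assms, where R = "\<lambda>x y. \<exists>\<gamma>. smooth_arc \<gamma> \<and> \<gamma> 0 = x \<and> \<gamma> 1 = y"])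
    fix x y assume "\<exists>\<gamma>. smooth_arc \<gamma> \<and> \<gamma> 0 = x \<and> \<gamma> 1 = y"
    then obtain \<gamma> where "smooth_arc \<gamma>" "\<gamma> 0 = x" "\<gamma> 1 = y" by blast
    then show "\<exists>\<gamma>. smooth_arc \<gamma> \<and> \<gamma> 0 = y \<and> \<gamma> 1 = x"
      by (intro exI[of _ "\<lambda>u. \<gamma> (1 - u)"]) (simp add: smooth_arc_reverse)
  next
    fix x y z assume "\<exists>\<gamma>. smooth_arc \<gamma> \<and> \<gamma> 0 = x \<and> \<gamma> 1 = y" "\<exists>\<gamma>. smooth_arc \<gamma> \<and> \<gamma> 0 = y \<and> \<gamma> 1 = z"
    then show "\<exists>\<gamma>. smooth_arc \<gamma> \<and> \<gamma> 0 = x \<and> \<gamma> 1 = z"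
      by (metis smooth_arc_join)
  next
    fix x
    obtain c where c: "c \<in> A" "x \<in> chart_dom c" by (rule chart_cover)
    obtain r where r: "r > 0" "ball (chart_map c x) r \<subseteq> chart_map c ` chart_dom c"
      using chart_ball[OF c] by blast
    let ?T = "{y \<in> chart_dom c. chart_map c y \<in> ball (chart_map c x) r}"
    have "\<exists>\<gamma>. smooth_arc \<gamma> \<and> \<gamma> 0 = x \<and> \<gamma> 1 = y" if "y \<in> ?T" for y
      using smooth_arc_chart_segment[OF c(1) convex_ball r(2), of "chart_map c x" "chart_map c y"]
        chart_segment_ends[OF c, of y] that r(1) by auto
    then show "\<exists>T. openin (top_of_set UNIV) T \<and> x \<in> T \<and> (\<forall>y\<in>T. \<exists>\<gamma>. smooth_arc \<gamma> \<and> \<gamma> 0 = x \<and> \<gamma> 1 = y)"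
      using open_chart_preimage[OF c(1) open_ball] c r(1) by (intro exI[of _ ?T]) auto
  qed auto
  then show ?thesis using that by blast
qed

end

section \<open>Smooth cocycles on simply connected manifolds\<close>

context atlas_space
begin

lemma open_chart_map_image:
  assumes "c \<in> A" "open U"
  shows "open (chart_map c ` (chart_dom c \<inter> U))"
proof -
  have "openin (top_of_set (chart_dom c)) (chart_dom c \<inter> U)"
    using assms(2) by (rule openin_open_Int)
  then have "openin (top_of_set (chart_map c ` chart_dom c)) (chart_map c ` (chart_dom c \<inter> U))"
    by (rule homeomorphism_imp_open_map[OF chart_homeo[OF assms(1)]])
  then show ?thesis
    using openin_open_eq[OF open_chart_image[OF assms(1)]] by auto
qed

text \<open>The values on short straight segments form local differences, by the cone relation, and
  the increment of these along a smooth arc is the value of the cocycle on it. The claim is then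
  \<open>has_increment_triangle\<close>, where smoothness no longer enters.\<close>

lemma cocycle_arc_triangle:
  fixes \<theta> :: "('a, 'm::ab_group_add) sing_cochain"
  assumes \<theta>: "sing_coboundary A 1 \<theta> = (\<lambda>_. 0)" and sc: "simply_connected (UNIV :: 'a set)"
    and arcs: "smooth_arc \<gamma>" "smooth_arc \<delta>" "smooth_arc \<eta>"
    and ends: "\<gamma> 1 = \<delta> 0" "\<delta> 1 = \<eta> 1" "\<gamma> 0 = \<eta> 0"
  shows "\<theta> (arc_simplex \<eta>) = \<theta> (arc_simplex \<gamma>) + \<theta> (arc_simplex \<delta>)"
proof -
  \<comment> \<open>A chart and a radius are fixed at every point, so that the germs become a
    function of points.\<close>
  have "\<exists>c r. c \<in> A \<and> x \<in> chart_dom c \<and> r > 0 \<and> ball (chart_map c x) r \<subseteq> chart_map c ` chart_dom c" for x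
  proof -
    obtain c where c: "c \<in> A" "x \<in> chart_dom c" by (rule chart_cover)
    obtain r where "r > 0" "ball (chart_map c x) r \<subseteq> chart_map c ` chart_dom c"
      by (rule chart_ball[OF c])
    with c show ?thesis by blast
  qed
  from choice[OF allI[OF this]] obtain C where
    "\<forall>x. \<exists>r. C x \<in> A \<and> x \<in> chart_dom (C x) \<and> r > 0 \<and> ball (chart_map (C x) x) r \<subseteq> chart_map (C x) ` chart_dom (C x)" ..
  from choice[OF this] obtain R where CR': "\<forall>x. C x \<in> A \<and> x \<in> chart_dom (C x) \<and> R x > 0 \<and>
      ball (chart_map (C x) x) (R x) \<subseteq> chart_map (C x) ` chart_dom (C x)" ..
  have CR: "\<And>x. C x \<in> A" "\<And>x. x \<in> chart_dom (C x)" "\<And>x. R x > 0"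
    "\<And>x. ball (chart_map (C x) x) (R x) \<subseteq> chart_map (C x) ` chart_dom (C x)"
    by (rule CR'[THEN spec, THEN conjunct1] CR'[THEN spec, THEN conjunct2, THEN conjunct1]
        CR'[THEN spec, THEN conjunct2, THEN conjunct2, THEN conjunct1]
        CR'[THEN spec, THEN conjunct2, THEN conjunct2, THEN conjunct2])+
  define B where "B x = ball (chart_map (C x) x) (R x)" for x
  define U where "U x = {y \<in> chart_dom (C x). chart_map (C x) y \<in> B x}" for x
  \<comment> \<open>Only for \<open>y\<close> in \<open>U x\<close> is the segment known to stay in
    the chart; other values are irrelevant, since only germs at \<open>x\<close> enter.\<close>
  define D where "D x y = \<theta> (arc_simplex (chart_segment (C x) (chart_map (C x) x) (chart_map (C x) y)))" for x y
  have U: "open (U x)" "x \<in> U x" for x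
    unfolding U_def B_def using open_chart_preimage[OF CR(1) open_ball] CR(2,3) by auto
  have cone: "D x (\<gamma> 1) = \<theta> (arc_simplex \<gamma>) + D x (\<gamma> 0)"
    if "smooth_arc \<gamma>" "\<And>u. u \<in> {0..1} \<Longrightarrow> \<gamma> u \<in> U x" for x \<gamma>
    unfolding D_def
  proof (rule cocycle_cone[OF \<theta> CR(1) _ _ _ that(1), where V = "B x"])
    show "\<gamma> u \<in> chart_dom (C x) \<and> chart_map (C x) (\<gamma> u) \<in> B x" if "u \<in> {0..1}" for u
      using \<open>\<And>u. u \<in> {0..1} \<Longrightarrow> \<gamma> u \<in> U x\<close>[OF that] by (simp add: U_def)
  qed (use CR in \<open>auto simp: B_def\<close>)
  have D: "local_differences D"
    unfolding local_differences_def
  proof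
    fix x
    have "\<forall>\<^sub>F y in nhds x. y \<in> U x" using U by (rule eventually_nhds_in_open)
    then show "\<forall>\<^sub>F y in nhds x. \<forall>\<^sub>F z in nhds y. D x z = D x y + D y z"
    proof eventually_elim
      case (elim y)
      let ?c = "C y" and ?q = "chart_map (C y) y"
      \<comment> \<open>The segment from \<open>y\<close> to \<open>z\<close> is straight in the
        chart at \<open>y\<close> and in general curved in the one at \<open>x\<close>. The radius
        \<open>s\<close> keeps it inside \<open>U x\<close>, where the cone with apex
        \<open>x\<close> applies to any arc.\<close>
      have "?q \<in> chart_map ?c ` (chart_dom ?c \<inter> U x)" using elim CR(2) by blast
      then obtain s where s: "s > 0" "ball ?q s \<subseteq> chart_map ?c ` (chart_dom ?c \<inter> U x)"
        using open_chart_map_image[OF CR(1)[of y] U(1)[of x], unfolded open_contains_ball] by blast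
      have "\<forall>\<^sub>F z in nhds y. z \<in> {z \<in> chart_dom ?c. chart_map ?c z \<in> ball ?q s}"
        using s(1) CR(2) by (intro eventually_nhds_in_open open_chart_preimage[OF CR(1) open_ball]) auto
      then show ?case
      proof eventually_elim
        case (elim z)
        let ?\<sigma> = "chart_segment ?c ?q (chart_map ?c z)"
        have qs: "?q \<in> ball ?q s" using s(1) by simp
        have "smooth_arc ?\<sigma>"
          by (rule smooth_arc_chart_segment[OF CR(1) convex_ball _ qs]) (use s elim in auto)
        moreover have "?\<sigma> u \<in> U x" if "u \<in> {0..1}" for u
        proof -
          have "(1 - u) *\<^sub>R ?q + u *\<^sub>R chart_map ?c z \<in> ball ?q s"
            by (rule convexD_alt[OF convex_ball qs]) (use elim that in auto)
          then have "(1 - u) *\<^sub>R ?q + u *\<^sub>R chart_map ?c z \<in> chart_map ?c ` (chart_dom ?c \<inter> U x)"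
            using s(2) by blast
          then show ?thesis unfolding chart_segment_def using CR(1) by auto
        qed
        ultimately have "D x (?\<sigma> 1) = \<theta> (arc_simplex ?\<sigma>) + D x (?\<sigma> 0)" by (rule cone)
        moreover have "?\<sigma> 0 = y" "?\<sigma> 1 = z"
          using chart_segment_ends[OF CR(1) CR(2)] elim by auto
        ultimately show ?case by (simp add: D_def add.commute)
      qed
    qed
  qed
  have incr: "has_increment D \<gamma> (\<theta> (arc_simplex \<gamma>))" if \<gamma>: "smooth_arc \<gamma>" for \<gamma>
  proof -
    \<comment> \<open>The primitive along the arc is the value of the cocycle on the initial piece
      up to \<open>t\<close>.\<close>
    define \<psi> where "\<psi> t = \<theta> (arc_simplex (\<lambda>u. \<gamma> ((1 - u) * 0 + u * t)))" for t
    have "\<forall>\<^sub>F t in nhds s. t \<in> {0..1} \<longrightarrow> \<psi> t = \<psi> s + D (\<gamma> s) (\<gamma> t)" if s: "s \<in> {0..1}" for s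
    proof -
      \<comment> \<open>The segment from a point to itself is a constant arc, so the second term of
        the cone relation drops out.\<close>
      have "D (\<gamma> s) (\<gamma> s) = \<theta> (arc_simplex (\<lambda>_. \<gamma> s))"
        unfolding D_def chart_segment_def
        using CR(1,2)[of "\<gamma> s"] by (simp add: scaleR_left_distrib[symmetric])
      then have D0: "D (\<gamma> s) (\<gamma> s) = 0" using cocycle_const_arc[OF \<theta> \<gamma> s] by simp
      obtain N where N: "open N" "N \<inter> {0..1} = \<gamma> -` U (\<gamma> s) \<inter> {0..1}"
        using smooth_arc_continuous_on[OF \<gamma>] U(1)[of "\<gamma> s"] unfolding continuous_on_open_invariant by blast
      have "s \<in> N" using N(2) s U(2) by blast
      then obtain d where d: "d > 0" "ball s d \<subseteq> N" using N(1)[unfolded open_contains_ball] by blast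
      have "\<forall>\<^sub>F t in nhds s. t \<in> ball s d" using d(1) by (intro eventually_nhds_in_open) auto
      then show ?thesis
      proof eventually_elim
        case (elim t)
        show ?case
        proof
          assume t: "t \<in> {0..1}"
          let ?\<gamma> = "\<lambda>u. \<gamma> ((1 - u) * s + u * t)"
          have "?\<gamma> u \<in> U (\<gamma> s)" if u: "u \<in> {0..1}" for u
          proof -
            have "(1 - u) *\<^sub>R s + u *\<^sub>R t \<in> ball s d \<inter> {0..1}"
              by (rule convexD_alt) (use d(1) elim s t u in \<open>auto intro: convex_Int\<close>)
            then have "(1 - u) *\<^sub>R s + u *\<^sub>R t \<in> N \<inter> {0..1}" using d(2) by blast
            then show ?thesis unfolding N(2) by simp
          qed
          from cone[OF smooth_arc_affine[OF \<gamma> s t] this]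
          have "D (\<gamma> s) (\<gamma> t) = \<theta> (arc_simplex ?\<gamma>)" using D0 by simp
          moreover have "\<psi> t = \<theta> (arc_simplex ?\<gamma>) + \<psi> s"
            unfolding \<psi>_def by (rule cocycle_affine[OF \<theta> \<gamma> s t]) simp
          ultimately show "\<psi> t = \<psi> s + D (\<gamma> s) (\<gamma> t)" by (simp add: add.commute)
        qed
      qed
    qed
    then have "primitive_on (\<lambda>s t. D (\<gamma> s) (\<gamma> t)) {0..1} \<psi>" unfolding primitive_on_def by blast
    moreover have "\<psi> 1 - \<psi> 0 = \<theta> (arc_simplex \<gamma>)"
      using cocycle_const_arc[OF \<theta> \<gamma>, of 0] by (simp add: \<psi>_def)
    ultimately show ?thesis unfolding has_increment_def by blast
  qed
  show ?thesis
    by (rule has_increment_triangle[OF D sc _ _ _ _ _ _ incr[OF arcs(1)] incr[OF arcs(2)] incr[OF arcs(3)]])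
      (use ends arcs in \<open>auto simp: path_def pathfinish_def pathstart_def intro: smooth_arc_continuous_on\<close>)
qed

section \<open>The pairing of a cocycle with paths\<close>

lemma vertex_bary: "vertex 0 = bary 0 0" "vertex 1 = bary 1 0"
  by (auto simp: vertex_def bary_def)

text \<open>The given path, the one picked by \<open>SOME\<close> and a constant arc at
  \<open>x\<close> are the sides of a triangle, and the constant arc contributes zero.\<close>

lemma path_pairing_eq:
  fixes \<theta> :: "('a, 'm::ab_group_add) sing_cochain"
  assumes oc: "one_connected (UNIV :: 'a set)" and \<theta>: "sing_coboundary A 1 \<theta> = (\<lambda>_. 0)"
    and \<sigma>: "smooth_simplex A 1 \<sigma>" "\<sigma> (vertex 0) = x" "\<sigma> (vertex 1) = y"
  shows "path_pairing A x y \<theta> = \<theta> \<sigma>"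
proof -
  let ?P = "\<lambda>\<sigma>. smooth_simplex A 1 \<sigma> \<and> \<sigma> (vertex 0) = x \<and> \<sigma> (vertex 1) = y"
  define \<tau> where "\<tau> = (SOME \<sigma>. ?P \<sigma>)"
  have \<tau>: "?P \<tau>" unfolding \<tau>_def using \<sigma> by (intro someI[of ?P \<sigma>]) blast
  let ?\<gamma> = "\<lambda>u. \<sigma> (bary u 0)" and ?\<delta> = "\<lambda>u. \<tau> (bary u 0)"
  note s = smooth_arc_of_simplex[OF \<sigma>(1)] and t = smooth_arc_of_simplex[OF conjunct1[OF \<tau>]]
  have 0: "smooth_arc (\<lambda>_. ?\<gamma> 0)" "\<theta> (arc_simplex (\<lambda>_. ?\<gamma> 0)) = 0"
    using smooth_arc_affine[OF s(1), of 0 0] cocycle_const_arc[OF \<theta> s(1), of 0] by simp_all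
  have "\<theta> (arc_simplex ?\<delta>) = \<theta> (arc_simplex (\<lambda>_. ?\<gamma> 0)) + \<theta> (arc_simplex ?\<gamma>)"
    by (rule cocycle_arc_triangle[OF \<theta> _ 0(1) s(1) t(1)])
      (use oc \<sigma> \<tau> in \<open>auto simp: one_connected_def vertex_bary simp del: One_nat_def\<close>)
  then show ?thesis
    unfolding path_pairing_def \<tau>_def[symmetric] s(2) t(2) using 0(2) by simp
qed

lemma smooth_path_exists:
  assumes oc: "one_connected (UNIV :: 'a set)"
  obtains \<sigma> where "smooth_simplex A 1 \<sigma>" "\<sigma> (vertex 0) = x" "\<sigma> (vertex 1) = y"
proof -
  obtain \<gamma> where \<gamma>: "smooth_arc \<gamma>" "\<gamma> 0 = x" "\<gamma> 1 = y"
    using smooth_arc_exists[of x y] oc unfolding one_connected_def by metis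
  show ?thesis
    by (rule that[of "arc_simplex \<gamma>"])
      (use \<gamma> arc_simplex_bary[of 0 \<gamma>] arc_simplex_bary[of 1 \<gamma>] in
        \<open>auto simp: smooth_arc_def vertex_bary simp del: One_nat_def\<close>)
qed

lemma path_pairing_trans:
  fixes \<theta> :: "('a, 'm::ab_group_add) sing_cochain"
  assumes oc: "one_connected (UNIV :: 'a set)" and \<theta>: "sing_coboundary A 1 \<theta> = (\<lambda>_. 0)"
  shows "path_pairing A x z \<theta> = path_pairing A x y \<theta> + path_pairing A y z \<theta>"
proof -
  obtain \<sigma> where \<sigma>: "smooth_simplex A 1 \<sigma>" "\<sigma> (vertex 0) = x" "\<sigma> (vertex 1) = y"
    by (rule smooth_path_exists[OF oc])
  obtain \<tau> where \<tau>: "smooth_simplex A 1 \<tau>" "\<tau> (vertex 0) = y" "\<tau> (vertex 1) = z"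
    by (rule smooth_path_exists[OF oc])
  obtain \<rho> where \<rho>: "smooth_simplex A 1 \<rho>" "\<rho> (vertex 0) = x" "\<rho> (vertex 1) = z"
    by (rule smooth_path_exists[OF oc])
  note s = smooth_arc_of_simplex[OF \<sigma>(1)] and t = smooth_arc_of_simplex[OF \<tau>(1)]
    and r = smooth_arc_of_simplex[OF \<rho>(1)]
  have "\<theta> \<rho> = \<theta> \<sigma> + \<theta> \<tau>"
    using cocycle_arc_triangle[OF \<theta> _ s(1) t(1) r(1)] oc \<sigma>(2,3) \<tau>(2,3) \<rho>(2,3)
    unfolding s(2) t(2) r(2) one_connected_def vertex_bary by simp
  then show ?thesis
    using path_pairing_eq[OF oc \<theta> \<sigma>] path_pairing_eq[OF oc \<theta> \<tau>] path_pairing_eq[OF oc \<theta> \<rho>] by simp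
qed

end

section \<open>Symplectomorphisms acting on cochains\<close>

lemma simplex_map_compose:
  "simplex_map p (g \<circ> h) \<sigma> = simplex_map p g (simplex_map p h \<sigma>)"
  by (auto simp: simplex_map_def fun_eq_iff)

lemma simplex_map_inverse:
  assumes "inj g" "\<sigma> \<in> extensional (standard_simplex p)"
  shows "simplex_map p (inv_into UNIV g) (simplex_map p g \<sigma>) = \<sigma>"
  using assms by (auto simp: simplex_map_def fun_eq_iff extensional_def)

lemma singular_face_simplex_map_eq:
  assumes "1 \<le> p" "k \<le> p"
  shows "singular_face p k (simplex_map p g \<sigma>) = simplex_map (p - 1) g (singular_face p k \<sigma>)"
  unfolding singular_face_def simplex_map_def
  by (rule ext) (use simplical_face_in_standard_simplex[OF assms] in auto)

lemma smooth_simplex_extensional: "smooth_simplex A p \<sigma> \<Longrightarrow> \<sigma> \<in> extensional (standard_simplex p)"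
  unfolding smooth_simplex_def singular_simplex_def by blast

lemma vertex_in_standard_simplex: "i \<le> p \<Longrightarrow> vertex i \<in> standard_simplex p"
  unfolding vertex_def by simp

lemma bary_in_standard_simplex: "0 \<le> s \<Longrightarrow> 0 \<le> t \<Longrightarrow> s + t \<le> 1 \<Longrightarrow> bary s t \<in> standard_simplex 2"
  by (auto simp: bary_def standard_simplex_def numeral_2_eq_2)

lemma bary_ge_3: "i \<ge> 3 \<Longrightarrow> bary s t i = 0"
  by (simp add: bary_def)

text \<open>The coordinate lines of the triangle in the form required by
  \<open>smooth_vars_on_line\<close>: weight moves from vertex \<open>0\<close> to vertex
  \<open>1\<close> or \<open>2\<close>.\<close>

lemma bary_lines:
  "bary r t = (bary 0 t)(0 := (1 - t) - r, 1 := r)"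
  "bary s r = (bary s 0)(0 := (1 - s) - r, 2 := r)"
  by (auto simp: bary_def fun_eq_iff)

context atlas_space
begin

text \<open>A single intermediate chart need not contain the image of \<open>g\<close>, so the
  composite is factored near one point only.\<close>

lemma local_rep_compose:
  assumes f: "smooth_self_map A f" and g: "smooth_self_map A g"
    and c: "c \<in> A" "c'' \<in> A" and q: "q \<in> local_dom (f \<circ> g) c c''"
  obtains c' U where "c' \<in> A" "open U" "q \<in> U" "U \<subseteq> local_dom g c c'"
    "local_rep g c c' ` U \<subseteq> local_dom f c' c''"
    "\<forall>x\<in>U. local_rep f c' c'' (local_rep g c c' x) = local_rep (f \<circ> g) c c'' x"
proof -
  obtain y where y: "y \<in> chart_dom c" "f (g y) \<in> chart_dom c''" "q = chart_map c y"
    using q unfolding local_dom_def by auto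
  obtain c' where c': "c' \<in> A" "g y \<in> chart_dom c'" by (rule chart_cover)
  define U where "U = local_dom g c c' \<inter> local_rep g c c' -` local_dom f c' c''"
  have "smooth_on (local_dom g c c') (local_rep g c c')"
    using g c(1) c'(1) unfolding smooth_self_map_def by blast
  then have "open U"
    unfolding U_def
    using f g c c' unfolding smooth_self_map_def
    by (intro continuous_open_preimage smooth_on_imp_continuous_on open_local_dom) auto
  moreover have "q \<in> U"
    using y c c' by (auto simp: U_def local_domI local_rep_chart_map)
  moreover have "local_rep f c' c'' (local_rep g c c' x) = local_rep (f \<circ> g) c c'' x" if "x \<in> U" for x
  proof -
    have "g (chart_inv c x) \<in> chart_dom c'"
      using that local_domD(2)[OF c(1)] unfolding U_def by blast
    then show ?thesis using c'(1) by (simp add: local_rep_def)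
  qed
  ultimately show ?thesis
    by (intro that[OF c'(1)]) (auto simp: U_def)
qed

lemma smooth_self_map_Ck_on:
  "smooth_self_map A f \<Longrightarrow> c \<in> A \<Longrightarrow> c' \<in> A \<Longrightarrow> Ck_on k (local_dom f c c') (local_rep f c c')"
  unfolding smooth_self_map_def smooth_on_def by simp

lemma smooth_self_map_compose:
  assumes f: "smooth_self_map A f" and g: "smooth_self_map A g"
  shows "smooth_self_map A (f \<circ> g)"
  unfolding smooth_self_map_def
proof (intro conjI ballI)
  show "continuous_on UNIV (f \<circ> g)"
    using f g continuous_on_compose[of UNIV g f] continuous_on_subset[of UNIV f "range g"]
    unfolding smooth_self_map_def by simp
  fix c c'' assume c: "c \<in> A" "c'' \<in> A"
  show "smooth_on (local_dom (f \<circ> g) c c'') (local_rep (f \<circ> g) c c'')"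
    unfolding smooth_on_def
  proof (intro allI Ck_on_local)
    fix k q assume q: "q \<in> local_dom (f \<circ> g) c c''"
    obtain c' U where U: "c' \<in> A" "open U" "q \<in> U" "U \<subseteq> local_dom g c c'"
      "local_rep g c c' ` U \<subseteq> local_dom f c' c''"
      "\<forall>x\<in>U. local_rep f c' c'' (local_rep g c c' x) = local_rep (f \<circ> g) c c'' x"
      by (rule local_rep_compose[OF f g c q])
    obtain B :: "'e set" where B: "finite B" "span B = UNIV" by (rule finite_span)
    have K: "Ck_on k U (\<lambda>x. local_rep f c' c'' (local_rep g c c' x))"
      by (rule Ck_on_compose[OF B U(2) Ck_on_subset[OF smooth_self_map_Ck_on[OF g c(1) U(1)] U(4)]
            smooth_self_map_Ck_on[OF f U(1) c(2)] U(5)])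
    have "Ck_on k U (local_rep (f \<circ> g) c c'')"
      by (rule Ck_on_cong[OF U(2) bspec[OF U(6)] K])
    then show "\<exists>U. open U \<and> q \<in> U \<and> Ck_on k U (local_rep (f \<circ> g) c c'')"
      using U(2,3) by blast
  qed
qed

lemma local_rep_has_derivative:
  assumes "smooth_self_map A f" "c \<in> A" "c' \<in> A" "q \<in> local_dom f c c'"
  shows "(local_rep f c c' has_derivative frechet_derivative (local_rep f c c') (at q)) (at q)"
  using assms smooth_on_has_derivative unfolding smooth_self_map_def by blast

lemma preserves_formD:
  assumes "preserves_form A \<omega> f" "c \<in> A" "c' \<in> A" "q \<in> local_dom f c c'"
  shows "\<omega> c' (local_rep f c c' q) (frechet_derivative (local_rep f c c') (at q) u)
    (frechet_derivative (local_rep f c c') (at q) v) = \<omega> c q u v"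
  using assms unfolding preserves_form_def Let_def by blast

text \<open>Near each point the local representative factors through a chart around the image, and
  the chain rule reduces the claim to the two hypotheses.\<close>

lemma preserves_form_compose:
  assumes f: "smooth_self_map A f" "preserves_form A \<omega> f" and g: "smooth_self_map A g" "preserves_form A \<omega> g"
  shows "preserves_form A \<omega> (f \<circ> g)"
  unfolding preserves_form_def Let_def
proof (intro ballI allI)
  fix c c'' q u v assume c: "c \<in> A" "c'' \<in> A" and q: "q \<in> local_dom (f \<circ> g) c c''"
  obtain c' U where U: "c' \<in> A" "open U" "q \<in> U" "U \<subseteq> local_dom g c c'"
    "local_rep g c c' ` U \<subseteq> local_dom f c' c''"
    "\<forall>x\<in>U. local_rep f c' c'' (local_rep g c c' x) = local_rep (f \<circ> g) c c'' x"
    by (rule local_rep_compose[OF f(1) g(1) c q])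
  let ?q = "local_rep g c c' q"
  let ?Dg = "frechet_derivative (local_rep g c c') (at q)" and ?Df = "frechet_derivative (local_rep f c' c'') (at ?q)"
  have q1: "q \<in> local_dom g c c'" and q2: "?q \<in> local_dom f c' c''" using U(3-5) by auto
  have "((\<lambda>x. local_rep f c' c'' (local_rep g c c' x)) has_derivative (\<lambda>u. ?Df (?Dg u))) (at q)"
    by (rule has_derivative_compose[OF local_rep_has_derivative[OF g(1) c(1) U(1) q1]
          local_rep_has_derivative[OF f(1) U(1) c(2) q2]])
  then have "(local_rep (f \<circ> g) c c'' has_derivative (\<lambda>u. ?Df (?Dg u))) (at q)"
    by (rule has_derivative_transform_within_open[OF _ U(2,3) bspec[OF U(6)]])
  then have D: "frechet_derivative (local_rep (f \<circ> g) c c'') (at q) = (\<lambda>u. ?Df (?Dg u))"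
    by (rule frechet_derivative_eq)
  show "\<omega> c'' (local_rep (f \<circ> g) c c'' q) (frechet_derivative (local_rep (f \<circ> g) c c'') (at q) u)
      (frechet_derivative (local_rep (f \<circ> g) c c'') (at q) v) = \<omega> c q u v"
    unfolding D bspec[OF U(6) U(3), symmetric]
    using preserves_formD[OF f(2) U(1) c(2) q2] preserves_formD[OF g(2) c(1) U(1) q1] by simp
qed

section \<open>The group of symplectomorphisms and the invariance of the integral of the
  form\<close>

lemma SympD:
  assumes "g \<in> carrier (Symp A \<omega>)"
  shows "bij g" "smooth_self_map A g" "smooth_self_map A (inv_into UNIV g)" "preserves_form A \<omega> g"
  using assms unfolding Symp_def by auto

lemma Symp_mult [simp]: "g \<otimes>\<^bsub>Symp A \<omega>\<^esub> h = g \<circ> h"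
  by (simp add: Symp_def)

lemma Symp_closed:
  assumes "g \<in> carrier (Symp A \<omega>)" "h \<in> carrier (Symp A \<omega>)"
  shows "g \<circ> h \<in> carrier (Symp A \<omega>)"
proof -
  note g = SympD[OF assms(1)] and h = SympD[OF assms(2)]
  have "inv_into UNIV (g \<circ> h) = inv_into UNIV h \<circ> inv_into UNIV g" by (rule o_inv_distrib[OF g(1) h(1)])
  then show ?thesis
    using g h unfolding Symp_def
    by (simp add: bij_comp smooth_self_map_compose preserves_form_compose)
qed

text \<open>Chain rule along a coordinate line. Differentiability of \<sigma> in the chart comes
  from its lift \<open>F\<close>, with which it agrees near \<open>r\<close> because the line stays
  in the simplex for parameters in the open set \<open>N\<close>.\<close>

lemma simplex_line_derivative:
  assumes \<sigma>: "smooth_simplex A 2 \<sigma>" and g: "smooth_self_map A g" and c: "c \<in> A" "c' \<in> A"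
    and k: "\<And>r. k r = z(0 := e - r, j := r)" and j: "j \<in> {1, 2}" and z: "\<forall>i\<ge>3. z i = 0"
    and N: "open N" "r \<in> N" "\<And>u. u \<in> N \<Longrightarrow> k u \<in> standard_simplex 2"
    and dom: "\<sigma> (k r) \<in> chart_dom c" "g (\<sigma> (k r)) \<in> chart_dom c'"
  shows "vector_derivative (\<lambda>u. chart_map c' (g (\<sigma> (k u)))) (at r) =
    frechet_derivative (local_rep g c c') (at (chart_map c (\<sigma> (k r))))
      (vector_derivative (\<lambda>u. chart_map c (\<sigma> (k u))) (at r))"
proof -
  have kr: "k r \<in> standard_simplex 2" using N by blast
  obtain W F where L: "lifts 2 \<sigma> c W F" "k r \<in> W"
    using smooth_simplex_lifts[OF \<sigma> c(1) kr dom(1)] by metis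
  obtain W' F' where L': "lifts 2 (g \<circ> \<sigma>) c' W' F'" "k r \<in> W'"
    using lifts_compose[OF L kr c g dom(2)] by blast
  have W: "openin (Euclidean_space 3) W" "smooth_vars_on 3 W F" and W': "openin (Euclidean_space 3) W'" "smooth_vars_on 3 W' F'"
    using L L' unfolding lifts_def by (simp_all add: numeral_3_eq_3 numeral_2_eq_2)
  have j': "0 < (3::nat)" "j < 3" "0 \<noteq> j" using j by auto
  define O' where "O' = {u. k u \<in> W} \<inter> {u. k u \<in> W'} \<inter> N"
  have "open {u. k u \<in> W}" "open {u. k u \<in> W'}"
    unfolding k by (rule smooth_vars_on_line(1)[OF W j' z] smooth_vars_on_line(1)[OF W' j' z])+
  then have O': "open O'" "r \<in> O'" using N(1,2) L(2) L'(2) by (auto simp: O'_def)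
  have inO: "\<sigma> (k u) \<in> chart_dom c" "F (k u) = chart_map c (\<sigma> (k u))" "g (\<sigma> (k u)) \<in> chart_dom c'"
    if "u \<in> O'" for u
    using that L(1) L'(1) N(3)[of u] unfolding O'_def lifts_def by auto
  have "smooth_on {u. k u \<in> W} (\<lambda>u. F (k u))"
    unfolding k by (rule smooth_vars_on_line(2)[OF W j' z])
  then have "(\<lambda>u. F (k u)) differentiable (at r)"
    using smooth_on_has_derivative L(2) differentiable_def by blast
  then have "((\<lambda>u. F (k u)) has_vector_derivative vector_derivative (\<lambda>u. F (k u)) (at r)) (at r)"
    by (simp add: vector_derivative_works)
  then have v: "((\<lambda>u. chart_map c (\<sigma> (k u))) has_vector_derivative vector_derivative (\<lambda>u. F (k u)) (at r)) (at r)"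
    (is "(_ has_vector_derivative ?v) _")
    by (rule has_vector_derivative_transform_within_open[OF _ O']) (simp add: inO)
  let ?D = "frechet_derivative (local_rep g c c') (at (chart_map c (\<sigma> (k r))))"
  have D: "(local_rep g c c' has_derivative ?D) (at (chart_map c (\<sigma> (k r))))"
    by (rule local_rep_has_derivative[OF g c local_domI[of "\<sigma> (k r)" c g c', OF dom]])
  have "((\<lambda>u. local_rep g c c' (chart_map c (\<sigma> (k u)))) has_vector_derivative ?D ?v) (at r)"
    using has_derivative_compose[OF v[unfolded has_vector_derivative_def] D]
    unfolding has_vector_derivative_def
    by (rule has_derivative_eq_rhs) (simp add: linear_cmul[OF has_derivative_linear[OF D]])
  then have "((\<lambda>u. chart_map c' (g (\<sigma> (k u)))) has_vector_derivative ?D ?v) (at r)"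
    by (rule has_vector_derivative_transform_within_open[OF _ O'])
      (simp add: inO local_rep_chart_map[OF c(1)])
  then show ?thesis using vector_derivative_at v by metis
qed

text \<open>Needed because \<open>simplex_map 2 g \<sigma>\<close> and
  \<open>g \<circ> \<sigma>\<close> agree on the simplex only. At an interior point the coordinate
  lines stay in the simplex nearby, so the two-sided derivatives see no other values.\<close>

lemma form_density_cong_interior:
  assumes st: "0 < s" "0 < t" "s + t < 1" and eq: "\<And>x. x \<in> standard_simplex 2 \<Longrightarrow> \<sigma> x = \<tau> x"
  shows "form_density A \<omega> \<sigma> s t = form_density A \<omega> \<tau> s t"
proof -
  have b: "\<sigma> (bary s t) = \<tau> (bary s t)" by (rule eq, rule bary_in_standard_simplex) (use st in auto)
  have 1: "vector_derivative (\<lambda>r. chart_map c (\<sigma> (bary r t))) (at s) =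
      vector_derivative (\<lambda>r. chart_map c (\<tau> (bary r t))) (at s)" for c :: "('a, 'e) chart"
  proof (rule vector_derivative_cong_eq)
    have "\<forall>\<^sub>F r in nhds s. r \<in> {0<..<1 - t}" using st by (intro eventually_nhds_in_open) auto
    then show "\<forall>\<^sub>F r in nhds s. r \<in> UNIV \<longrightarrow> chart_map c (\<sigma> (bary r t)) = chart_map c (\<tau> (bary r t))"
      by eventually_elim (use st in \<open>auto intro!: arg_cong[where f = "chart_map c"] eq bary_in_standard_simplex\<close>)
  qed auto
  have 2: "vector_derivative (\<lambda>r. chart_map c (\<sigma> (bary s r))) (at t) =
      vector_derivative (\<lambda>r. chart_map c (\<tau> (bary s r))) (at t)" for c :: "('a, 'e) chart"
  proof (rule vector_derivative_cong_eq)
    have "\<forall>\<^sub>F r in nhds t. r \<in> {0<..<1 - s}" using st by (intro eventually_nhds_in_open) auto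
    then show "\<forall>\<^sub>F r in nhds t. r \<in> UNIV \<longrightarrow> chart_map c (\<sigma> (bary s r)) = chart_map c (\<tau> (bary s r))"
      by eventually_elim (use st in \<open>auto intro!: arg_cong[where f = "chart_map c"] eq bary_in_standard_simplex\<close>)
  qed auto
  show ?thesis unfolding form_density_def b 1 2 ..
qed

text \<open>The two densities use different charts, each picked by \<open>SOME\<close>. Both tangent
  vectors are carried over by the derivative of the local representative between exactly these
  charts, and \<open>preserves_form\<close> ranges over all pairs of charts.\<close>

lemma form_density_map:
  assumes \<sigma>: "smooth_simplex A 2 \<sigma>" and g: "smooth_self_map A g" "preserves_form A \<omega> g"
    and st: "0 < s" "0 < t" "s + t < 1"
  shows "form_density A \<omega> (simplex_map 2 g \<sigma>) s t = form_density A \<omega> \<sigma> s t"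
proof -
  have "form_density A \<omega> (simplex_map 2 g \<sigma>) s t = form_density A \<omega> (g \<circ> \<sigma>) s t"
    by (rule form_density_cong_interior[OF st]) (simp add: simplex_map_def)
  also have "\<dots> = form_density A \<omega> \<sigma> s t"
  proof -
    define x where "x = \<sigma> (bary s t)"
    define c where "c = (SOME c. c \<in> A \<and> x \<in> chart_dom c)"
    define c' where "c' = (SOME c. c \<in> A \<and> g x \<in> chart_dom c)"
    have c: "c \<in> A \<and> x \<in> chart_dom c"
      unfolding c_def by (rule someI_ex) (metis chart_cover)
    have c': "c' \<in> A \<and> g x \<in> chart_dom c'"
      unfolding c'_def by (rule someI_ex) (metis chart_cover)
    have d: "\<sigma> (bary s t) \<in> chart_dom c" "g (\<sigma> (bary s t)) \<in> chart_dom c'"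
      using c c' by (simp_all add: x_def)
    let ?D = "frechet_derivative (local_rep g c c') (at (chart_map c x))"
    have 1: "vector_derivative (\<lambda>u. chart_map c' (g (\<sigma> (bary u t)))) (at s) =
        ?D (vector_derivative (\<lambda>u. chart_map c (\<sigma> (bary u t))) (at s))"
      unfolding x_def
      by (rule simplex_line_derivative[OF \<sigma> g(1) conjunct1[OF c] conjunct1[OF c'] bary_lines(1),
            where N = "{0<..<1 - t}"])
        (use st d in \<open>auto simp: bary_ge_3 intro: bary_in_standard_simplex\<close>)
    have 2: "vector_derivative (\<lambda>u. chart_map c' (g (\<sigma> (bary s u)))) (at t) =
        ?D (vector_derivative (\<lambda>u. chart_map c (\<sigma> (bary s u))) (at t))"
      unfolding x_def
      by (rule simplex_line_derivative[OF \<sigma> g(1) conjunct1[OF c] conjunct1[OF c'] bary_lines(2),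
            where N = "{0<..<1 - s}"])
        (use st d in \<open>auto simp: bary_ge_3 intro: bary_in_standard_simplex\<close>)
    have "local_rep g c c' (chart_map c x) = chart_map c' (g x)"
      using c by (simp add: local_rep_chart_map)
    moreover have "chart_map c x \<in> local_dom g c c'" using c c' by (simp add: local_domI)
    ultimately have 3: "\<omega> c' (chart_map c' (g x)) (?D u) (?D v) = \<omega> c (chart_map c x) u v" for u v
      using preserves_formD[OF g(2) conjunct1[OF c] conjunct1[OF c']] by metis
    show ?thesis
      unfolding form_density_def Let_def comp_def x_def[symmetric] c_def[symmetric] c'_def[symmetric]
      by (simp only: 1 2 3)
  qed
  finally show ?thesis .
qed

lemma integral_cochain_map:
  assumes \<sigma>: "smooth_simplex A 2 \<sigma>" and g: "smooth_self_map A g" "preserves_form A \<omega> g"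
  shows "integral_cochain A \<omega> (simplex_map 2 g \<sigma>) = integral_cochain A \<omega> \<sigma>"
proof -
  have "integral {(s, t). 0 < s \<and> 0 < t \<and> s + t < 1} (\<lambda>(s, t). form_density A \<omega> (simplex_map 2 g \<sigma>) s t)
      = integral {(s, t). 0 < s \<and> 0 < t \<and> s + t < 1} (\<lambda>(s, t). form_density A \<omega> \<sigma> s t)"
    by (rule integral_cong) (auto simp: form_density_map[OF \<sigma> g])
  then show ?thesis
    using \<sigma> smooth_simplex_map[OF \<sigma> g(1)] by (simp add: integral_cochain_def)
qed

end

section \<open>The variation of a primitive of the form\<close>

text \<open>The cocycle \<theta> of the overview, as a function of \<open>g\<close>.\<close>

definition variation ::
    "('a::topological_space, 'e::real_inner) chart set \<Rightarrow> ('a, 'm::ab_group_add) sing_cochain \<Rightarrow>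
      ('a \<Rightarrow> 'a) \<Rightarrow> ('a, 'm) sing_cochain" where
  "variation A \<alpha> g = (\<lambda>\<sigma>. sing_pullback A 1 g \<alpha> \<sigma> - \<alpha> \<sigma>)"

context atlas_space
begin

text \<open>Invertibility of \<open>g\<close> makes both sides vanish when \<open>\<sigma>\<close> is not smooth.\<close>

lemma sing_pullback_eq:
  assumes \<alpha>: "\<alpha> \<in> sing_cochains A p" and g: "g \<in> carrier (Symp A \<omega>)"
    and \<sigma>: "\<sigma> \<in> extensional (standard_simplex p)"
  shows "sing_pullback A p g \<alpha> \<sigma> = \<alpha> (simplex_map p g \<sigma>)"
proof (cases "smooth_simplex A p \<sigma>")
  case False
  have "\<not> smooth_simplex A p (simplex_map p g \<sigma>)"
    using smooth_simplex_map[OF _ SympD(3)[OF g]] simplex_map_inverse[OF bij_is_inj[OF SympD(1)[OF g]] \<sigma>]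
      False by metis
  then show ?thesis using False \<alpha> by (simp add: sing_pullback_def sing_cochains_def)
qed (simp add: sing_pullback_def)

lemma variation_eq:
  assumes "\<alpha> \<in> sing_cochains A 1" "g \<in> carrier (Symp A \<omega>)" "\<sigma> \<in> extensional (standard_simplex 1)"
  shows "variation A \<alpha> g \<sigma> = \<alpha> (simplex_map 1 g \<sigma>) - \<alpha> \<sigma>"
  using sing_pullback_eq[OF assms] by (simp add: variation_def)

lemma singular_face_extensional: "singular_face 2 k \<sigma> \<in> extensional (standard_simplex 1)"
  by (simp add: singular_face_def)

lemma variation_cocycle:
  fixes \<alpha> :: "('a, circle) sing_cochain"
  assumes \<alpha>: "\<alpha> \<in> sing_cochains A 1"
    and d\<alpha>: "sing_coboundary A 1 \<alpha> = (\<lambda>\<sigma>. to_circle (integral_cochain A \<omega> \<sigma>))"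
    and g: "g \<in> carrier (Symp A \<omega>)"
  shows "sing_coboundary A 1 (variation A \<alpha> g) = (\<lambda>_. 0)"
proof
  fix \<sigma> :: "(nat \<Rightarrow> real) \<Rightarrow> 'a"
  show "sing_coboundary A 1 (variation A \<alpha> g) \<sigma> = 0"
  proof (cases "smooth_simplex A 2 \<sigma>")
    case True
    have g\<sigma>: "smooth_simplex A 2 (simplex_map 2 g \<sigma>)"
      by (rule smooth_simplex_map[OF True SympD(2)[OF g]])
    have face: "singular_face 2 k (simplex_map 2 g \<sigma>) = simplex_map 1 g (singular_face 2 k \<sigma>)"
      if "k \<le> 2" for k
      using singular_face_simplex_map_eq[of 2 k g \<sigma>] that by simp
    have "sing_coboundary A 1 (variation A \<alpha> g) \<sigma> =
        sing_coboundary A 1 \<alpha> (simplex_map 2 g \<sigma>) - sing_coboundary A 1 \<alpha> \<sigma>"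
      unfolding sing_coboundary_1_eq[OF True] sing_coboundary_1_eq[OF g\<sigma>]
        variation_eq[OF \<alpha> g singular_face_extensional]
      by (simp add: face algebra_simps del: One_nat_def)
    also have "\<dots> = 0"
      unfolding d\<alpha> using integral_cochain_map[OF True SympD(2,4)[OF g]] by simp
    finally show ?thesis .
  next
    case False
    then show ?thesis by (simp add: sing_coboundary_def numeral_2_eq_2)
  qed
qed

lemma simplex_map_vertex:
  assumes "i \<le> 1"
  shows "simplex_map 1 g \<sigma> (vertex i) = g (\<sigma> (vertex i))"
  using vertex_in_standard_simplex[OF assms] by (simp add: simplex_map_def)

text \<open>Lets a pairing between translated end points be evaluated on the translate of a path
  from \<open>x\<close> to \<open>y\<close>, so that all terms of an identity refer to the same
  \<sigma>.\<close>

lemma path_pairing_image: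
  assumes oc: "one_connected (UNIV :: 'a set)" and \<theta>: "sing_coboundary A 1 \<theta> = (\<lambda>_. 0)"
    and g: "g \<in> carrier (Symp A \<omega>)"
    and \<sigma>: "smooth_simplex A 1 \<sigma>" "\<sigma> (vertex 0) = x" "\<sigma> (vertex 1) = y"
  shows "path_pairing A (g x) (g y) \<theta> = \<theta> (simplex_map 1 g \<sigma>)"
  by (rule path_pairing_eq[OF oc \<theta> smooth_simplex_map[OF \<sigma>(1) SympD(2)[OF g]]])
    (simp_all add: simplex_map_vertex \<sigma> del: One_nat_def)

text \<open>On one path \<sigma> from \<open>x\<close> to \<open>y\<close> the right-hand side
  telescopes: the value of \<alpha> on the image of \<sigma> under \<open>h\<close> cancels.\<close>

lemma path_pairing_variation_compose:
  fixes \<alpha> :: "('a, circle) sing_cochain"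
  assumes oc: "one_connected (UNIV :: 'a set)" and \<alpha>: "\<alpha> \<in> sing_cochains A 1"
    and d\<alpha>: "sing_coboundary A 1 \<alpha> = (\<lambda>\<sigma>. to_circle (integral_cochain A \<omega> \<sigma>))"
    and g: "g \<in> carrier (Symp A \<omega>)" and h: "h \<in> carrier (Symp A \<omega>)"
  shows "path_pairing A x y (variation A \<alpha> (g \<circ> h)) =
    path_pairing A (h x) (h y) (variation A \<alpha> g) + path_pairing A x y (variation A \<alpha> h)"
proof -
  note gh = Symp_closed[OF g h]
  obtain \<sigma> where \<sigma>: "smooth_simplex A 1 \<sigma>" "\<sigma> (vertex 0) = x" "\<sigma> (vertex 1) = y"
    by (rule smooth_path_exists[OF oc])
  note ext = smooth_simplex_extensional[OF \<sigma>(1)]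
    and ext' = smooth_simplex_extensional[OF smooth_simplex_map[OF \<sigma>(1) SympD(2)[OF h]]]
  show ?thesis
    unfolding path_pairing_image[OF oc variation_cocycle[OF \<alpha> d\<alpha> g] h \<sigma>]
      path_pairing_eq[OF oc variation_cocycle[OF \<alpha> d\<alpha> h] \<sigma>]
      path_pairing_eq[OF oc variation_cocycle[OF \<alpha> d\<alpha> gh] \<sigma>]
      variation_eq[OF \<alpha> gh ext] variation_eq[OF \<alpha> h ext] variation_eq[OF \<alpha> g ext']
    by (simp add: simplex_map_compose)
qed

text \<open>The variation is additive in the cochain, and that of \<open>\<beta> - \<alpha>\<close>
  is its pull-back minus itself; in the pairing the pull-back moves to the end points.\<close>

lemma path_pairing_variation_diff:
  fixes \<alpha> \<beta> :: "('a, circle) sing_cochain"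
  assumes oc: "one_connected (UNIV :: 'a set)"
    and \<alpha>: "\<alpha> \<in> sing_cochains A 1" "sing_coboundary A 1 \<alpha> = (\<lambda>\<sigma>. to_circle (integral_cochain A \<omega> \<sigma>))"
    and \<beta>: "\<beta> \<in> sing_cochains A 1" "sing_coboundary A 1 \<beta> = (\<lambda>\<sigma>. to_circle (integral_cochain A \<omega> \<sigma>))"
    and g: "g \<in> carrier (Symp A \<omega>)" and \<eta>: "sing_coboundary A 1 (\<lambda>\<sigma>. \<beta> \<sigma> - \<alpha> \<sigma>) = (\<lambda>_. 0)"
  shows "path_pairing A x y (variation A \<beta> g) = path_pairing A x y (variation A \<alpha> g)
    + (path_pairing A (g x) (g y) (\<lambda>\<sigma>. \<beta> \<sigma> - \<alpha> \<sigma>) - path_pairing A x y (\<lambda>\<sigma>. \<beta> \<sigma> - \<alpha> \<sigma>))"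
proof -
  obtain \<sigma> where \<sigma>: "smooth_simplex A 1 \<sigma>" "\<sigma> (vertex 0) = x" "\<sigma> (vertex 1) = y"
    by (rule smooth_path_exists[OF oc])
  note ext = smooth_simplex_extensional[OF \<sigma>(1)]
  show ?thesis
    unfolding path_pairing_image[OF oc \<eta> g \<sigma>] path_pairing_eq[OF oc \<eta> \<sigma>]
      path_pairing_eq[OF oc variation_cocycle[OF \<alpha> g] \<sigma>]
      path_pairing_eq[OF oc variation_cocycle[OF \<beta> g] \<sigma>]
      variation_eq[OF \<alpha>(1) g ext] variation_eq[OF \<beta>(1) g ext]
    by (simp add: algebra_simps)
qed

end

lemma sing_coboundary_1_diff:
  "sing_coboundary A 1 (\<lambda>\<sigma>. \<beta> \<sigma> - \<alpha> \<sigma>) \<sigma> = sing_coboundary A 1 \<beta> \<sigma> - sing_coboundary A 1 \<alpha> \<sigma>"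
  by (simp add: sing_coboundary_def alt_sign_def algebra_simps)

section \<open>Group cohomology\<close>

lemma grp_coboundary_1_eq:
  assumes "g \<in> carrier G" "h \<in> carrier G"
  shows "grp_coboundary G 1 b [g, h] = b [h] - b [g \<otimes>\<^bsub>G\<^esub> h] + b [g]"
  using assms by (simp add: grp_coboundary_def grp_tuples_def merge_def alt_sign_def)

lemma grp_coboundary_2_eq:
  assumes "g \<in> carrier G" "h \<in> carrier G" "k \<in> carrier G"
  shows "grp_coboundary G 2 a [g, h, k] = a [h, k] - a [g \<otimes>\<^bsub>G\<^esub> h, k] + a [g, h \<otimes>\<^bsub>G\<^esub> k] - a [g, h]"
proof -
  have "{1..2} = {1, 2::nat}" by auto
  then show ?thesis
    using assms by (simp add: grp_coboundary_def grp_tuples_def merge_def alt_sign_def)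
qed

lemma grp_tuples_2E:
  assumes "gs \<in> grp_tuples G 2"
  obtains g h where "gs = [g, h]" "g \<in> carrier G" "h \<in> carrier G"
  using assms by (auto simp: grp_tuples_def length_Suc_conv numeral_2_eq_2)

lemma grp_tuples_3E:
  assumes "gs \<in> grp_tuples G 3"
  obtains g h k where "gs = [g, h, k]" "g \<in> carrier G" "h \<in> carrier G" "k \<in> carrier G"
  using assms by (auto simp: grp_tuples_def length_Suc_conv numeral_3_eq_3)

lemma grp_coboundary_diff:
  "grp_coboundary G p (\<lambda>gs. b gs - c gs) gs = grp_coboundary G p b gs - grp_coboundary G p c gs"
proof -
  have "(\<Sum>i = 1..p. alt_sign i (b (merge G i gs) - c (merge G i gs))) =
      (\<Sum>i = 1..p. alt_sign i (b (merge G i gs))) - (\<Sum>i = 1..p. alt_sign i (c (merge G i gs)))"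
    unfolding sum_subtractf[symmetric] by (intro sum.cong) (auto simp: alt_sign_def)
  then show ?thesis
    by (simp add: grp_coboundary_def) (simp add: alt_sign_def algebra_simps)
qed

text \<open>Adding the coboundary of \<open>e\<close> to \<open>d\<close> is adding that of
  \<open>e - b\<close> to \<open>c\<close>.\<close>

lemma grp_class_subset:
  assumes b: "b \<in> grp_cochains G p" and c: "\<And>gs. c gs = d gs + grp_coboundary G p b gs"
  shows "grp_class G (Suc p) d \<subseteq> grp_class G (Suc p) c"
proof
  fix f assume "f \<in> grp_class G (Suc p) d"
  then obtain e where e: "e \<in> grp_cochains G p" "f = (\<lambda>gs. d gs + grp_coboundary G p e gs)"
    unfolding grp_class_def grp_coboundaries_def by auto
  let ?e = "\<lambda>gs. e gs - b gs"
  have "?e \<in> grp_cochains G p" using b e(1) by (simp add: grp_cochains_def)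
  moreover have "f = (\<lambda>gs. c gs + grp_coboundary G p ?e gs)"
    by (simp add: e(2) c grp_coboundary_diff)
  ultimately show "f \<in> grp_class G (Suc p) c"
    unfolding grp_class_def grp_coboundaries_def by auto
qed

lemma grp_class_eq:
  assumes b: "b \<in> grp_cochains G p" and c: "\<And>gs. c gs = d gs + grp_coboundary G p b gs"
  shows "grp_class G (Suc p) c = grp_class G (Suc p) d"
proof (rule antisym)
  show "grp_class G (Suc p) d \<subseteq> grp_class G (Suc p) c" by (rule grp_class_subset[OF b c])
  \<comment> \<open>The negative of \<open>b\<close> is written as a difference so that
    \<open>grp_coboundary_diff\<close> applies.\<close>
  let ?b = "\<lambda>gs. (\<lambda>_. 0) gs - b gs"
  have "grp_coboundary G p (\<lambda>_. 0 :: 'b) gs = 0" for gs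
    using grp_coboundary_diff[of G p b b gs] by simp
  then have "d gs = c gs + grp_coboundary G p ?b gs" for gs
    unfolding grp_coboundary_diff by (simp add: c)
  moreover have "?b \<in> grp_cochains G p" using b by (simp add: grp_cochains_def)
  ultimately show "grp_class G (Suc p) c \<subseteq> grp_class G (Suc p) d" by (intro grp_class_subset)
qed

lemma symp_cochain_eq:
  assumes "g \<in> carrier (Symp A \<omega>)" "h \<in> carrier (Symp A \<omega>)"
  shows "symp_cochain A \<omega> x \<alpha> [g, h] = path_pairing A x (h x) (variation A \<alpha> g)"
  using assms by (simp add: symp_cochain_def grp_tuples_def variation_def)

theorem proposition3p2:
  fixes A :: "('a::{t2_space,second_countable_topology}, 'e::real_inner) chart set"
    and \<omega> :: "('a, 'e) form2"
    and x\<^sub>0 :: 'a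
    and \<alpha> :: "('a, circle) sing_cochain"
  assumes "symplectic_manifold A \<omega>"
    and "one_connected (UNIV :: 'a set)"
    and "integral_form A \<omega>"
    and "\<alpha> \<in> sing_cochains A 1"
    and "sing_coboundary A 1 \<alpha> = (\<lambda>\<sigma>. to_circle (integral_cochain A \<omega> \<sigma>))"
  shows "symp_cochain A \<omega> x\<^sub>0 \<alpha> \<in> grp_cocycles (Symp A \<omega>) 2 \<and>
    (\<forall>x\<^sub>1. \<forall>\<beta> \<in> sing_cochains A 1.
       sing_coboundary A 1 \<beta> = (\<lambda>\<sigma>. to_circle (integral_cochain A \<omega> \<sigma>)) \<longrightarrow>
       grp_class (Symp A \<omega>) 2 (symp_cochain A \<omega> x\<^sub>1 \<beta>) = grp_class (Symp A \<omega>) 2 (symp_cochain A \<omega> x\<^sub>0 \<alpha>))"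
proof -
  interpret atlas_space A
    using assms(1) by unfold_locales (simp add: symplectic_manifold_def)
  note oc = assms(2) and \<alpha> = assms(4,5)
  note comp = path_pairing_variation_compose[OF oc \<alpha>]
    and trans = path_pairing_trans[OF oc variation_cocycle[OF \<alpha>]]
  show ?thesis
  proof (intro conjI allI ballI impI)
    have "grp_coboundary (Symp A \<omega>) 2 (symp_cochain A \<omega> x\<^sub>0 \<alpha>) gs = 0" for gs
    proof (cases "gs \<in> grp_tuples (Symp A \<omega>) 3")
      case True
      then obtain g h k where gs: "gs = [g, h, k]"
        and ghk: "g \<in> carrier (Symp A \<omega>)" "h \<in> carrier (Symp A \<omega>)" "k \<in> carrier (Symp A \<omega>)"
        by (rule grp_tuples_3E)
      note gh = Symp_closed[OF ghk(1,2)] and hk = Symp_closed[OF ghk(2,3)]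
      \<comment> \<open>By \<open>comp\<close> the value at \<open>[g \<circ> h, k]\<close> is that
        at \<open>[h, k]\<close> plus the integral of \<open>variation A \<alpha> g\<close> from
        \<open>h x\<^sub>0\<close> to \<open>(h \<circ> k) x\<^sub>0\<close>; by
        \<open>trans\<close> the same integral is the difference of the values at
        \<open>[g, h \<circ> k]\<close> and \<open>[g, h]\<close>.\<close>
      show ?thesis
        unfolding gs grp_coboundary_2_eq[OF ghk] Symp_mult symp_cochain_eq[OF ghk(2,3)]
          symp_cochain_eq[OF gh ghk(3)] symp_cochain_eq[OF ghk(1) hk] symp_cochain_eq[OF ghk(1,2)]
          comp[OF ghk(1,2)] trans[OF ghk(1), of x\<^sub>0 "(h \<circ> k) x\<^sub>0" "h x\<^sub>0"]
        by simp
    next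
      case False
      then show ?thesis by (simp add: grp_coboundary_def numeral_3_eq_3 numeral_2_eq_2)
    qed
    then show "symp_cochain A \<omega> x\<^sub>0 \<alpha> \<in> grp_cocycles (Symp A \<omega>) 2"
      by (auto simp: grp_cocycles_def grp_cochains_def symp_cochain_def)
  next
    fix x\<^sub>1 and \<beta> :: "('a, circle) sing_cochain"
    assume \<beta>: "\<beta> \<in> sing_cochains A 1" "sing_coboundary A 1 \<beta> = (\<lambda>\<sigma>. to_circle (integral_cochain A \<omega> \<sigma>))"
    define \<eta> where "\<eta> = (\<lambda>\<sigma>. \<beta> \<sigma> - \<alpha> \<sigma>)"
    have \<eta>: "sing_coboundary A 1 \<eta> = (\<lambda>_. 0)"
      unfolding \<eta>_def by (rule ext) (simp only: sing_coboundary_1_diff \<alpha>(2) \<beta>(2) diff_self)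
    \<comment> \<open>One cochain serves both changes: the first term replaces \<alpha> by \<beta>
      at the base point \<open>x\<^sub>1\<close>, the second moves the base point from
      \<open>x\<^sub>0\<close> to \<open>x\<^sub>1\<close> with \<alpha> fixed.\<close>
    define b where "b gs = (if gs \<in> grp_tuples (Symp A \<omega>) 1
      then - path_pairing A x\<^sub>1 ((gs ! 0) x\<^sub>1) \<eta> - path_pairing A x\<^sub>0 x\<^sub>1 (variation A \<alpha> (gs ! 0)) else 0)" for gs
    have b: "b [g] = - path_pairing A x\<^sub>1 (g x\<^sub>1) \<eta> - path_pairing A x\<^sub>0 x\<^sub>1 (variation A \<alpha> g)"
      if "g \<in> carrier (Symp A \<omega>)" for g
      using that by (simp add: b_def grp_tuples_def)
    have "symp_cochain A \<omega> x\<^sub>1 \<beta> gs = symp_cochain A \<omega> x\<^sub>0 \<alpha> gs + grp_coboundary (Symp A \<omega>) 1 b gs" for gs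
    proof (cases "gs \<in> grp_tuples (Symp A \<omega>) 2")
      case True
      then obtain g h where gs: "gs = [g, h]" and gh: "g \<in> carrier (Symp A \<omega>)" "h \<in> carrier (Symp A \<omega>)"
        by (rule grp_tuples_2E)
      note c = Symp_closed[OF gh]
      have 1: "path_pairing A x\<^sub>1 (h x\<^sub>1) (variation A \<beta> g) = path_pairing A x\<^sub>1 (h x\<^sub>1) (variation A \<alpha> g)
          + (path_pairing A (g x\<^sub>1) (g (h x\<^sub>1)) \<eta> - path_pairing A x\<^sub>1 (h x\<^sub>1) \<eta>)"
        using path_pairing_variation_diff[OF oc \<alpha> \<beta> gh(1)] \<eta> unfolding \<eta>_def by blast
      have 2: "path_pairing A x\<^sub>1 (g (h x\<^sub>1)) \<eta> = path_pairing A x\<^sub>1 (g x\<^sub>1) \<eta> + path_pairing A (g x\<^sub>1) (g (h x\<^sub>1)) \<eta>"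
        by (rule path_pairing_trans[OF oc \<eta>])
      \<comment> \<open>The integral from \<open>x\<^sub>0\<close> to \<open>h x\<^sub>1\<close> is
        split once at \<open>x\<^sub>1\<close> and once at \<open>h x\<^sub>0\<close>; comparison
        isolates the effect of the base point.\<close>
      have 3: "path_pairing A x\<^sub>0 (h x\<^sub>1) (variation A \<alpha> g) =
          path_pairing A x\<^sub>0 x\<^sub>1 (variation A \<alpha> g) + path_pairing A x\<^sub>1 (h x\<^sub>1) (variation A \<alpha> g)"
        "path_pairing A x\<^sub>0 (h x\<^sub>1) (variation A \<alpha> g) =
          path_pairing A x\<^sub>0 (h x\<^sub>0) (variation A \<alpha> g) + path_pairing A (h x\<^sub>0) (h x\<^sub>1) (variation A \<alpha> g)"
        by (rule trans[OF gh(1)])+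
      have 4: "path_pairing A x\<^sub>1 (h x\<^sub>1) (variation A \<alpha> g) = path_pairing A x\<^sub>0 (h x\<^sub>0) (variation A \<alpha> g)
          + path_pairing A (h x\<^sub>0) (h x\<^sub>1) (variation A \<alpha> g) - path_pairing A x\<^sub>0 x\<^sub>1 (variation A \<alpha> g)"
        using 3 by (simp add: algebra_simps)
      \<comment> \<open>In the coboundary of \<open>b\<close> the term at \<open>g \<circ> h\<close>
        is expanded by \<open>comp\<close> and \<open>2\<close>; what remains is cancellation in an
        abelian group.\<close>
      show ?thesis
        unfolding gs grp_coboundary_1_eq[OF gh] Symp_mult symp_cochain_eq[OF gh] b[OF gh(1)] b[OF gh(2)]
          b[OF c] comp[OF gh] comp_apply 1 2 4
        by (simp add: algebra_simps)
    next
      case False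
      then show ?thesis by (simp add: symp_cochain_def grp_coboundary_def numeral_2_eq_2)
    qed
    moreover have "b \<in> grp_cochains (Symp A \<omega>) 1" by (simp add: grp_cochains_def b_def)
    ultimately have "grp_class (Symp A \<omega>) (Suc 1) (symp_cochain A \<omega> x\<^sub>1 \<beta>) =
        grp_class (Symp A \<omega>) (Suc 1) (symp_cochain A \<omega> x\<^sub>0 \<alpha>)"
      by (intro grp_class_eq)
    then show "grp_class (Symp A \<omega>) 2 (symp_cochain A \<omega> x\<^sub>1 \<beta>) = grp_class (Symp A \<omega>) 2 (symp_cochain A \<omega> x\<^sub>0 \<alpha>)"
      by (simp add: numeral_2_eq_2)
  qed
qed

end
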